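(* Let $G$ be a finite group that admits a five-product-avoiding generating set $T=\{a_1,\ldots,a_\ell\}$ such that (i) $|t|>2$ for every $t\in T$, and (ii) $|a_{i+1}a_i^{-1}|>2$ for every $i\in\{1,\ldots,\ell-1\}$. Then $G$ admits an ORR if and only if $G\not\cong Q_8$, $G\not\cong C_3\times C_2^3$ and $G\not\cong C_3\times C_3$.
   Context: $|g|$ denotes the order of $g$; $Q_8$ is the quaternion group of order 8. A generating set $T$ of a group $G$ is five-product-avoiding if $T\cap T^{-1}=\emptyset$ and for all $x,y,z,w,v\in T\cup T^{-1}\cup\{1\}$ we have $xyzwv\notin T\setminus\{x^{\pm1},y^{\pm1},z^{\pm1},w^{\pm1},v^{\pm1}\}$. The Cayley digraph $\mathrm{Cay}(G,S)$ has vertex set $G$ and arcs $(x,y)$ with $yx^{-1}\in S$. $G$ admits an ORR (oriented regular representation) if there is $S\subseteq G$ with $S\cap S^{-1}=\emptyset$ and the full automorphism group of $\mathrm{Cay}(G,S)$ equal to the right regular representation of $G$. *)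

theory Defs
  imports
    "HOL-Algebra.Elementary_Groups"
    "HOL-Algebra.Multiplicative_Group"
    "HOL-Algebra.Bij"
    "Graph_Theory.Pair_Digraph"
begin

(* Integer quaternions: (a, b, c, d) stands for a + b i + c j + d k. *)

fun hamilton_mult :: "int \<times> int \<times> int \<times> int \<Rightarrow> int \<times> int \<times> int \<times> int \<Rightarrow> int \<times> int \<times> int \<times> int"
  where
  "hamilton_mult (a, b, c, d) (a', b', c', d') =
     (a * a' - b * b' - c * c' - d * d',
      a * b' + b * a' + c * d' - d * c',
      a * c' - b * d' + c * a' + d * b',
      a * d' + b * c' - c * b' + d * a')"

definition quaternion_group :: "(int \<times> int \<times> int \<times> int) monoid"  where
  "quaternion_group =
     \<lparr>carrier = {(1,0,0,0), (-1,0,0,0), (0,1,0,0), (0,-1,0,0),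
                 (0,0,1,0), (0,0,-1,0), (0,0,0,1), (0,0,0,-1)},
      monoid.mult = hamilton_mult,
      one = (1,0,0,0)\<rparr>"

definition five_product_avoiding :: "('a, 'b) monoid_scheme \<Rightarrow> 'a set \<Rightarrow> bool"  where
  "five_product_avoiding G T \<longleftrightarrow>
     T \<inter> set_inv\<^bsub>G\<^esub> T = {} \<and>
     (let U = T \<union> set_inv\<^bsub>G\<^esub> T \<union> {\<one>\<^bsub>G\<^esub>} in
      \<forall>x\<in>U. \<forall>y\<in>U. \<forall>z\<in>U. \<forall>w\<in>U. \<forall>v\<in>U.
        x \<otimes>\<^bsub>G\<^esub> y \<otimes>\<^bsub>G\<^esub> z \<otimes>\<^bsub>G\<^esub> w \<otimes>\<^bsub>G\<^esub> v \<notin>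
          T - {x, inv\<^bsub>G\<^esub> x, y, inv\<^bsub>G\<^esub> y, z, inv\<^bsub>G\<^esub> z, w, inv\<^bsub>G\<^esub> w, v, inv\<^bsub>G\<^esub> v})"

definition Cay :: "('a, 'b) monoid_scheme \<Rightarrow> 'a set \<Rightarrow> 'a pair_pre_digraph"  where
  "Cay G S =
     \<lparr>pverts = carrier G,
      parcs = {(x, y). x \<in> carrier G \<and> y \<in> carrier G \<and> y \<otimes>\<^bsub>G\<^esub> inv\<^bsub>G\<^esub> x \<in> S}\<rparr>"

(* Permutations of a vertex set are represented by extensional functions, i.e. by elements
   of the carrier of BijGroup, so that two of them are equal iff they agree on the vertices. *)

definition digraph_automorphisms :: "'a pair_pre_digraph \<Rightarrow> ('a \<Rightarrow> 'a) set"  where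
  "digraph_automorphisms D =
     {f \<in> Bij (pverts D).
        \<forall>u\<in>pverts D. \<forall>v\<in>pverts D. (u, v) \<in> parcs D \<longleftrightarrow> (f u, f v) \<in> parcs D}"

definition right_regular_representation :: "('a, 'b) monoid_scheme \<Rightarrow> ('a \<Rightarrow> 'a) set"  where
  "right_regular_representation G =
     (\<lambda>g. \<lambda>x\<in>carrier G. x \<otimes>\<^bsub>G\<^esub> g) ` carrier G"

definition admits_ORR :: "('a, 'b) monoid_scheme \<Rightarrow> bool"  where
  "admits_ORR G \<longleftrightarrow>
     (\<exists>S \<subseteq> carrier G. S \<inter> set_inv\<^bsub>G\<^esub> S = {} \<and>
        digraph_automorphisms (Cay G S) = right_regular_representation G)"

end

theory Submission
  imports Defs
begin

text \<open>
  Let \<open>A\<close> be the group of automorphisms of $\mathrm{Cay}(G, S)$ that fix the identity. The elements of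
  \<open>G\<close> fixed by every member of \<open>A\<close> form a subgroup, so it suffices that \<open>A\<close> fixes a generating set
  pointwise; and \<open>A\<close> acts on the digraph that $\mathrm{Cay}(G, S)$ induces on \<open>S\<close>.

  Let \<open>S\<close> consist of \<open>T\<close> and of the quotients $y x^{-1}$ for the edges $(x, y)$ of an oriented
  triangle-free graph on \<open>T\<close>. An arc of the induced digraph amounts to a relation of length at most six
  in the generators, and five-product-avoidance says that every letter of such a relation occurs at
  least twice. This leaves the arcs $x \to y$ and possibly some arcs between $y x^{-1}$ and \<open>x\<close>, \<open>y\<close>,
  which are governed by whether \<open>x\<close> and \<open>y\<close> commute, have equal squares, or \<open>y\<close> inverts \<open>x\<close>.
  For at least four generators, the path $a_1 \to a_2 \to \dots \to a_\ell$ makes the digraph rigid when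
  $a_1, a_2$ do not commute, and the path with its first edge reversed does so when they commute. For two
  or three generators the same sets work except in a few configurations, where one adds products of two
  generators; the configurations that remain are the three exceptional groups.

  In the exceptional groups every \<open>S\<close> with $S \cap S^{-1} = \emptyset$ is invariant under a nontrivial
  group automorphism.
\<close>

text \<open>The bound six comes from arcs between two quotients: such an arc equates products of
  three quotients of two letters each, and solving for one letter leaves a product of five.
  Triangles are excluded because (z y^{-1})(y x^{-1}) = z x^{-1} holds in every group; condition
  (ii) keeps a quotient from being its own inverse. The obstacle is commutation. If x and y commute,
  then x and y x^{-1} both have an arc to y; in a free abelian group, exchanging these two while
  fixing y and the later generators is an automorphism preserving the set of the path. Reversing the
  edge removes this symmetry, since x y^{-1} would have to be exchanged with y, which has a further
  arc to the next generator. With at most three generators the reversed graph has no vertex with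
  both an incoming and an outgoing edge, so commuting pairs call for products such as xy or x^2. Q_8
  appears when xyx = y and x^2 = y^2 close x, y, y x^{-1} to a directed triangle, C_3 x C_3 when two
  commuting generators have order three, and C_3 x C_2^3 when x^2 = z^2 = y^{-2} and y has order
  six.\<close>

context group
begin

section \<open>Identities in an arbitrary group\<close>

lemma cancel_inv:
  assumes "x \<in> carrier G" "y \<in> carrier G"
  shows "x \<otimes> (inv x \<otimes> y) = y" "inv x \<otimes> (x \<otimes> y) = y"
  using assms by (simp_all add: m_assoc [symmetric])

lemma mult_relator:
  assumes "v \<otimes> inv u = s" "v \<in> carrier G" "u \<in> carrier G" "s \<in> carrier G"
  shows "v \<otimes> (inv u \<otimes> inv s) = \<one>"
  using assms by (metis inv_closed m_assoc r_inv)

lemma mult_inv_eq_self: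
  assumes "a \<otimes> inv b = a" "a \<in> carrier G" "b \<in> carrier G" shows "b = \<one>"
proof -
  have "inv a \<otimes> (a \<otimes> inv b) = \<one>" using assms by simp
  then show ?thesis using assms(2,3) by (simp add: cancel_inv)
qed

lemma inv_mult_eq_iff:
  assumes "x \<in> carrier G" "y \<in> carrier G" "z \<in> carrier G"
  shows "x \<otimes> y = z \<longleftrightarrow> y = inv x \<otimes> z" "x \<otimes> y = z \<longleftrightarrow> x = z \<otimes> inv y"
  using assms by (auto simp: cancel_inv m_assoc)

text \<open>The equation xyx = y is the form in which "y inverts x by conjugation" appears
  throughout.\<close>

lemma inverts_iff:
  assumes "x \<in> carrier G" "y \<in> carrier G"
  shows "x \<otimes> y \<otimes> x = y \<longleftrightarrow> x \<otimes> y = y \<otimes> inv x" "x \<otimes> y \<otimes> x = y \<longleftrightarrow> y \<otimes> x = inv x \<otimes> y"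
  using inv_mult_eq_iff(2) [of "x \<otimes> y" x y] inv_mult_eq_iff(1) [of x "y \<otimes> x" y] assms
  by (simp_all add: m_assoc)

text \<open>A quotient with trivial square gives x = y x^{-1} y; multiplying by y and replacing y^2
  by x^2 yields yx = xy. Hence noncommuting elements with equal squares may always be joined by an
  edge.\<close>

lemma square_quotient_eq_one_commutes:
  assumes xy: "x \<in> carrier G" "y \<in> carrier G" and "x \<otimes> x = y \<otimes> y"
    and "(y \<otimes> inv x) \<otimes> (y \<otimes> inv x) = \<one>"
  shows "x \<otimes> y = y \<otimes> x"
proof -
  have "y \<otimes> inv x = inv (y \<otimes> inv x)"
    using inv_equality [OF assms(4)] xy by simp
  then have 1: "y \<otimes> inv x = x \<otimes> inv y" using xy by (simp add: inv_mult_group)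
  then have "x = y \<otimes> inv x \<otimes> y" using xy by (simp add: m_assoc)
  then have "y \<otimes> x = (y \<otimes> y) \<otimes> inv x \<otimes> y" using xy by (simp add: m_assoc)
  also have "\<dots> = x \<otimes> x \<otimes> inv x \<otimes> y" using assms(3) by simp
  also have "\<dots> = x \<otimes> y" using xy by (simp add: m_assoc)
  finally show ?thesis by simp
qed

text \<open>The square of the quotient is y^2 x^{-2} under commutation. Condition (ii) therefore
  prevents consecutive generators from commuting and having equal squares.\<close>

lemma commuting_square_quotient_eq_one:
  assumes xy: "x \<in> carrier G" "y \<in> carrier G" and "x \<otimes> x = y \<otimes> y" and c: "x \<otimes> y = y \<otimes> x"
  shows "(y \<otimes> inv x) \<otimes> (y \<otimes> inv x) = \<one>"
proof -
  have "y = inv x \<otimes> (y \<otimes> x)" using xy c by (simp add: cancel_inv flip: c)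
  then have i: "inv x \<otimes> y = y \<otimes> inv x" using xy by (metis inv_closed inv_mult_eq_iff(2) m_assoc m_closed)
  have "(y \<otimes> inv x) \<otimes> (y \<otimes> inv x) = y \<otimes> (inv x \<otimes> y) \<otimes> inv x"
    using xy by (simp add: m_assoc)
  also have "\<dots> = (y \<otimes> y) \<otimes> (inv x \<otimes> inv x)"
    unfolding i using xy by (simp add: m_assoc)
  also have "\<dots> = \<one>"
    unfolding assms(3) [symmetric] using xy by (simp add: m_assoc cancel_inv)
  finally show ?thesis .
qed

lemma quotient_square_swap:
  assumes "x \<in> carrier G" "y \<in> carrier G" "(y \<otimes> inv x) \<otimes> (y \<otimes> inv x) \<noteq> \<one>"
  shows "(x \<otimes> inv y) \<otimes> (x \<otimes> inv y) \<noteq> \<one>"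
proof
  assume "(x \<otimes> inv y) \<otimes> (x \<otimes> inv y) = \<one>"
  then have "inv ((x \<otimes> inv y) \<otimes> (x \<otimes> inv y)) = \<one>" by simp
  then show False using assms by (simp add: inv_mult_group m_assoc)
qed

end

section \<open>Automorphisms of Cayley digraphs fixing the identity\<close>

definition cayley_stabilizer :: "('a, 'b) monoid_scheme \<Rightarrow> 'a set \<Rightarrow> ('a \<Rightarrow> 'a) set" where
  "cayley_stabilizer G S = {\<psi> \<in> digraph_automorphisms (Cay G S). \<psi> \<one>\<^bsub>G\<^esub> = \<one>\<^bsub>G\<^esub>}"

definition cayley_fixed :: "('a, 'b) monoid_scheme \<Rightarrow> 'a set \<Rightarrow> 'a set" where
  "cayley_fixed G S = {h \<in> carrier G. \<forall>\<psi>\<in>cayley_stabilizer G S. \<psi> h = h}"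

context group
begin

lemma digraph_automorphisms_Cay_iff:
  "\<phi> \<in> digraph_automorphisms (Cay G S) \<longleftrightarrow>
     \<phi> \<in> extensional (carrier G) \<and> bij_betw \<phi> (carrier G) (carrier G) \<and>
     (\<forall>u\<in>carrier G. \<forall>v\<in>carrier G. v \<otimes> inv u \<in> S \<longleftrightarrow> \<phi> v \<otimes> inv (\<phi> u) \<in> S)"
  unfolding digraph_automorphisms_def Cay_def Bij_def
  by simp (use bij_betwE in \<open>blast\<close>)

lemma right_mult_difference:
  "\<lbrakk>u \<in> carrier G; v \<in> carrier G; g \<in> carrier G\<rbrakk> \<Longrightarrow> (v \<otimes> g) \<otimes> inv (u \<otimes> g) = v \<otimes> inv u"
  by (simp add: inv_mult_group m_assoc cancel_inv)

lemma right_mult_bij: "g \<in> carrier G \<Longrightarrow> bij_betw (\<lambda>x. x \<otimes> g) (carrier G) (carrier G)"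
  by (rule bij_betwI [where g = "\<lambda>x. x \<otimes> inv g"]) (auto simp: m_assoc)

lemma right_mult_automorphism:
  "g \<in> carrier G \<Longrightarrow> (\<lambda>x\<in>carrier G. x \<otimes> g) \<in> digraph_automorphisms (Cay G S)"
  unfolding digraph_automorphisms_Cay_iff
  by (simp add: right_mult_difference bij_betw_restrict_eq right_mult_bij)

text \<open>Right translations leave v u^{-1} unchanged. Translating by h before applying \<phi>,
  and by the inverse of \<phi>(h) afterwards, brings the identity back to itself.\<close>

lemma automorphism_conjugate:
  assumes \<phi>: "\<phi> \<in> digraph_automorphisms (Cay G S)" and h: "h \<in> carrier G"
  shows "(\<lambda>x\<in>carrier G. \<phi> (x \<otimes> h) \<otimes> inv (\<phi> h)) \<in> cayley_stabilizer G S"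
proof -
  have b: "bij_betw \<phi> (carrier G) (carrier G)"
    and ar: "\<And>u v. u \<in> carrier G \<Longrightarrow> v \<in> carrier G \<Longrightarrow>
       v \<otimes> inv u \<in> S \<longleftrightarrow> \<phi> v \<otimes> inv (\<phi> u) \<in> S"
    using \<phi> by (auto simp: digraph_automorphisms_Cay_iff)
  have c: "\<And>u. u \<in> carrier G \<Longrightarrow> \<phi> u \<in> carrier G"
    using b by (auto simp: bij_betw_def)
  have "bij_betw (\<lambda>x. \<phi> (x \<otimes> h) \<otimes> inv (\<phi> h)) (carrier G) (carrier G)"
    using bij_betw_trans [OF bij_betw_trans [OF right_mult_bij [OF h] b]
        right_mult_bij [OF inv_closed [OF c [OF h]]]] by (simp add: comp_def)
  moreover have "v \<otimes> inv u \<in> S \<longleftrightarrow> \<phi> (v \<otimes> h) \<otimes> inv (\<phi> (u \<otimes> h)) \<in> S"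
    if "u \<in> carrier G" "v \<in> carrier G" for u v
    using ar [of "u \<otimes> h" "v \<otimes> h"] that h by (simp add: right_mult_difference)
  ultimately show ?thesis
    unfolding cayley_stabilizer_def digraph_automorphisms_Cay_iff
    using h c by (simp add: bij_betw_restrict_eq right_mult_difference)
qed

text \<open>A fixed element s is also fixed by the conjugate of \<psi> at h, which says \<psi>(s h)
  = s \<psi>(h). Taking h = s^{-1} gives inverses, and taking h fixed gives products.\<close>

lemma cayley_fixed_subgroup: "subgroup (cayley_fixed G S) G"
proof -
  have inv: "\<psi> (inv s) = inv s"
    if s: "s \<in> cayley_fixed G S" and \<psi>: "\<psi> \<in> cayley_stabilizer G S" for s \<psi>
  proof -
    have sc: "s \<in> carrier G" using s by (simp add: cayley_fixed_def)
    have \<psi>': "\<psi> \<in> digraph_automorphisms (Cay G S)" "\<psi> \<one> = \<one>"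
      using \<psi> by (auto simp: cayley_stabilizer_def)
    then have c: "\<psi> (inv s) \<in> carrier G"
      using sc by (auto simp: digraph_automorphisms_Cay_iff bij_betw_def)
    have "\<psi> (s \<otimes> inv s) \<otimes> inv (\<psi> (inv s)) = s"
      using automorphism_conjugate [OF \<psi>'(1) inv_closed [OF sc]] s sc
      by (force simp: cayley_fixed_def)
    then show ?thesis
      using sc c \<psi>'(2) by (metis inv_closed inv_inv l_one r_inv)
  qed
  have mult: "\<psi> (s \<otimes> h) = s \<otimes> h"
    if s: "s \<in> cayley_fixed G S" and h: "h \<in> cayley_fixed G S"
      and \<psi>: "\<psi> \<in> cayley_stabilizer G S" for s h \<psi>
  proof -
    have sc: "s \<in> carrier G" "h \<in> carrier G" "\<psi> h = h"
      using s h \<psi> by (auto simp: cayley_fixed_def)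
    have \<psi>': "\<psi> \<in> digraph_automorphisms (Cay G S)" "\<psi> \<one> = \<one>"
      using \<psi> by (auto simp: cayley_stabilizer_def)
    then have c: "\<psi> (s \<otimes> h) \<in> carrier G"
      using sc by (auto simp: digraph_automorphisms_Cay_iff bij_betw_def)
    have "\<psi> (s \<otimes> h) \<otimes> inv h = s"
      using automorphism_conjugate [OF \<psi>'(1) sc(2)] s sc by (force simp: cayley_fixed_def)
    then show ?thesis
      using sc c by (metis inv_solve_right)
  qed
  show ?thesis
    by (rule subgroupI)
      (use inv mult in \<open>auto simp: cayley_fixed_def cayley_stabilizer_def\<close>)
qed

text \<open>The conjugate of an automorphism \<phi> at the identity lies in the stabilizer, hence is
  trivial, so \<phi>(x) = x \<phi>(1). The condition on products includes \<open>s = t\<close> and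
  amounts to disjointness of S from its inverses.\<close>

lemma admits_ORR_if_fixed:
  assumes S: "S \<subseteq> carrier G" "\<And>s t. s \<in> S \<Longrightarrow> t \<in> S \<Longrightarrow> s \<otimes> t \<noteq> \<one>"
    and X: "X \<subseteq> cayley_fixed G S" "generate G X = carrier G"
  shows "admits_ORR G"
proof -
  have all: "carrier G \<subseteq> cayley_fixed G S"
    using generate_subgroup_incl [OF X(1) cayley_fixed_subgroup] X(2) by simp
  have "\<phi> \<in> right_regular_representation G"
    if \<phi>: "\<phi> \<in> digraph_automorphisms (Cay G S)" for \<phi>
  proof -
    have c: "\<phi> x \<in> carrier G" if "x \<in> carrier G" for x
      using \<phi> that by (auto simp: digraph_automorphisms_Cay_iff bij_betw_def)
    have "\<phi> x \<otimes> inv (\<phi> \<one>) = x" if "x \<in> carrier G" for x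
      using automorphism_conjugate [OF \<phi> one_closed] all that by (force simp: cayley_fixed_def)
    then have eq: "\<phi> x = x \<otimes> \<phi> \<one>" if "x \<in> carrier G" for x
      using that c by (metis inv_solve_right one_closed)
    have "\<phi> = (\<lambda>x\<in>carrier G. x \<otimes> \<phi> \<one>)"
    proof (rule extensionalityI)
      show "\<phi> \<in> extensional (carrier G)"
        using \<phi> by (simp add: digraph_automorphisms_Cay_iff)
      show "\<phi> x = (\<lambda>x\<in>carrier G. x \<otimes> \<phi> \<one>) x" if "x \<in> carrier G" for x
        using eq [OF that] that by (metis restrict_apply')
    qed simp
    then show ?thesis
      using c unfolding right_regular_representation_def by blast
  qed
  moreover have "right_regular_representation G \<subseteq> digraph_automorphisms (Cay G S)"
    using right_mult_automorphism by (auto simp: right_regular_representation_def)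
  moreover have "S \<inter> set_inv S = {}"
    using S r_inv l_inv unfolding SET_INV_def by blast
  ultimately show ?thesis
    using S(1) unfolding admits_ORR_def by blast
qed

lemma stabilizer_arc_iff:
  assumes "\<psi> \<in> cayley_stabilizer G S" "u \<in> carrier G" "v \<in> carrier G"
  shows "\<psi> v \<otimes> inv (\<psi> u) \<in> S \<longleftrightarrow> v \<otimes> inv u \<in> S"
  using assms by (auto simp: cayley_stabilizer_def digraph_automorphisms_Cay_iff)

lemma stabilizer_closed:
  "\<psi> \<in> cayley_stabilizer G S \<Longrightarrow> u \<in> carrier G \<Longrightarrow> \<psi> u \<in> carrier G"
  by (auto simp: cayley_stabilizer_def digraph_automorphisms_Cay_iff bij_betw_def)

lemma stabilizer_inj:
  "\<psi> \<in> cayley_stabilizer G S \<Longrightarrow> u \<in> carrier G \<Longrightarrow> v \<in> carrier G \<Longrightarrow> \<psi> u = \<psi> v \<longleftrightarrow> u = v"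
  by (auto simp: cayley_stabilizer_def digraph_automorphisms_Cay_iff bij_betw_def inj_on_def)

text \<open>The connection set is the out-neighbourhood of the identity, which the stabilizer
  fixes.\<close>

lemma stabilizer_connection_set:
  assumes "\<psi> \<in> cayley_stabilizer G S" "u \<in> carrier G"
  shows "\<psi> u \<in> S \<longleftrightarrow> u \<in> S"
  using stabilizer_arc_iff [OF assms(1) one_closed assms(2)] assms stabilizer_closed
  by (auto simp: cayley_stabilizer_def)

lemma stab_S:
  assumes "\<psi> \<in> cayley_stabilizer G S" "S \<subseteq> carrier G"
  shows "u \<in> S \<Longrightarrow> \<psi> u \<in> S"
    and "u \<in> S \<Longrightarrow> v \<in> S \<Longrightarrow> \<psi> u = \<psi> v \<longleftrightarrow> u = v"
    and "u \<in> S \<Longrightarrow> v \<in> S \<Longrightarrow> v \<otimes> inv u \<in> S \<Longrightarrow> \<psi> v \<otimes> inv (\<psi> u) \<in> S"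
proof -
  show "u \<in> S \<Longrightarrow> \<psi> u \<in> S"
    using stabilizer_connection_set [OF assms(1), of u] assms(2) by blast
  show "u \<in> S \<Longrightarrow> v \<in> S \<Longrightarrow> \<psi> u = \<psi> v \<longleftrightarrow> u = v"
    using stabilizer_inj [OF assms(1), of u v] assms(2) by blast
  show "u \<in> S \<Longrightarrow> v \<in> S \<Longrightarrow> v \<otimes> inv u \<in> S \<Longrightarrow> \<psi> v \<otimes> inv (\<psi> u) \<in> S"
    using stabilizer_arc_iff [OF assms(1), of u v] assms(2) by blast
qed

end

section \<open>Words in a five-product-avoiding set\<close>

text \<open>A word is a list of letters; the flag \<open>False\<close> marks an inverted letter.\<close>

primrec word :: "('a, 'b) monoid_scheme \<Rightarrow> ('a \<times> bool) list \<Rightarrow> 'a" where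
  "word G [] = \<one>\<^bsub>G\<^esub>"
| "word G (w # ws) = (if snd w then fst w else inv\<^bsub>G\<^esub> (fst w)) \<otimes>\<^bsub>G\<^esub> word G ws"

definition word_inv :: "('a \<times> bool) list \<Rightarrow> ('a \<times> bool) list" where
  "word_inv ws = rev (map (\<lambda>(t, s). (t, \<not> s)) ws)"

lemma fst_word_inv: "map fst (word_inv ws) = rev (map fst ws)"
  by (simp add: word_inv_def rev_map case_prod_unfold)

lemma length_word_inv [simp]: "length (word_inv ws) = length ws"
  by (simp add: word_inv_def)

context group
begin

lemma word_closed: "fst ` set ws \<subseteq> carrier G \<Longrightarrow> word G ws \<in> carrier G"
  by (induction ws) auto

lemma word_append:
  "fst ` set us \<subseteq> carrier G \<Longrightarrow> fst ` set vs \<subseteq> carrier G \<Longrightarrow>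
     word G (us @ vs) = word G us \<otimes> word G vs"
  by (induction us) (auto simp: m_assoc word_closed)

lemma word_word_inv: "fst ` set ws \<subseteq> carrier G \<Longrightarrow> word G (word_inv ws) = inv (word G ws)"
proof (induction ws)
  case (Cons w ws)
  then have "word G (word_inv ws @ [(fst w, \<not> snd w)]) =
      word G (word_inv ws) \<otimes> word G [(fst w, \<not> snd w)]"
    by (intro word_append) (auto simp: word_inv_def)
  with Cons show ?case
    by (cases w) (auto simp: word_inv_def inv_mult_group word_closed)
qed (simp add: word_inv_def)

end

locale avoiding = group G for G (structure) +
  fixes T
  assumes letters: "T \<subseteq> carrier G"
    and five_avoiding: "five_product_avoiding G T"
    and square_neq_one: "t \<in> T \<Longrightarrow> t \<otimes> t \<noteq> \<one>"
begin

lemma letter_closed [simp, intro]: "t \<in> T \<Longrightarrow> t \<in> carrier G"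
  using letters by blast

lemma letter_neq_one: "t \<in> T \<Longrightarrow> t \<noteq> \<one>"
  using square_neq_one by force

lemma inv_not_letter: "t \<in> T \<Longrightarrow> inv t \<notin> T"
  using five_avoiding unfolding five_product_avoiding_def SET_INV_def by blast

text \<open>As T meets neither its inverses nor the identity, a letter outside L differs from every
  element of U and from its inverse; this is the exclusion that avoidance asks for.\<close>

lemma five_letters:
  assumes L: "L \<subseteq> T" and t: "t \<in> T"
    and U: "U = L \<union> (\<lambda>x. inv x) ` L \<union> {\<one>}"
    and x: "x1 \<in> U" "x2 \<in> U" "x3 \<in> U" "x4 \<in> U" "x5 \<in> U"
    and eq: "t = x1 \<otimes> x2 \<otimes> x3 \<otimes> x4 \<otimes> x5"
  shows "t \<in> L"
proof (rule ccontr)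
  assume n: "t \<notin> L"
  have U': "U \<subseteq> T \<union> set_inv T \<union> {\<one>}"
    using L U unfolding SET_INV_def by blast
  have "t \<notin> {x, inv x}" if "x \<in> U" for x
    using that n t L U letter_neq_one [OF t] inv_not_letter letters by (auto simp: subset_iff)
  then have "t \<in> T - {x1, inv x1, x2, inv x2, x3, inv x3, x4, inv x4, x5, inv x5}"
    using t x by blast
  moreover have "x1 \<otimes> x2 \<otimes> x3 \<otimes> x4 \<otimes> x5 \<notin>
      T - {x1, inv x1, x2, inv x2, x3, inv x3, x4, inv x4, x5, inv x5}"
    using five_avoiding x U' unfolding five_product_avoiding_def Let_def by blast
  ultimately show False
    using eq by simp
qed

text \<open>An empty word contributes the identity, so that five peelings write every word of length
  at most five as a product of exactly five factors.\<close>

lemma word_peel: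
  assumes "length ws \<le> Suc n"
  obtains x ws' where "word G ws = x \<otimes> word G ws'" "length ws' \<le> n" "set ws' \<subseteq> set ws"
    "x \<in> fst ` set ws \<union> (\<lambda>x. inv x) ` fst ` set ws \<union> {\<one>}"
proof (cases ws)
  case Nil
  then show ?thesis using that [of \<one> "[]"] by simp
next
  case (Cons w vs)
  then show ?thesis
    using that [of "if snd w then fst w else inv (fst w)" vs] assms by (cases "snd w") auto
qed

lemma short_word_letter:
  assumes ws: "length ws \<le> 5" "fst ` set ws \<subseteq> T" and t: "t \<in> T" "word G ws = t"
  shows "t \<in> fst ` set ws"
proof -
  let ?U = "\<lambda>ws. fst ` set ws \<union> (\<lambda>x. inv x) ` fst ` set ws \<union> {\<one>}"
  have mono: "set us \<subseteq> set vs \<Longrightarrow> ?U us \<subseteq> ?U vs" for us vs :: "('a \<times> bool) list"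
    by blast
  obtain x1 ws1 where 1: "word G ws = x1 \<otimes> word G ws1" "length ws1 \<le> 4" "set ws1 \<subseteq> set ws"
    "x1 \<in> ?U ws" using word_peel [of ws 4] ws by auto
  obtain x2 ws2 where 2: "word G ws1 = x2 \<otimes> word G ws2" "length ws2 \<le> 3" "set ws2 \<subseteq> set ws1"
    "x2 \<in> ?U ws1" using word_peel [of ws1 3] 1 by auto
  obtain x3 ws3 where 3: "word G ws2 = x3 \<otimes> word G ws3" "length ws3 \<le> 2" "set ws3 \<subseteq> set ws2"
    "x3 \<in> ?U ws2" using word_peel [of ws2 2] 2 by auto
  obtain x4 ws4 where 4: "word G ws3 = x4 \<otimes> word G ws4" "length ws4 \<le> 1" "set ws4 \<subseteq> set ws3"
    "x4 \<in> ?U ws3" using word_peel [of ws3 1] 3 by auto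
  obtain x5 ws5 where 5: "word G ws4 = x5 \<otimes> word G ws5" "length ws5 \<le> 0" "set ws5 \<subseteq> set ws4"
    "x5 \<in> ?U ws4" using word_peel [of ws4 0] 4 by auto
  have sub: "set ws2 \<subseteq> set ws" "set ws3 \<subseteq> set ws" "set ws4 \<subseteq> set ws"
    using 1(3) 2(3) 3(3) 4(3) by (meson subset_trans)+
  note U = 1(4) subsetD [OF mono [OF 1(3)] 2(4)] subsetD [OF mono [OF sub(1)] 3(4)]
    subsetD [OF mono [OF sub(2)] 4(4)] subsetD [OF mono [OF sub(3)] 5(4)]
  have "?U ws \<subseteq> carrier G"
    using ws(2) letters by auto
  then have "x1 \<in> carrier G" "x2 \<in> carrier G" "x3 \<in> carrier G" "x4 \<in> carrier G" "x5 \<in> carrier G"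
    using U by (meson subsetD)+
  then have "t = x1 \<otimes> x2 \<otimes> x3 \<otimes> x4 \<otimes> x5"
    using 1(1) 2(1) 3(1) 4(1) 5(1,2) t(2) by (simp add: m_assoc)
  then show ?thesis
    by (rule five_letters [OF ws(2) t(1) refl U])
qed

text \<open>One occurrence of t can be isolated: t, or its inverse, becomes a product of the at most
  five other letters, and avoidance puts t among them.\<close>

lemma relator_letter_twice:
  assumes ws: "word G ws = \<one>" "length ws \<le> 6" "fst ` set ws \<subseteq> T" and t: "t \<in> fst ` set ws"
  shows "2 \<le> count_list (map fst ws) t"
proof -
  obtain s where "(t, s) \<in> set ws" using t by auto
  then obtain us vs where sp: "ws = us @ (t, s) # vs" by (auto simp: in_set_conv_decomp)
  have T: "fst ` set us \<subseteq> T" "fst ` set vs \<subseteq> T" "t \<in> T" using ws(3) sp by auto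
  then have C: "fst ` set us \<subseteq> carrier G" "fst ` set vs \<subseteq> carrier G" "t \<in> carrier G"
    using letters by auto
  have W: "word G us \<in> carrier G" "word G vs \<in> carrier G"
    using C word_closed by blast+
  define z where "z = (if s then t else inv t)"
  have z: "z \<in> carrier G" using C by (simp add: z_def)
  have "word G us \<otimes> (z \<otimes> word G vs) = \<one>"
    using ws(1) C sp word_append [of us "(t, s) # vs"] by (cases s) (simp_all add: z_def)
  then have "inv (word G us) \<otimes> (word G us \<otimes> (z \<otimes> word G vs)) \<otimes> inv (word G vs) =
      inv (word G us) \<otimes> \<one> \<otimes> inv (word G vs)"
    by simp
  then have eq: "z = inv (word G us) \<otimes> inv (word G vs)"
    using W z by (simp add: cancel_inv m_assoc)
  have "t \<in> fst ` (set us \<union> set vs)"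
  proof (cases s)
    case True
    have 1: "map fst (word_inv us @ word_inv vs) = rev (map fst us) @ rev (map fst vs)"
      by (simp add: fst_word_inv)
    then have 2: "fst ` set (word_inv us @ word_inv vs) = fst ` (set us \<union> set vs)"
      by (metis image_Un set_append set_map set_rev)
    have 3: "fst ` set (word_inv us) = fst ` set us" "fst ` set (word_inv vs) = fst ` set vs"
      by (metis fst_word_inv set_map set_rev)+
    have "word G (word_inv us @ word_inv vs) = t"
      using eq True z_def C 3 by (simp add: word_append word_word_inv)
    then have "t \<in> fst ` set (word_inv us @ word_inv vs)"
      using T ws(2) sp 2 by (intro short_word_letter) auto
    then show ?thesis using 2 by blast
  next
    case False
    \<comment> \<open>For an inverted letter, t itself is the rest of the relator read cyclically
      from behind that letter.\<close>
    have "inv t = inv (word G vs \<otimes> word G us)"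
      using eq False z_def W by (simp add: inv_mult_group)
    then have "word G (vs @ us) = t"
      using C W by (metis inv_inv m_closed word_append)
    then have "t \<in> fst ` set (vs @ us)"
      using T ws(2) sp by (intro short_word_letter) auto
    then show ?thesis by auto
  qed
  then have "t \<in> set (map fst us @ map fst vs)" by auto
  then have "count_list (map fst us @ map fst vs) t \<noteq> 0"
    by (simp only: count_list_0_iff not_not)
  then show ?thesis using sp by auto
qed

lemma word_eq_letter_twice:
  assumes "word G us = word G vs" "length us + length vs \<le> 6"
    and T: "fst ` set (us @ vs) \<subseteq> T" and t: "t \<in> fst ` set (us @ vs)"
  shows "2 \<le> count_list (map fst (us @ vs)) t"
proof -
  have 3: "fst ` set (word_inv vs) = fst ` set vs"
    by (metis fst_word_inv set_map set_rev)
  have C: "fst ` set us \<subseteq> carrier G" "fst ` set vs \<subseteq> carrier G"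
    using T letters by auto
  then have "word G (us @ word_inv vs) = \<one>"
    using assms(1) 3 by (simp add: word_append word_word_inv word_closed)
  then have "2 \<le> count_list (map fst (us @ word_inv vs)) t"
    using assms(2) T t 3 by (intro relator_letter_twice) (auto simp: image_Un)
  then show ?thesis by (simp add: fst_word_inv)
qed

text \<open>For each length up to six the count is restated as membership in the list of the other
  letters, a form that splits into finitely many equalities.\<close>

lemma relator2:
  assumes "word G [(p1,s1),(p2,s2)] = \<one>" "{p1,p2} \<subseteq> T"
  shows "p1 = p2"
  using assms relator_letter_twice [OF assms(1), of p1]
  by (auto split: if_splits)

lemma relator3:
  assumes "word G [(p1,s1),(p2,s2),(p3,s3)] = \<one>" "{p1,p2,p3} \<subseteq> T"
  shows "p1 \<in> {p2,p3}" "p2 \<in> {p1,p3}" "p3 \<in> {p1,p2}"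
proof -
  have "2 \<le> count_list [p1,p2,p3] t" if "t \<in> {p1,p2,p3}" for t
    using relator_letter_twice [OF assms(1), of t] assms(2) that by auto
  from this [of p1] this [of p2] this [of p3]
  show "p1 \<in> {p2,p3}" "p2 \<in> {p1,p3}" "p3 \<in> {p1,p2}"
    by (auto split: if_splits)
qed

lemma relator4:
  assumes "word G [(p1,s1),(p2,s2),(p3,s3),(p4,s4)] = \<one>" "{p1,p2,p3,p4} \<subseteq> T"
  shows "p1 \<in> {p2,p3,p4}" "p2 \<in> {p1,p3,p4}" "p3 \<in> {p1,p2,p4}" "p4 \<in> {p1,p2,p3}"
proof -
  have *: "2 \<le> count_list [p1,p2,p3,p4] t" if "t \<in> {p1,p2,p3,p4}" for t
    using relator_letter_twice [OF assms(1), of t] assms(2) that by auto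
  show "p1 \<in> {p2,p3,p4}" using * [of p1] by (auto split: if_splits)
  show "p2 \<in> {p1,p3,p4}" using * [of p2] by (auto split: if_splits)
  show "p3 \<in> {p1,p2,p4}" using * [of p3] by (auto split: if_splits)
  show "p4 \<in> {p1,p2,p3}" using * [of p4] by (auto split: if_splits)
qed

lemma relator5:
  assumes "word G [(p1,s1),(p2,s2),(p3,s3),(p4,s4),(p5,s5)] = \<one>" "{p1,p2,p3,p4,p5} \<subseteq> T"
  shows "p1 \<in> {p2,p3,p4,p5}" "p2 \<in> {p1,p3,p4,p5}" "p3 \<in> {p1,p2,p4,p5}"
    "p4 \<in> {p1,p2,p3,p5}" "p5 \<in> {p1,p2,p3,p4}"
proof -
  have *: "2 \<le> count_list [p1,p2,p3,p4,p5] t" if "t \<in> {p1,p2,p3,p4,p5}" for t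
    using relator_letter_twice [OF assms(1), of t] assms(2) that by auto
  show "p1 \<in> {p2,p3,p4,p5}" using * [of p1] by (auto split: if_splits)
  show "p2 \<in> {p1,p3,p4,p5}" using * [of p2] by (auto split: if_splits)
  show "p3 \<in> {p1,p2,p4,p5}" using * [of p3] by (auto split: if_splits)
  show "p4 \<in> {p1,p2,p3,p5}" using * [of p4] by (auto split: if_splits)
  show "p5 \<in> {p1,p2,p3,p4}" using * [of p5] by (auto split: if_splits)
qed

lemma relator6:
  assumes "word G [(p1,s1),(p2,s2),(p3,s3),(p4,s4),(p5,s5),(p6,s6)] = \<one>"
    "{p1,p2,p3,p4,p5,p6} \<subseteq> T"
  shows "p1 \<in> {p2,p3,p4,p5,p6}" "p2 \<in> {p1,p3,p4,p5,p6}" "p3 \<in> {p1,p2,p4,p5,p6}"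
    "p4 \<in> {p1,p2,p3,p5,p6}" "p5 \<in> {p1,p2,p3,p4,p6}" "p6 \<in> {p1,p2,p3,p4,p5}"
proof -
  have *: "2 \<le> count_list [p1,p2,p3,p4,p5,p6] t" if "t \<in> {p1,p2,p3,p4,p5,p6}" for t
    using relator_letter_twice [OF assms(1), of t] assms(2) that by auto
  show "p1 \<in> {p2,p3,p4,p5,p6}" using * [of p1] by (auto split: if_splits)
  show "p2 \<in> {p1,p3,p4,p5,p6}" using * [of p2] by (auto split: if_splits)
  show "p3 \<in> {p1,p2,p4,p5,p6}" using * [of p3] by (auto split: if_splits)
  show "p4 \<in> {p1,p2,p3,p5,p6}" using * [of p4] by (auto split: if_splits)
  show "p5 \<in> {p1,p2,p3,p4,p6}" using * [of p5] by (auto split: if_splits)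
  show "p6 \<in> {p1,p2,p3,p4,p5}" using * [of p6] by (auto split: if_splits)
qed

end

section \<open>Connection sets given by an oriented triangle-free graph on the generators\<close>

text \<open>\<open>triangle_free\<close> excludes the arcs between connectors that every triangle
  would produce, and \<open>edge_square\<close> keeps a connector from being its own
  inverse.\<close>

locale avoiding_graph = avoiding +
  fixes D
  assumes edge_letters: "(x, y) \<in> D \<Longrightarrow> x \<in> T \<and> y \<in> T"
    and edge_antisym: "(x, y) \<in> D \<Longrightarrow> (y, x) \<notin> D"
    and triangle_free: "(x, y) \<in> D \<union> D\<inverse> \<Longrightarrow> (y, z) \<in> D \<union> D\<inverse> \<Longrightarrow> (z, x) \<notin> D \<union> D\<inverse>"
    and edge_square: "(x, y) \<in> D \<Longrightarrow> (y \<otimes> inv x) \<otimes> (y \<otimes> inv x) \<noteq> \<one>"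
begin

definition connectors :: "'a set" where "connectors = {y \<otimes> inv x | x y. (x, y) \<in> D}"

abbreviation S where "S \<equiv> T \<union> connectors"

abbreviation arc where "arc u v \<equiv> v \<otimes> inv u \<in> S"

lemma edge_letter [simp]: "(x, y) \<in> D \<Longrightarrow> x \<in> T" "(x, y) \<in> D \<Longrightarrow> y \<in> T"
  using edge_letters by blast+

lemma edge_neq: "(x, y) \<in> D \<Longrightarrow> x \<noteq> y"
  using edge_antisym by blast

lemma connector [simp, intro]: "(x, y) \<in> D \<Longrightarrow> y \<otimes> inv x \<in> connectors"
  by (auto simp: connectors_def)

lemma connectors_cases:
  assumes "s \<in> S"
  obtains "s \<in> T" | x y where "(x, y) \<in> D" "s = y \<otimes> inv x"
  using assms by (auto simp: connectors_def)

lemma S_closed: "S \<subseteq> carrier G"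
  using edge_letters by (auto simp: connectors_def)

text \<open>Three positions in which every letter occurs at least twice hold a single letter,
  whereas x and y differ.\<close>

lemma connector_not_letter:
  assumes "(x, y) \<in> D" shows "y \<otimes> inv x \<notin> T"
proof
  assume t: "y \<otimes> inv x \<in> T"
  have "word G [(y,True),(x,False),(y \<otimes> inv x,False)] = \<one>"
    using mult_relator [OF refl, of y x] assms by simp
  from relator3 [OF this] show False
    using assms t edge_neq [OF assms] by auto
qed

text \<open>A letter and a connector give a relation of length three with two different letters. Two
  connectors give one of length four, which forces the same pair of endpoints;
  \<open>edge_antisym\<close> makes the edges equal and \<open>edge_square\<close> excludes
  that.\<close>

lemma S_mult_neq_one:
  assumes "s \<in> S" "t \<in> S" shows "s \<otimes> t \<noteq> \<one>"
proof
  assume eq: "s \<otimes> t = \<one>"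
  have TC: False if "t \<in> T" "(x, y) \<in> D" and eq: "t \<otimes> (y \<otimes> inv x) = \<one>" for t x y
  proof -
    have "word G [(t,True),(y,True),(x,False)] = \<one>"
      using that by simp
    from relator3 [OF this] show False
      using that edge_neq [OF that(2)] by auto
  qed
  from assms(1) show False
  proof (cases rule: connectors_cases)
    case 1
    from assms(2) show False
    proof (cases rule: connectors_cases)
      case t: 1
      have "word G [(s,True),(t,True)] = \<one>"
        using eq 1 t by simp
      then show False using relator2 [of s True t True] 1 t square_neq_one eq by blast
    next
      case (2 x y)
      then show False using TC 1 eq by blast
    qed
  next
    case (2 x y)
    note st = 2
    from assms(2) show False
    proof (cases rule: connectors_cases)
      case 1
      then have "t \<otimes> s = \<one>"
        using eq 2 by (metis S_closed assms(1) inv_comm letter_closed subsetD)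
      then show False using TC 1 2 by blast
    next
      case (2 x' y')
      have "word G [(y,True),(x,False),(y',True),(x',False)] = \<one>"
        using eq 2 st by (simp add: m_assoc)
      note r = relator4 [OF this]
      have "x = x' \<and> y = y'"
        using r st 2 edge_neq [OF st(1)] edge_neq [OF 2(1)] edge_antisym [OF st(1)] by auto
      then show False
        using edge_square [OF 2(1)] eq st 2 by simp
    qed
  qed
qed

text \<open>If v u^{-1} is the connector of an edge, the relation of length four identifies the
  endpoints with u and v. An edge in the wrong direction would make the connector equal to its
  inverse.\<close>

lemma arc_letter_letter:
  assumes "u \<in> T" "v \<in> T" shows "arc u v \<longleftrightarrow> (u, v) \<in> D"
proof
  assume "arc u v"
  then show "(u, v) \<in> D"
  proof (cases rule: connectors_cases)
    case 1
    have "word G [(v,True),(u,False),(v \<otimes> inv u,False)] = \<one>"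
      using mult_relator [OF refl, of v u] assms by simp
    note r = relator3 [OF this]
    have "u = v" using r assms 1 by auto
    then show ?thesis using 1 assms letter_neq_one by auto
  next
    case (2 x y)
    have "word G [(v,True),(u,False),(x,True),(y,False)] = \<one>"
      using mult_relator [OF 2(2)] 2 assms by (simp add: inv_mult_group)
    note r = relator4 [OF this]
    have "u \<noteq> v"
    proof
      assume "u = v"
      then have "y \<otimes> inv x = \<one>" using 2 assms by simp
      then show False using edge_square [OF 2(1)] by simp
    qed
    then have "u = x \<and> v = y \<or> u = y \<and> v = x"
      using r 2 assms edge_neq [OF 2(1)] by auto
    then show ?thesis
    proof
      assume "u = y \<and> v = x"
      then have "x \<otimes> inv y = y \<otimes> inv x" using 2 by simp
      then have "(y \<otimes> inv x) \<otimes> (y \<otimes> inv x) = (y \<otimes> inv x) \<otimes> (x \<otimes> inv y)" by simp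
      also have "\<dots> = \<one>" using 2 by (simp add: m_assoc cancel_inv)
      finally show ?thesis using edge_square [OF 2(1)] by simp
    qed (use 2 in simp)
  qed
qed auto

text \<open>Write y x^{-1} = s u with s in S. If s is a letter, then s and u are x and y in some
  order: s = y would give x^2 = 1, and s = x is xyx = y. If s is a connector, it is the same one and
  u = 1.\<close>

lemma arc_letter_connector:
  assumes u: "u \<in> T" and e: "(x, y) \<in> D"
  shows "arc u (y \<otimes> inv x) \<longleftrightarrow> u = y \<and> x \<otimes> y \<otimes> x = y"
proof
  assume a: "arc u (y \<otimes> inv x)"
  from a show "u = y \<and> x \<otimes> y \<otimes> x = y"
  proof (cases rule: connectors_cases)
    case 1
    define s where "s = y \<otimes> inv x \<otimes> inv u"
    have s: "s \<in> T" using 1 s_def by simp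
    have "word G [(y,True),(x,False),(u,False),(s,False)] = \<one>"
      using mult_relator [OF s_def [symmetric]] s u e by (simp add: m_assoc)
    note r = relator4 [OF this]
    have "(s = x \<and> u = y) \<or> (s = y \<and> u = x)"
      using r s u e edge_neq [OF e] by auto
    moreover have eq: "y \<otimes> inv x = s \<otimes> u"
      using s u e by (simp add: s_def m_assoc)
    ultimately show ?thesis
    proof (elim disjE)
      assume *: "s = y \<and> u = x"
      then have "inv x = x" using eq e by simp
      then have "x \<otimes> x = \<one>" using e by (metis edge_letter(1) letter_closed r_inv)
      then show ?thesis using square_neq_one e by simp
    next
      assume *: "s = x \<and> u = y"
      then have "x \<otimes> y \<otimes> x = y \<otimes> inv x \<otimes> x" using eq by simp
      also have "\<dots> = y" using e by (simp add: m_assoc)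
      finally show ?thesis using * by simp
    qed
  next
    case (2 x' y')
    have "word G [(y,True),(x,False),(u,False),(x',True),(y',False)] = \<one>"
      using mult_relator [OF 2(2)] 2 u e by (simp add: inv_mult_group m_assoc)
    note r = relator5 [OF this]
    have "x = x' \<and> y = y' \<or> x = y' \<and> y = x'"
      using r u e 2 edge_neq [OF e] edge_neq [OF 2(1)] by auto
    then have "x = x' \<and> y = y'" using e 2 edge_antisym by blast
    then have "u = \<one>" using mult_inv_eq_self [of "y \<otimes> inv x" u] 2 u e by simp
    then show ?thesis using u letter_neq_one by blast
  qed
next
  assume a: "u = y \<and> x \<otimes> y \<otimes> x = y"
  have "y \<otimes> inv x = x \<otimes> y"
    using a e by (metis edge_letter inv_solve_right letter_closed m_closed)
  then have "(y \<otimes> inv x) \<otimes> inv u = x" using a e by (simp add: m_assoc)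
  then show "arc u (y \<otimes> inv x)" using e by simp
qed

text \<open>Write u x = s y with a letter s: the two ways of matching s, u with x, y give yx = xy
  and x^2 = y^2. If s is a connector, it is y x^{-1} itself, so u is its square; u = y then leaves a
  relation of length three with two letters.\<close>

lemma arc_connector_letter:
  assumes u: "u \<in> T" and e: "(x, y) \<in> D"
  shows "arc (y \<otimes> inv x) u \<longleftrightarrow>
    u = y \<and> x \<otimes> y = y \<otimes> x \<or>
    u = x \<and> (x \<otimes> x = y \<otimes> y \<or> x = (y \<otimes> inv x) \<otimes> (y \<otimes> inv x))"
proof
  assume a: "arc (y \<otimes> inv x) u"
  from a show "u = y \<and> x \<otimes> y = y \<otimes> x \<or>
    u = x \<and> (x \<otimes> x = y \<otimes> y \<or> x = (y \<otimes> inv x) \<otimes> (y \<otimes> inv x))"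
  proof (cases rule: connectors_cases)
    case 1
    define s where "s = u \<otimes> inv (y \<otimes> inv x)"
    have s: "s \<in> T" using 1 s_def by simp
    have "word G [(u,True),(x,True),(y,False),(s,False)] = \<one>"
      using mult_relator [OF s_def [symmetric]] s u e by (simp add: m_assoc inv_mult_group)
    note r = relator4 [OF this]
    have "(s = x \<and> u = y) \<or> (s = y \<and> u = x)"
      using r s u e edge_neq [OF e] by auto
    moreover have eq: "u \<otimes> x = s \<otimes> y"
      using s u e by (simp add: s_def m_assoc inv_mult_group)
    ultimately show ?thesis by auto
  next
    case (2 x' y')
    have "word G [(u,True),(x,True),(y,False),(x',True),(y',False)] = \<one>"
      using mult_relator [OF 2(2)] 2 u e by (simp add: inv_mult_group m_assoc)
    note r = relator5 [OF this]
    have "x = x' \<and> y = y' \<or> x = y' \<and> y = x'"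
      using r u e 2 edge_neq [OF e] edge_neq [OF 2(1)] by auto
    then have xy: "x = x' \<and> y = y'" using e 2 edge_antisym by blast
    have ueq: "u = (y \<otimes> inv x) \<otimes> (y \<otimes> inv x)"
      using 2(2) xy u e
      by (metis edge_letter inv_closed inv_solve_right letter_closed m_closed)
    have "u = x \<or> u = y" using r u e 2 xy edge_neq [OF e] by auto
    then show ?thesis
    proof
      assume "u = y"
      then have "inv y \<otimes> y = inv y \<otimes> ((y \<otimes> inv x) \<otimes> (y \<otimes> inv x))"
        using ueq by simp
      then have "inv x \<otimes> (y \<otimes> inv x) = \<one>"
        using e by (simp add: m_assoc cancel_inv)
      then have "word G [(x,False),(y,True),(x,False)] = \<one>" using e by simp
      from relator3(2) [OF this] show ?thesis using e edge_neq [OF e] by auto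
    qed (use ueq in simp)
  qed
next
  assume "u = y \<and> x \<otimes> y = y \<otimes> x \<or>
    u = x \<and> (x \<otimes> x = y \<otimes> y \<or> x = (y \<otimes> inv x) \<otimes> (y \<otimes> inv x))"
  then consider "u = y" "x \<otimes> y = y \<otimes> x" | "u = x" "x \<otimes> x = y \<otimes> y"
    | "u = x" "x = (y \<otimes> inv x) \<otimes> (y \<otimes> inv x)" by blast
  then show "arc (y \<otimes> inv x) u"
  proof cases
    case 1
    then have "u \<otimes> inv (y \<otimes> inv x) = x \<otimes> y \<otimes> inv y"
      using e by (simp add: inv_mult_group m_assoc [symmetric])
    then show ?thesis using e by (simp add: m_assoc)
  next
    case 2
    then have "u \<otimes> inv (y \<otimes> inv x) = y \<otimes> y \<otimes> inv y"
      using e by (simp add: inv_mult_group m_assoc [symmetric])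
    then show ?thesis using e by (simp add: m_assoc)
  next
    case 3
    then have "u \<otimes> inv (y \<otimes> inv x) = y \<otimes> inv x"
      using e by (metis edge_letter inv_closed inv_solve_right letter_closed m_closed)
    then show ?thesis using e by simp
  qed
qed

text \<open>The relation has length six and involves three edges. If the edge of the target
  coincides with one of the other two, the remaining connector is trivial; otherwise the double
  occurrence of every letter closes the three edges to a triangle.\<close>

lemma no_arc_connectors:
  assumes e: "(x, y) \<in> D" and f: "(x', y') \<in> D"
  shows "\<not> arc (y \<otimes> inv x) (y' \<otimes> inv x')"
proof
  assume a: "arc (y \<otimes> inv x) (y' \<otimes> inv x')"
  note neq = edge_neq [OF e] edge_neq [OF f]
  from a show False
  proof (cases rule: connectors_cases)
    case 1
    define s where "s = y' \<otimes> inv x' \<otimes> inv (y \<otimes> inv x)"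
    have s: "s \<in> T" using 1 s_def by simp
    have "word G [(y',True),(x',False),(x,True),(y,False),(s,False)] = \<one>"
      using mult_relator [OF s_def [symmetric]] s f e by (simp add: m_assoc inv_mult_group)
    note r = relator5 [OF this]
    have "x = x' \<and> y = y' \<or> x = y' \<and> y = x'"
      using r s e f neq by auto
    then have "x = x' \<and> y = y'" using e f edge_antisym by blast
    then have "s = \<one>" using e by (simp add: s_def)
    then show False using s letter_neq_one by blast
  next
    case (2 p q)
    have "word G [(y',True),(x',False),(x,True),(y,False),(p,True),(q,False)] = \<one>"
      using mult_relator [OF 2(2)] 2 f e by (simp add: m_assoc inv_mult_group)
    note r = relator6 [OF this]
    have ne: "(x, y) \<noteq> (x', y')"
    proof
      assume "(x, y) = (x', y')"
      then have "q \<otimes> inv p = \<one>" using 2 e by simp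
      then show False using edge_square [OF 2(1)] by simp
    qed
    have ne': "(p, q) \<noteq> (x', y')"
    proof
      assume "(p, q) = (x', y')"
      then have "q \<otimes> inv p \<otimes> inv (y \<otimes> inv x) = q \<otimes> inv p" using 2 by simp
      then have "y \<otimes> inv x = \<one>"
        by (rule mult_inv_eq_self) (use 2(1) e in simp_all)
      then show False using edge_square [OF e] by simp
    qed
    have D: "(x, y) \<in> D" "(x', y') \<in> D" "(p, q) \<in> D" "(y, x) \<notin> D" "(y', x') \<notin> D" "(q, p) \<notin> D"
      using e f 2 edge_antisym by blast+
    have T: "{y', x', x, y, p, q} \<subseteq> T" using e f 2 by simp
    note r = r [OF T]
    have "\<not> (x' \<in> {x, y} \<and> y' \<in> {x, y})" "\<not> (x' \<in> {p, q} \<and> y' \<in> {p, q})"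
      using ne ne' D neq by auto
    moreover have "x' \<in> {x, y} \<union> {p, q}" "y' \<in> {x, y} \<union> {p, q}"
      using r(1,2) neq by auto
    ultimately consider "x' \<in> {x, y}" "x' \<notin> {p, q}" "y' \<in> {p, q}" "y' \<notin> {x, y}"
      | "y' \<in> {x, y}" "y' \<notin> {p, q}" "x' \<in> {p, q}" "x' \<notin> {x, y}" by blast
    then show False
    proof cases
      case 1
      \<comment> \<open>The target edge meets {x, y} in one endpoint and {p, q} in the other;
        \<open>w\<close> is the other end of the edge {x, y}. Its second occurrence must be in {p,
        q}, which completes the triangle.\<close>
      define w where "w = (if x = x' then y else x)"
      have "x \<in> {x', w}" "y \<in> {x', w}" "w \<noteq> x'" "w \<in> {x, y}"
        using 1(1) neq by (auto simp: w_def)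
      then have "w \<in> {p, q}" "(w, x') \<in> D \<union> D\<inverse>"
        using r(3,4) 1 D neq by auto
      moreover from this 1 have "(y', w) \<in> D \<union> D\<inverse>"
        using D \<open>w \<in> {x, y}\<close> by auto
      ultimately show False using triangle_free [of x' y' w] D(2) by blast
    next
      case 2
      define w where "w = (if x = y' then y else x)"
      have "x \<in> {y', w}" "y \<in> {y', w}" "w \<noteq> y'" "w \<in> {x, y}"
        using 2(1) neq by (auto simp: w_def)
      then have "w \<in> {p, q}" "(y', w) \<in> D \<union> D\<inverse>"
        using r(3,4) 2 D neq by auto
      moreover from this 2 have "(w, x') \<in> D \<union> D\<inverse>"
        using D \<open>w \<in> {x, y}\<close> by auto
      ultimately show False using triangle_free [of x' y' w] D(2) by blast
    qed
  qed
qed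

text \<open>The two ways in which the connector y x^{-1} can have an arc to x; in the second it is a
  square root of x.\<close>

definition root_rel where
  "root_rel x y \<longleftrightarrow> x \<otimes> x = y \<otimes> y \<or> x = (y \<otimes> inv x) \<otimes> (y \<otimes> inv x)"

lemma arc_from_letter:
  assumes "u \<in> T" "v \<in> S" "arc u v"
  shows "(u, v) \<in> D \<or> (\<exists>x. (x, u) \<in> D \<and> v = u \<otimes> inv x \<and> x \<otimes> u \<otimes> x = u)"
  using assms(2)
proof (cases rule: connectors_cases)
  case 1
  then show ?thesis using arc_letter_letter assms by blast
next
  case (2 x y)
  then show ?thesis using arc_letter_connector assms by blast
qed

lemma arc_to_letter:
  assumes "u \<in> S" "v \<in> T" "arc u v"
  shows "(u, v) \<in> D \<or> (\<exists>x. (x, v) \<in> D \<and> u = v \<otimes> inv x \<and> x \<otimes> v = v \<otimes> x)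
    \<or> (\<exists>y. (v, y) \<in> D \<and> u = y \<otimes> inv v \<and> root_rel v y)"
  using assms(1)
proof (cases rule: connectors_cases)
  case 1
  then show ?thesis using arc_letter_letter assms by blast
next
  case (2 x y)
  then show ?thesis using arc_connector_letter [of v x y] assms unfolding root_rel_def by blast
qed

lemma arc_from_connector:
  assumes "(x, y) \<in> D" "v \<in> S" "arc (y \<otimes> inv x) v"
  shows "v = y \<and> x \<otimes> y = y \<otimes> x \<or> v = x \<and> root_rel x y"
  using assms(2)
proof (cases rule: connectors_cases)
  case 1
  then show ?thesis using arc_connector_letter assms unfolding root_rel_def by blast
next
  case (2 p q)
  then show ?thesis using no_arc_connectors assms by blast
qed

lemma arc_to_connector:
  assumes "(x, y) \<in> D" "u \<in> S" "arc u (y \<otimes> inv x)"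
  shows "u = y \<and> x \<otimes> y \<otimes> x = y"
  using assms(2)
proof (cases rule: connectors_cases)
  case 1
  then show ?thesis using arc_letter_connector assms by blast
next
  case (2 p q)
  then show ?thesis using no_arc_connectors assms by blast
qed

text \<open>Under commutation xyx = y reads x^2 = 1. So there are never arcs in both directions
  between y and the connector y x^{-1}.\<close>

lemma inverted_not_commuting:
  assumes "(x, y) \<in> D" "x \<otimes> y \<otimes> x = y" shows "x \<otimes> y \<noteq> y \<otimes> x"
proof
  assume "x \<otimes> y = y \<otimes> x"
  then have "y \<otimes> (x \<otimes> x) = y \<otimes> \<one>"
    using assms by (simp add: m_assoc)
  then have "inv y \<otimes> (y \<otimes> (x \<otimes> x)) = inv y \<otimes> (y \<otimes> \<one>)" by simp
  then show False using assms square_neq_one [of x] by (simp add: cancel_inv)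
qed

text \<open>With b = y x^{-1}, both x = b^2 and y = b^3 are powers of b.\<close>

lemma root_commuting:
  assumes "(x, y) \<in> D" "x = (y \<otimes> inv x) \<otimes> (y \<otimes> inv x)" shows "x \<otimes> y = y \<otimes> x"
proof -
  define b where "b = y \<otimes> inv x"
  have c: "b \<in> carrier G" "x \<in> carrier G" "y \<in> carrier G" using assms(1) by (simp_all add: b_def)
  have y: "y = b \<otimes> x" using c by (simp add: b_def m_assoc)
  have x: "x = b \<otimes> b" using assms(2) b_def by simp
  show ?thesis
    unfolding y by (subst (1 2 3 4) x) (use c in \<open>simp add: m_assoc\<close>)
qed

lemma S_in_carrier: "u \<in> S \<Longrightarrow> u \<in> carrier G"
  using S_closed by blast

lemma stab_in_S: "\<psi> \<in> cayley_stabilizer G S \<Longrightarrow> u \<in> S \<Longrightarrow> \<psi> u \<in> S"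
  using stabilizer_connection_set S_in_carrier by blast

lemma stab_eq_iff:
  "\<psi> \<in> cayley_stabilizer G S \<Longrightarrow> u \<in> S \<Longrightarrow> v \<in> S \<Longrightarrow> \<psi> u = \<psi> v \<longleftrightarrow> u = v"
  using stabilizer_inj S_in_carrier by blast

lemma stab_arc:
  "\<psi> \<in> cayley_stabilizer G S \<Longrightarrow> u \<in> S \<Longrightarrow> v \<in> S \<Longrightarrow> arc (\<psi> u) (\<psi> v) \<longleftrightarrow> arc u v"
  using stabilizer_arc_iff S_in_carrier by blast

lemma stab_edge_arc:
  "\<psi> \<in> cayley_stabilizer G S \<Longrightarrow> (u, v) \<in> D \<Longrightarrow> arc (\<psi> u) (\<psi> v)"
  using stab_arc [of \<psi> u v] arc_letter_letter [of u v] by simp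

lemma letter_neq_connector:
  "t \<in> T \<Longrightarrow> (x, y) \<in> D \<Longrightarrow> t \<noteq> y \<otimes> inv x"
  using connector_not_letter by blast

lemma fixed_connector:
  assumes "x \<in> cayley_fixed G S" "y \<in> cayley_fixed G S" shows "y \<otimes> inv x \<in> cayley_fixed G S"
  using subgroup.m_closed subgroup.m_inv_closed cayley_fixed_subgroup assms by metis

lemma fixedD: "x \<in> cayley_fixed G S \<Longrightarrow> \<psi> \<in> cayley_stabilizer G S \<Longrightarrow> \<psi> x = x"
  by (simp add: cayley_fixed_def)

lemma fixedI: "x \<in> T \<Longrightarrow> (\<And>\<psi>. \<psi> \<in> cayley_stabilizer G S \<Longrightarrow> \<psi> x = x) \<Longrightarrow> x \<in> cayley_fixed G S"
  by (simp add: cayley_fixed_def)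

text \<open>If q went to a connector y x^{-1}, its in-neighbour p would go to y and its
  out-neighbour r to x. The arc from x to y would then come from an edge from r to p, completing a
  triangle.\<close>

lemma middle_letter:
  assumes \<psi>: "\<psi> \<in> cayley_stabilizer G S" and D: "(p, q) \<in> D" "(q, r) \<in> D"
  shows "\<psi> q \<in> T"
proof -
  have S: "p \<in> S" "q \<in> S" "r \<in> S" using D by auto
  note im = stab_in_S [OF \<psi> S(1)] stab_in_S [OF \<psi> S(2)] stab_in_S [OF \<psi> S(3)]
  from im(2) show ?thesis
  proof (cases rule: connectors_cases)
    case (2 x y)
    have p: "\<psi> p = y"
      using arc_to_connector [OF 2(1) im(1)] stab_edge_arc [OF \<psi> D(1)] 2(2) by simp
    have "\<psi> r = x"
      using arc_from_connector [OF 2(1) im(3)] stab_edge_arc [OF \<psi> D(2)] 2(2) p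
        stab_eq_iff [OF \<psi> S(1,3)] D edge_antisym by auto
    then have "arc (\<psi> r) (\<psi> p)" using p 2(1) arc_letter_letter [of x y] by simp
    then have "(r, p) \<in> D" using stab_arc [OF \<psi> S(3,1)] arc_letter_letter D by simp
    then show ?thesis using triangle_free [of p q r] D by blast
  qed
qed

lemma letter_edge_image:
  assumes "\<psi> \<in> cayley_stabilizer G S" "(p, q) \<in> D" "\<psi> p \<in> T" "\<psi> q \<in> T"
  shows "(\<psi> p, \<psi> q) \<in> D"
  using arc_letter_letter [OF assms(3,4)] stab_edge_arc [OF assms(1,2)] by blast

end

section \<open>Directed paths\<close>

locale avoiding_path = avoiding_graph +
  fixes a :: "nat \<Rightarrow> 'a" and m :: nat
  assumes inj: "inj_on a {1..m}"
    and path: "D = {(a i, a (Suc i)) | i. 1 \<le> i \<and> i < m}"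
    and long: "3 \<le> m"
begin

lemma vertex_eq_iff: "i \<in> {1..m} \<Longrightarrow> j \<in> {1..m} \<Longrightarrow> a i = a j \<longleftrightarrow> i = j"
  by (rule inj_on_eq_iff [OF inj])

lemma succ_iff: "i \<in> {1..m} \<Longrightarrow> (a i, v) \<in> D \<longleftrightarrow> i < m \<and> v = a (Suc i)"
proof
  assume i: "i \<in> {1..m}" and "(a i, v) \<in> D"
  then obtain j where j: "a i = a j" "v = a (Suc j)" "1 \<le> j" "j < m"
    unfolding path by blast
  then show "i < m \<and> v = a (Suc i)" using vertex_eq_iff [of i j] i by simp
qed (auto simp: path)

lemma pred_iff: "i \<in> {1..m} \<Longrightarrow> (u, a i) \<in> D \<longleftrightarrow> 1 < i \<and> u = a (i - 1)"
proof
  assume i: "i \<in> {1..m}" and "(u, a i) \<in> D"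
  then obtain j where j: "u = a j" "a i = a (Suc j)" "1 \<le> j" "j < m"
    unfolding path by blast
  then have "i = Suc j" using vertex_eq_iff [of i "Suc j"] i by simp
  then show "1 < i \<and> u = a (i - 1)" using j by simp
next
  assume "i \<in> {1..m}" "1 < i \<and> u = a (i - 1)"
  then show "(u, a i) \<in> D" by (auto simp: path intro!: exI [of _ "i - 1"])
qed

lemma edge: "1 \<le> i \<Longrightarrow> i < m \<Longrightarrow> (a i, a (Suc i)) \<in> D"
  by (auto simp: path)

lemma edge_diff: "j = Suc i \<Longrightarrow> 1 \<le> i \<Longrightarrow> i < m \<Longrightarrow> (a i, a j) \<in> D"
  by (auto simp: path)

lemma vertex: "i \<in> {1..m} \<Longrightarrow> a i \<in> T"
  using edge_letters [OF edge [of i]] edge_letters [OF edge_diff [of i "i - 1"]] long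
  by (cases "i < m") auto

text \<open>Inner vertices go to letters, so the inner part of the path slides along the path. The
  images of the two end vertices exclude a shift in either direction.\<close>

lemma middle_fixed:
  assumes \<psi>: "\<psi> \<in> cayley_stabilizer G S" and i: "2 \<le> i" "i < m"
  shows "\<psi> (a i) = a i"
proof -
  have T: "a i \<in> S" if "i \<in> {1..m}" for i using vertex that by simp
  note im = stab_in_S [OF \<psi> T]
  have mid: "\<psi> (a i) \<in> T" if "2 \<le> i" "i < m" for i
    using middle_letter [OF \<psi>, of "a (i - 1)" "a i" "a (Suc i)"] edge [of "i - 1"] edge [of i] that
    by simp
  have "arc (\<psi> (a 1)) (\<psi> (a 2))"
    using stab_edge_arc [OF \<psi> edge [of 1]] long by (simp add: numeral_2_eq_2)
  then have "\<exists>u v. (u, v) \<in> D \<and> (\<psi> (a 2) = u \<or> \<psi> (a 2) = v)"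
    using arc_to_letter [OF im [of 1] mid [of 2]] long by auto
  then obtain k where k: "\<psi> (a 2) = a k" "k \<in> {1..m}"
    by (auto simp: path)
  have shift: "2 + j < m \<Longrightarrow> \<psi> (a (2 + j)) = a (k + j) \<and> k + j \<le> m" for j
  proof (induction j)
    case 0
    then show ?case using k by simp
  next
    case (Suc j)
    then have IH: "\<psi> (a (2 + j)) = a (k + j)" "k + j \<le> m" by simp_all
    have "(\<psi> (a (2 + j)), \<psi> (a (Suc (2 + j)))) \<in> D"
      using Suc.prems by (intro letter_edge_image [OF \<psi> edge] mid) auto
    then show ?case using IH succ_iff [of "k + j"] k by auto
  qed
  \<comment> \<open>The inner vertices are the m - 2 letters \<open>a 2\<close>, ...,
    \<open>a (m - 1)\<close>. The last one goes to \<open>a (k + (m - 3))\<close>, which must exist,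
    so the shift is by at most one.\<close>
  have "k + (m - 3) \<le> m" using shift [of "m - 3"] long by simp
  then have "k \<le> 3" using long by simp
  then consider "k = 1" | "k = 2" | "k = 3" using k by force
  then show ?thesis
  proof cases
    case 1
    \<comment> \<open>Shift down: \<open>a 1\<close> has no predecessor, so its image, an
      in-neighbour of \<open>a 1\<close>, is the first connector. Then \<open>a 3\<close> and this
      connector would both go to \<open>a 2\<close>.\<close>
    have a1: "arc (\<psi> (a 1)) (a 1)"
      using stab_edge_arc [OF \<psi> edge [of 1]] long 1 k by (simp add: numeral_2_eq_2)
    have c1: "(a 1, a 2) \<in> D" using edge [of 1] long by (simp add: numeral_2_eq_2)
    have b1: "\<psi> (a 1) = a 2 \<otimes> inv (a 1)" "root_rel (a 1) (a 2)"
      using arc_to_letter [OF im [of 1] vertex [of 1] a1] pred_iff [of 1] succ_iff [of 1] long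
      by (auto simp: numeral_2_eq_2)
    define b where "b = a 2 \<otimes> inv (a 1)"
    have b: "b \<in> S" using c1 by (simp add: b_def)
    have "arc b (a 1)" using b1(2) c1 arc_connector_letter [of "a 1" "a 1" "a 2"]
      unfolding b_def root_rel_def by simp
    then have "arc (\<psi> b) b" using stab_arc [OF \<psi> b T [of 1]] long b1(1) b_def by simp
    then have \<psi>b: "\<psi> b = a 2"
      using arc_to_connector [OF c1 stab_in_S [OF \<psi> b]] b_def by simp
    have "arc (\<psi> (a 2)) (\<psi> (a 3))"
      using stab_edge_arc [OF \<psi> edge [of 2]] long by (simp add: numeral_eq_Suc)
    then have "\<psi> (a 3) = a 2"
      using arc_from_letter [OF vertex [of 1] im [of 3]] k 1 long pred_iff [of 1] succ_iff [of 1]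
      by (auto simp: numeral_2_eq_2)
    then have "a 3 = b" using stab_eq_iff [OF \<psi> T [of 3] b] \<psi>b long by simp
    then show ?thesis using letter_neq_connector [OF vertex [of 3] c1] long b_def by simp
  next
    case 2
    obtain j where "i = 2 + j" using i(1) le_iff_add by blast
    then show ?thesis using shift [of j] i 2 by simp
  next
    case 3
    \<comment> \<open>Shift up: dually, \<open>a m\<close> goes to the last connector, and then
      \<open>a (m - 2)\<close> and this connector would both go to \<open>a (m - 1)\<close>.\<close>
    have "2 + (m - 3) = m - 1" "3 + (m - 3) = m" using long by simp_all
    then have last: "\<psi> (a (m - 1)) = a m" using shift [of "m - 3"] 3 long by simp
    have e: "(a (m - 1), a m) \<in> D" using edge [of "m - 1"] long by simp
    have am: "arc (a m) (\<psi> (a m))" using stab_edge_arc [OF \<psi> e] last by simp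
    define b where "b = a m \<otimes> inv (a (m - 1))"
    have b: "b \<in> S" using e by (simp add: b_def)
    have Q: "\<psi> (a m) = b" "a (m - 1) \<otimes> a m \<otimes> a (m - 1) = a m"
      using arc_from_letter [OF vertex [of m] im [of m] am] succ_iff [of m] pred_iff [of m] long
      by (auto simp: b_def)
    have nc: "a (m - 1) \<otimes> a m \<noteq> a m \<otimes> a (m - 1)"
      using inverted_not_commuting [OF e Q(2)] .
    have "arc (a m) b" using arc_letter_connector [OF vertex [of m] e] Q(2) long by (simp add: b_def)
    then have "arc b (\<psi> b)" using stab_arc [OF \<psi> T [of m] b] Q(1) long by simp
    then have \<psi>b: "\<psi> b = a (m - 1)"
      using arc_from_connector [OF e stab_in_S [OF \<psi> b]] nc by (auto simp: b_def)
    have "(a (m - 2), a (m - 1)) \<in> D" using long by (intro edge_diff) auto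
    from stab_edge_arc [OF \<psi> this] have "arc (\<psi> (a (m - 2))) (a m)" using last by simp
    then have "\<psi> (a (m - 2)) = a (m - 1)"
      using arc_to_letter [OF im [of "m - 2"] vertex [of m]] succ_iff [of m] pred_iff [of m] long nc
      by auto
    then have "a (m - 2) = b" using stab_eq_iff [OF \<psi> T [of "m - 2"] b] \<psi>b long by simp
    moreover have "m - 2 \<in> {1..m}" using long by auto
    ultimately show ?thesis using letter_neq_connector [OF vertex e] b_def by blast
  qed
qed

text \<open>The ends are recognised from their fixed neighbours. A rival of \<open>a 1\<close> as
  in-neighbour of \<open>a 2\<close> is a connector: the one with \<open>a 1\<close> needs
  commutation, the one with \<open>a 3\<close> is itself fixed, since \<open>a 2\<close> and
  \<open>a 3\<close> are inner for \<open>4 \<le> m\<close>. The rival of \<open>a m\<close> is the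
  connector of the last two inner vertices.\<close>

lemma long_path_fixed:
  assumes m: "4 \<le> m" and nc: "a 1 \<otimes> a 2 \<noteq> a 2 \<otimes> a 1"
  shows "a ` {1..m} \<subseteq> cayley_fixed G S"
proof -
  have T: "a i \<in> S" if "i \<in> {1..m}" for i using vertex that by simp
  have mid: "a i \<in> cayley_fixed G S" if "2 \<le> i" "i < m" for i
    using middle_fixed that vertex [of i] by (intro fixedI) auto
  have c: "a (Suc i) \<otimes> inv (a i) \<in> cayley_fixed G S" if "2 \<le> i" "Suc i < m" for i
    using fixed_connector [OF mid [of i] mid [of "Suc i"]] that by simp
  have first: "a 1 \<in> cayley_fixed G S"
  proof (rule fixedI)
    fix \<psi> assume \<psi>: "\<psi> \<in> cayley_stabilizer G S"
    have ar: "arc (\<psi> (a 1)) (a 2)"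
      using stab_edge_arc [OF \<psi> edge [of 1]] middle_fixed [OF \<psi>, of 2] m
      by (simp add: numeral_2_eq_2)
    have "\<psi> (a 1) = a 1 \<or> \<psi> (a 1) = a 3 \<otimes> inv (a 2)"
      using arc_to_letter [OF stab_in_S [OF \<psi> T [of 1]] vertex [of 2] ar] m
        pred_iff [of 2] succ_iff [of 2] nc by (auto simp: numeral_eq_Suc)
    moreover have "\<psi> (a 1) \<noteq> a 3 \<otimes> inv (a 2)"
    proof
      assume "\<psi> (a 1) = a 3 \<otimes> inv (a 2)"
      then have "\<psi> (a 1) = \<psi> (a 3 \<otimes> inv (a 2))"
        using fixedD [OF c [of 2] \<psi>] m by (simp add: numeral_eq_Suc)
      moreover have e: "(a 2, a 3) \<in> D" using edge [of 2] m by (simp add: numeral_eq_Suc)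
      ultimately have "a 1 = a 3 \<otimes> inv (a 2)"
        using stab_eq_iff [OF \<psi> T [of 1], of "a 3 \<otimes> inv (a 2)"] m by simp
      then show False using letter_neq_connector [OF vertex [of 1] e] m by simp
    qed
    ultimately show "\<psi> (a 1) = a 1" by blast
  qed (use vertex [of 1] m in simp)
  have last: "a m \<in> cayley_fixed G S"
  proof (rule fixedI)
    fix \<psi> assume \<psi>: "\<psi> \<in> cayley_stabilizer G S"
    have e: "(a (m - 2), a (m - 1)) \<in> D" using m by (intro edge_diff) auto
    have e': "(a (m - 1), a m) \<in> D" using edge [of "m - 1"] m by simp
    have ar: "arc (a (m - 1)) (\<psi> (a m))"
      using stab_edge_arc [OF \<psi> e'] middle_fixed [OF \<psi>, of "m - 1"] m by simp
    have "\<psi> (a m) = a m \<or> \<psi> (a m) = a (m - 1) \<otimes> inv (a (m - 2))"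
      using arc_from_letter [OF vertex [of "m - 1"] stab_in_S [OF \<psi> T [of m]] ar] m
        pred_iff [of "m - 1"] succ_iff [of "m - 1"] by (auto simp: numeral_eq_Suc)
    moreover have "\<psi> (a m) \<noteq> a (m - 1) \<otimes> inv (a (m - 2))"
    proof
      assume "\<psi> (a m) = a (m - 1) \<otimes> inv (a (m - 2))"
      then have "\<psi> (a m) = \<psi> (a (m - 1) \<otimes> inv (a (m - 2)))"
        using fixedD [OF c [of "m - 2"] \<psi>] m by (simp add: Suc_diff_Suc numeral_eq_Suc)
      then have "a m = a (m - 1) \<otimes> inv (a (m - 2))"
        using stab_eq_iff [OF \<psi> T [of m], of "a (m - 1) \<otimes> inv (a (m - 2))"] m e by simp
      then show False using letter_neq_connector [OF vertex [of m] e] m by simp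
    qed
    ultimately show "\<psi> (a m) = a m" by blast
  qed (use vertex [of m] m in simp)
  show ?thesis
  proof
    fix x assume "x \<in> a ` {1..m}"
    then obtain i where "x = a i" "i \<in> {1..m}" by blast
    then show "x \<in> cayley_fixed G S"
      using first last mid [of i] by (cases "i = 1 \<or> i = m") auto
  qed
qed

text \<open>With \<open>y\<close> fixed, the only rival of \<open>x\<close> is c = z y^{-1} and the
  only rival of \<open>z\<close> is b = y x^{-1}. Exchanging \<open>x\<close> with \<open>c\<close>
  and \<open>z\<close> with \<open>b\<close> carries an arc from \<open>b\<close> to
  \<open>x\<close> into one from \<open>z\<close> to \<open>c\<close>. The configuration excluded by
  \<open>good\<close> is the one where the rivals exist with both or neither of these arcs, so that
  the induced digraph does not forbid the exchange.\<close>

lemma short_path_fixed: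
  assumes m: "m = 3" and xyz: "x = a 1" "y = a 2" "z = a 3"
    and nc: "x \<otimes> y \<noteq> y \<otimes> x"
    and good: "\<not> (x \<otimes> y \<otimes> x = y \<and> y \<otimes> y = z \<otimes> z \<and> (x \<otimes> x = y \<otimes> y \<longleftrightarrow> y \<otimes> z \<otimes> y = z))"
  shows "{x, y, z} \<subseteq> cayley_fixed G S"
proof -
  define b where "b = y \<otimes> inv x"
  define c where "c = z \<otimes> inv y"
  have D: "(x, y) \<in> D" "(y, z) \<in> D"
    using edge [of 1] edge [of 2] m xyz by (simp_all add: numeral_eq_Suc)
  have T: "x \<in> T" "y \<in> T" "z \<in> T" using D by auto
  have S: "x \<in> S" "y \<in> S" "z \<in> S" "b \<in> S" "c \<in> S" using D by (auto simp: b_def c_def)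
  have succ: "(x, v) \<in> D \<longleftrightarrow> v = y" "(y, v) \<in> D \<longleftrightarrow> v = z" "(z, v) \<notin> D" for v
    using succ_iff [of 1] succ_iff [of 2] succ_iff [of 3] m xyz by (auto simp: numeral_eq_Suc)
  have pred: "(v, x) \<notin> D" "(v, y) \<in> D \<longleftrightarrow> v = x" "(v, z) \<in> D \<longleftrightarrow> v = y" for v
    using pred_iff [of 1] pred_iff [of 2] pred_iff [of 3] m xyz by (auto simp: numeral_eq_Suc)
  have neq: "x \<noteq> b" "x \<noteq> c" "z \<noteq> b" "z \<noteq> c" "y \<noteq> b" "y \<noteq> c"
    using letter_neq_connector D T b_def c_def by blast+
  have neq': "y \<noteq> z" using edge_neq D by blast
  have y: "\<psi> y = y" if "\<psi> \<in> cayley_stabilizer G S" for \<psi>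
    using middle_fixed [OF that, of 2] m xyz by simp
  have to_y: "u = x \<or> u = c \<and> root_rel y z" if "u \<in> S" "arc u y" for u
    using arc_to_letter [OF that(1) T(2) that(2)] succ pred nc by (auto simp: c_def)
  have from_y: "u = z \<or> u = b \<and> x \<otimes> y \<otimes> x = y" if "u \<in> S" "arc y u" for u
    using arc_from_letter [OF T(2) that] succ pred by (auto simp: b_def)
  have x_cases: "\<psi> x = x \<or> \<psi> x = c \<and> root_rel y z"
    and z_cases: "\<psi> z = z \<or> \<psi> z = b \<and> x \<otimes> y \<otimes> x = y"
    if \<psi>: "\<psi> \<in> cayley_stabilizer G S" for \<psi>
    using to_y [OF stab_in_S [OF \<psi> S(1)]] from_y [OF stab_in_S [OF \<psi> S(3)]]
      stab_edge_arc [OF \<psi> D(1)] stab_edge_arc [OF \<psi> D(2)] y [OF \<psi>] by auto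
  have yF: "y \<in> cayley_fixed G S" using y T by (intro fixedI) auto
  \<comment> \<open>Fixing one end fixes its connector with \<open>y\<close>, which is the rival of
    the other end.\<close>
  have via_z: ?thesis if "\<And>\<psi>. \<psi> \<in> cayley_stabilizer G S \<Longrightarrow> \<psi> z = z"
  proof -
    have zF: "z \<in> cayley_fixed G S" using that T by (intro fixedI) auto
    have cF: "c \<in> cayley_fixed G S" unfolding c_def by (rule fixed_connector [OF yF zF])
    have "\<psi> x = x" if "\<psi> \<in> cayley_stabilizer G S" for \<psi>
      using x_cases [OF that] fixedD [OF cF that] stab_eq_iff [OF that S(1,5)] neq by auto
    then show ?thesis using yF zF T by (auto intro: fixedI)
  qed
  have via_x: ?thesis if "\<And>\<psi>. \<psi> \<in> cayley_stabilizer G S \<Longrightarrow> \<psi> x = x"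
  proof -
    have xF: "x \<in> cayley_fixed G S" using that T by (intro fixedI) auto
    have bF: "b \<in> cayley_fixed G S" unfolding b_def by (rule fixed_connector [OF xF yF])
    have "\<psi> z = z" if "\<psi> \<in> cayley_stabilizer G S" for \<psi>
      using z_cases [OF that] fixedD [OF bF that] stab_eq_iff [OF that S(3,4)] neq by auto
    then show ?thesis using yF xF T by (auto intro: fixedI)
  qed
  show ?thesis
  proof (cases "x \<otimes> y \<otimes> x = y \<and> root_rel y z")
    case False
    then show ?thesis using via_x via_z x_cases z_cases by blast
  next
    case True
    then have yb: "arc y b" and cy: "arc c y"
      using arc_letter_connector [OF T(2) D(1)] arc_connector_letter [OF T(2) D(2)]
      by (auto simp: b_def c_def root_rel_def)
    consider "y = (z \<otimes> inv y) \<otimes> (z \<otimes> inv y)"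
      | "y \<otimes> y = z \<otimes> z" "x \<otimes> x \<noteq> y \<otimes> y" "y \<otimes> z \<otimes> y = z"
      | "y \<otimes> y = z \<otimes> z" "x \<otimes> x = y \<otimes> y" "y \<otimes> z \<otimes> y \<noteq> z"
      using True good unfolding root_rel_def by blast
    then show ?thesis
    proof cases
      case 1
      \<comment> \<open>Here y = c^2 and z = c^3, so \<open>c\<close> has an arc to \<open>z\<close>
        besides the one to \<open>y\<close>, while \<open>x\<close> has only the arc to
        \<open>y\<close>.\<close>
      have cz: "arc c z"
        using arc_connector_letter [OF T(3) D(2)] root_commuting [OF D(2) 1] by (simp add: c_def)
      have "\<psi> x = x" if \<psi>: "\<psi> \<in> cayley_stabilizer G S" for \<psi>
      proof (rule ccontr)
        assume "\<psi> x \<noteq> x"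
        then have xc: "\<psi> x = c" using x_cases [OF \<psi>] by blast
        have "arc (\<psi> c) y" using stab_arc [OF \<psi> S(5,2)] cy y [OF \<psi>] by simp
        then have "\<psi> c = x"
          using to_y [OF stab_in_S [OF \<psi> S(5)]] xc stab_eq_iff [OF \<psi> S(1,5)] neq by auto
        then have "arc x (\<psi> z)" using stab_arc [OF \<psi> S(5,3)] cz by simp
        then have "\<psi> z = y"
          using arc_from_letter [OF T(1) stab_in_S [OF \<psi> S(3)]] succ pred by auto
        then show False using y [OF \<psi>] stab_eq_iff [OF \<psi> S(3,2)] neq' by auto
      qed
      then show ?thesis by (rule via_x)
    next
      case 2
      have nr: "\<not> root_rel x y" using 2 root_commuting [OF D(1)] nc unfolding root_rel_def by blast
      have zc: "arc z c" using arc_letter_connector [OF T(3) D(2)] 2 by (simp add: c_def)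
      have "\<psi> z = z" if \<psi>: "\<psi> \<in> cayley_stabilizer G S" for \<psi>
      proof (rule ccontr)
        assume "\<psi> z \<noteq> z"
        then have "\<psi> z = b" using z_cases [OF \<psi>] by blast
        then have "arc b (\<psi> c)" using stab_arc [OF \<psi> S(3,5)] zc by simp
        then show False
          using arc_from_connector [OF D(1) stab_in_S [OF \<psi> S(5)]] nc nr by (auto simp: b_def)
      qed
      then show ?thesis by (rule via_z)
    next
      case 3
      have bx: "arc b x" using arc_connector_letter [OF T(1) D(1)] 3 by (simp add: b_def)
      have "\<psi> z = z" if \<psi>: "\<psi> \<in> cayley_stabilizer G S" for \<psi>
      proof (rule ccontr)
        assume "\<psi> z \<noteq> z"
        then have zb: "\<psi> z = b" using z_cases [OF \<psi>] by blast
        have "arc y (\<psi> b)" using stab_arc [OF \<psi> S(2,4)] yb y [OF \<psi>] by simp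
        then have "\<psi> b = z"
          using from_y [OF stab_in_S [OF \<psi> S(4)]] zb stab_eq_iff [OF \<psi> S(3,4)] neq by auto
        then have "arc z (\<psi> x)" using stab_arc [OF \<psi> S(4,1)] bx by simp
        then show False
          using arc_from_letter [OF T(3) stab_in_S [OF \<psi> S(1)]] succ pred 3 by auto
      qed
      then show ?thesis by (rule via_z)
    qed
  qed
qed

end

section \<open>A path whose first edge is reversed\<close>

locale avoiding_fork = avoiding_graph +
  fixes a :: "nat \<Rightarrow> 'a" and m :: nat
  assumes inj: "inj_on a {1..m}"
    and fork: "D = insert (a 2, a 1) {(a i, a (Suc i)) | i. 2 \<le> i \<and> i < m}"
    and long: "4 \<le> m"
    and commute: "a 2 \<otimes> a 1 = a 1 \<otimes> a 2"
begin

lemma vertex_eq_iff: "i \<in> {1..m} \<Longrightarrow> j \<in> {1..m} \<Longrightarrow> a i = a j \<longleftrightarrow> i = j"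
  by (rule inj_on_eq_iff [OF inj])

lemma edge0: "(a 2, a 1) \<in> D"
  by (simp add: fork)

lemma edge: "j = Suc i \<Longrightarrow> 2 \<le> i \<Longrightarrow> i < m \<Longrightarrow> (a i, a j) \<in> D"
  by (auto simp: fork)

lemma edgeE:
  assumes "(u, v) \<in> D"
  obtains "u = a 2" "v = a 1" | i where "u = a i" "v = a (Suc i)" "2 \<le> i" "i < m"
  using assms unfolding fork by blast

lemma succ_iff:
  assumes "i \<in> {1..m}"
  shows "(a i, v) \<in> D \<longleftrightarrow> 2 \<le> i \<and> i < m \<and> v = a (Suc i) \<or> i = 2 \<and> v = a 1"
proof
  assume "(a i, v) \<in> D"
  then show "2 \<le> i \<and> i < m \<and> v = a (Suc i) \<or> i = 2 \<and> v = a 1"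
  proof (cases rule: edgeE)
    case 1
    then show ?thesis using vertex_eq_iff [of i 2] assms long by simp
  next
    case (2 j)
    then show ?thesis using vertex_eq_iff [of i j] assms long by simp
  qed
qed (use edge0 edge in auto)

lemma pred_iff:
  assumes "i \<in> {1..m}"
  shows "(u, a i) \<in> D \<longleftrightarrow> 3 \<le> i \<and> u = a (i - 1) \<or> i = 1 \<and> u = a 2"
proof
  assume "(u, a i) \<in> D"
  then show "3 \<le> i \<and> u = a (i - 1) \<or> i = 1 \<and> u = a 2"
  proof (cases rule: edgeE)
    case 1
    then show ?thesis using vertex_eq_iff [of i 1] assms long by simp
  next
    case (2 j)
    then have "i = Suc j" using vertex_eq_iff [of i "Suc j"] assms long by simp
    then show ?thesis using 2 by simp
  qed
qed (use edge0 edge [of i "i - 1"] assms in auto)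

lemma vertex: "i \<in> {1..m} \<Longrightarrow> a i \<in> T"
proof -
  assume i: "i \<in> {1..m}"
  consider "i = 1" | "i = 2" | "3 \<le> i" using i by force
  then show ?thesis
  proof cases
    case 3
    then show ?thesis using edge_letters [OF edge [of i "i - 1"]] i by simp
  qed (use edge_letters [OF edge0] in auto)
qed

text \<open>Commutation makes \<open>a 1\<close> a sink of the digraph on \<open>S\<close>, so inner
  vertices stay away from it, and the sliding argument applies to \<open>a 3\<close>, ...,
  \<open>a (m - 1)\<close>. Then \<open>a 2\<close> is recognised by its arcs to \<open>a 3\<close>
  and to the image of the sink; \<open>a 1\<close> and \<open>a m\<close> follow from their fixed
  neighbours.\<close>

lemma fork_fixed: "a ` {1..m} \<subseteq> cayley_fixed G S"
proof -
  have T: "a i \<in> S" if "i \<in> {1..m}" for i using vertex that by simp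
  have e23: "(a 2, a 3) \<in> D" "(a 3, a 4) \<in> D" using edge [of 3 2] edge [of 4 3] long by auto
  have e_last: "(a (m - 1), a m) \<in> D" "(a (m - 2), a (m - 1)) \<in> D"
    using long by (auto intro!: edge)
  define d where "d = a 1 \<otimes> inv (a 2)"
  define c where "c = a 3 \<otimes> inv (a 2)"
  have dc: "d \<in> S" "c \<in> S" using edge0 e23 by (auto simp: d_def c_def)
  have nQ: "a 2 \<otimes> a 1 \<otimes> a 2 \<noteq> a 1" using inverted_not_commuting [OF edge0] commute by blast
  \<comment> \<open>An arc leaving \<open>a 1\<close> could only lead to \<open>d\<close> and would
    need \<open>a 1\<close> to invert \<open>a 2\<close>, which contradicts commutation.\<close>
  have sink: "\<not> arc (a 1) u" if "u \<in> S" for u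
    using arc_from_letter [OF vertex [of 1] that] succ_iff [of 1] pred_iff [of 1] long nQ by auto
  have da: "arc d (a 1)"
    using arc_connector_letter [OF vertex [of 1] edge0] commute long by (simp add: d_def)
  have inner: "\<psi> (a i) = a i" if \<psi>: "\<psi> \<in> cayley_stabilizer G S" and i: "3 \<le> i" "i < m" for \<psi> i
  proof -
    note im = stab_in_S [OF \<psi> T]
    have mid: "\<psi> (a i) \<in> T" "\<psi> (a i) \<noteq> a 1" if "3 \<le> i" "i < m" for i
    proof -
      have e: "(a (i - 1), a i) \<in> D" "(a i, a (Suc i)) \<in> D" using that by (auto intro!: edge)
      show "\<psi> (a i) \<in> T" using middle_letter [OF \<psi> e] .
      show "\<psi> (a i) \<noteq> a 1" using sink [OF im [of "Suc i"]] stab_edge_arc [OF \<psi> e(2)] that by auto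
    qed
    have "arc (\<psi> (a 2)) (\<psi> (a 3))" using stab_edge_arc [OF \<psi> e23(1)] .
    then have "\<exists>u v. (u, v) \<in> D \<and> (\<psi> (a 3) = u \<or> \<psi> (a 3) = v)"
      using arc_to_letter [OF im [of 2] mid(1) [of 3]] long by auto
    then obtain k where k: "\<psi> (a 3) = a k" "k \<in> {2..m}"
      using mid(2) [of 3] long by (auto elim!: edgeE)
    have shift: "3 + j < m \<Longrightarrow> \<psi> (a (3 + j)) = a (k + j) \<and> k + j \<le> m" for j
    proof (induction j)
      case 0
      then show ?case using k by simp
    next
      case (Suc j)
      then have IH: "\<psi> (a (3 + j)) = a (k + j)" "k + j \<le> m" by simp_all
      have "(\<psi> (a (3 + j)), \<psi> (a (Suc (3 + j)))) \<in> D"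
        using Suc.prems by (intro letter_edge_image [OF \<psi> edge] mid) auto
      then show ?case using IH succ_iff [of "k + j"] k mid(2) [of "Suc (3 + j)"] Suc.prems by auto
    qed
    have "k + (m - 4) \<le> m" using shift [of "m - 4"] long by simp
    then have "k \<le> 4" using long by simp
    then consider "k = 2" | "k = 3" | "k = 4" using k by force
    then show ?thesis
    proof cases
      case 1
      \<comment> \<open>No edge enters \<open>a 2\<close>, so an arc into it starts at one of the
        connectors \<open>c\<close> and \<open>d\<close>.\<close>
      have "arc (\<psi> (a 2)) (a 2)" using stab_edge_arc [OF \<psi> e23(1)] 1 k by simp
      then have "\<psi> (a 2) = c \<and> root_rel (a 2) (a 3) \<or> \<psi> (a 2) = d \<and> root_rel (a 2) (a 1)"
        using arc_to_letter [OF im [of 2] vertex [of 2]] pred_iff [of 2] succ_iff [of 2] long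
        by (auto simp: c_def d_def numeral_3_eq_3 numeral_2_eq_2)
      then show ?thesis
      proof (elim disjE conjE)
        assume c2: "\<psi> (a 2) = c" "root_rel (a 2) (a 3)"
        have "arc c (\<psi> (a 1))" using stab_edge_arc [OF \<psi> edge0] c2 by simp
        then have "\<psi> (a 1) = a 3"
          using arc_from_connector [OF e23(1) im [of 1]] k 1 stab_eq_iff [OF \<psi> T [of 1] T [of 3]]
            vertex_eq_iff [of 1 3] long by (auto simp: c_def)
        moreover have "arc c (a 2)"
          using c2(2) arc_connector_letter [OF vertex [of 2] e23(1)] long
          by (simp add: c_def root_rel_def)
        then have "arc (\<psi> c) c" using stab_arc [OF \<psi> dc(2) T [of 2]] c2 long by simp
        then have "\<psi> c = a 3"
          using arc_to_connector [OF e23(1) stab_in_S [OF \<psi> dc(2)]] by (simp add: c_def)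
        ultimately have "a 1 = c" using stab_eq_iff [OF \<psi> T [of 1] dc(2)] long by simp
        then show ?thesis
          using letter_neq_connector [OF vertex [of 1] e23(1)] long by (simp add: c_def)
      next
        assume d2: "\<psi> (a 2) = d" "root_rel (a 2) (a 1)"
        have "arc d (a 2)"
          using d2(2) arc_connector_letter [OF vertex [of 2] edge0] long
          by (simp add: d_def root_rel_def)
        then have "arc (\<psi> d) d" using stab_arc [OF \<psi> dc(1) T [of 2]] d2 long by simp
        then show ?thesis
          using arc_to_connector [OF edge0 stab_in_S [OF \<psi> dc(1)]] nQ by (simp add: d_def)
      qed
    next
      case 2
      obtain j where "i = 3 + j" using i(1) le_iff_add by blast
      then show ?thesis using shift [of j] i 2 by simp
    next
      case 3
      have "3 + (m - 4) = m - 1" "4 + (m - 4) = m" using long by simp_all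
      then have last: "\<psi> (a (m - 1)) = a m" using shift [of "m - 4"] 3 long by simp
      have am: "arc (a m) (\<psi> (a m))" using stab_edge_arc [OF \<psi> e_last(1)] last by simp
      define b where "b = a m \<otimes> inv (a (m - 1))"
      have b: "b \<in> S" using e_last by (simp add: b_def)
      have Q: "\<psi> (a m) = b" "a (m - 1) \<otimes> a m \<otimes> a (m - 1) = a m"
        using arc_from_letter [OF vertex [of m] im [of m] am] succ_iff [of m] pred_iff [of m] long
        by (auto simp: b_def)
      have nc: "a (m - 1) \<otimes> a m \<noteq> a m \<otimes> a (m - 1)"
        using inverted_not_commuting [OF e_last(1) Q(2)] .
      have "arc (a m) b"
        using arc_letter_connector [OF vertex [of m] e_last(1)] Q(2) long by (simp add: b_def)
      then have "arc b (\<psi> b)" using stab_arc [OF \<psi> T [of m] b] Q(1) long by simp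
      then have \<psi>b: "\<psi> b = a (m - 1)"
        using arc_from_connector [OF e_last(1) stab_in_S [OF \<psi> b]] nc by (auto simp: b_def)
      from stab_edge_arc [OF \<psi> e_last(2)] have "arc (\<psi> (a (m - 2))) (a m)" using last by simp
      then have "\<psi> (a (m - 2)) = a (m - 1)"
        using arc_to_letter [OF im [of "m - 2"] vertex [of m]] succ_iff [of m] pred_iff [of m]
          long nc by auto
      then have "a (m - 2) = b" using stab_eq_iff [OF \<psi> T [of "m - 2"] b] \<psi>b long by simp
      moreover have "m - 2 \<in> {1..m}" using long by auto
      ultimately show ?thesis using letter_neq_connector [OF vertex e_last(1)] b_def by blast
    qed
  qed
  have second: "\<psi> (a 2) = a 2" if \<psi>: "\<psi> \<in> cayley_stabilizer G S" for \<psi>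
  proof -
    note im = stab_in_S [OF \<psi> T]
    define b where "b = a 4 \<otimes> inv (a 3)"
    have a3: "\<psi> (a 3) = a 3" using inner [OF \<psi>, of 3] long by simp
    have "arc (\<psi> (a 2)) (a 3)" using stab_edge_arc [OF \<psi> e23(1)] a3 by simp
    then consider "\<psi> (a 2) = a 2" | "\<psi> (a 2) = c" | "\<psi> (a 2) = b"
      using arc_to_letter [OF im [of 2] vertex [of 3]] pred_iff [of 3] succ_iff [of 3] long
      by (auto simp: c_def b_def)
    then show ?thesis
    proof cases
      case 2
      \<comment> \<open>The out-neighbours of \<open>c\<close> are among \<open>a 2\<close> and
        \<open>a 3\<close>. The latter is taken, and \<open>a 2\<close> is no possible image of a
        sink, having an arc to the fixed \<open>a 3\<close>.\<close>
      have "arc c (\<psi> (a 1))" using stab_edge_arc [OF \<psi> edge0] 2 by simp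
      then have a1: "\<psi> (a 1) = a 2"
        using arc_from_connector [OF e23(1) im [of 1]] a3 stab_eq_iff [OF \<psi> T [of 1] T [of 3]]
          vertex_eq_iff [of 1 3] long by (auto simp: c_def)
      have "arc (a 2) (a 3)" using arc_letter_letter e23(1) by simp
      then have "arc (a 1) (a 3)" using stab_arc [OF \<psi> T [of 1] T [of 3]] a1 a3 long by simp
      then show ?thesis using sink T [of 3] long by simp
    next
      case 3
      have "arc b (\<psi> (a 1))" using stab_edge_arc [OF \<psi> edge0] 3 by simp
      then have a1: "\<psi> (a 1) = a 4"
        using arc_from_connector [OF e23(2) im [of 1]] a3 stab_eq_iff [OF \<psi> T [of 1] T [of 3]]
          vertex_eq_iff [of 1 3] long by (auto simp: b_def)
      \<comment> \<open>For larger \<open>m\<close> the letter \<open>a 4\<close> is inner, hence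
        fixed, and cannot be the image of \<open>a 1\<close>.\<close>
      have "m = 4"
      proof (rule ccontr)
        assume "m \<noteq> 4"
        then have "\<psi> (a 4) = a 4" using inner [OF \<psi>, of 4] long by simp
        then show False
          using a1 stab_eq_iff [OF \<psi> T [of 1] T [of 4]] vertex_eq_iff [of 1 4] long by simp
      qed
      \<comment> \<open>The in-neighbours of \<open>a 4\<close> are among \<open>a 3\<close> and
        \<open>b\<close>, which are already the images of \<open>a 3\<close> and \<open>a 2\<close>;
        nothing is left for \<open>d\<close>.\<close>
      have "arc (\<psi> d) (a 4)" using stab_arc [OF \<psi> dc(1) T [of 1]] da a1 long by simp
      then have "\<psi> d = a 3 \<or> \<psi> d = b"
        using arc_to_letter [OF stab_in_S [OF \<psi> dc(1)] vertex [of 4]] pred_iff [of 4]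
          succ_iff [of 4] \<open>m = 4\<close> by (auto simp: b_def)
      then have "d = a 3 \<or> d = a 2"
        using 3 a3 stab_eq_iff [OF \<psi> dc(1) T [of 3]] stab_eq_iff [OF \<psi> dc(1) T [of 2]] long by auto
      then show ?thesis
        using letter_neq_connector [OF vertex [of 3] edge0] letter_neq_connector [OF vertex [of 2] edge0]
          long by (auto simp: d_def)
    qed
  qed
  have F: "a i \<in> cayley_fixed G S" if "2 \<le> i" "i < m" for i
    using inner second vertex [of i] that by (cases "i = 2") (auto intro!: fixedI)
  have last: "a m \<in> cayley_fixed G S"
  proof (rule fixedI)
    fix \<psi> assume \<psi>: "\<psi> \<in> cayley_stabilizer G S"
    define b where "b = a (m - 1) \<otimes> inv (a (m - 2))"
    have "b \<in> cayley_fixed G S"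
      using fixed_connector [OF F [of "m - 2"] F [of "m - 1"]] long by (simp add: b_def)
    then have b: "\<psi> b = b" "b \<in> S" using fixedD [OF _ \<psi>] e_last by (auto simp: b_def)
    have "arc (a (m - 1)) (\<psi> (a m))"
      using stab_edge_arc [OF \<psi> e_last(1)] inner [OF \<psi>, of "m - 1"] long by simp
    moreover have r: "m - 1 \<in> {1..m}" "m \<in> {1..m}" "3 \<le> m - 1"
      using long by auto
    ultimately have "(a (m - 1), \<psi> (a m)) \<in> D \<or>
        (\<exists>x. (x, a (m - 1)) \<in> D \<and> \<psi> (a m) = a (m - 1) \<otimes> inv x)"
      using arc_from_letter [OF vertex [OF r(1)] stab_in_S [OF \<psi> T [OF r(2)]]] by blast
    moreover have "m - 1 - 1 = m - 2" "Suc (m - 1) = m" using long by auto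
    ultimately have "\<psi> (a m) = a m \<or> \<psi> (a m) = b"
      using r unfolding pred_iff [OF r(1)] succ_iff [OF r(1)] b_def by auto
    moreover have "a m \<noteq> b"
      using letter_neq_connector [OF vertex [of m] e_last(2)] long by (simp add: b_def)
    ultimately show "\<psi> (a m) = a m"
      using b stab_eq_iff [OF \<psi> T [of m] b(2)] long by auto
  qed (use vertex [of m] long in simp)
  have first: "a 1 \<in> cayley_fixed G S"
  proof (rule fixedI)
    fix \<psi> assume \<psi>: "\<psi> \<in> cayley_stabilizer G S"
    have "arc (a 2) (\<psi> (a 1))" using stab_edge_arc [OF \<psi> edge0] second [OF \<psi>] by simp
    then have "\<psi> (a 1) = a 1 \<or> \<psi> (a 1) = a 3"
      using arc_from_letter [OF vertex [of 2] stab_in_S [OF \<psi> T [of 1]]] long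
        pred_iff [of 2] succ_iff [of 2] by (auto simp: numeral_eq_Suc)
    then show "\<psi> (a 1) = a 1"
      using inner [OF \<psi>, of 3] stab_eq_iff [OF \<psi> T [of 1] T [of 3]] vertex_eq_iff [of 1 3] long
      by auto
  qed (use vertex [of 1] long in simp)
  show ?thesis
  proof
    fix x assume "x \<in> a ` {1..m}"
    then obtain i where "x = a i" "i \<in> {1..m}" by blast
    then show "x \<in> cayley_fixed G S"
      using first last F [of i] by (cases "i = 1 \<or> i = m") auto
  qed
qed

end

section \<open>Choice of the edges for a given list of generators\<close>

context avoiding_graph
begin

lemma admits_ORR_if_letters_fixed:
  assumes "generate G T = carrier G" "T \<subseteq> cayley_fixed G S"
  shows "admits_ORR G"
  using admits_ORR_if_fixed [OF S_closed S_mult_neq_one assms(2,1)] .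

end

context avoiding
begin

text \<open>Adjacent vertices have indices of different parity, so no three vertices are pairwise
  adjacent.\<close>

lemma avoiding_graph_index:
  fixes m :: nat
  assumes inj: "inj_on a {1..m}" and T: "a ` {1..m} \<subseteq> T"
    and D: "\<And>x y. (x, y) \<in> D \<Longrightarrow> \<exists>i j. x = a i \<and> y = a j \<and> i \<in> {1..m} \<and> j \<in> {1..m} \<and>
       (j = Suc i \<or> i = Suc j) \<and> (y \<otimes> inv x) \<otimes> (y \<otimes> inv x) \<noteq> \<one>"
    and anti: "\<And>x y. (x, y) \<in> D \<Longrightarrow> (y, x) \<notin> D"
  shows "avoiding_graph G T D"
proof unfold_locales
  show "x \<in> T \<and> y \<in> T" if "(x, y) \<in> D" for x y using D [OF that] T by blast
  show "(y \<otimes> inv x) \<otimes> (y \<otimes> inv x) \<noteq> \<one>" if "(x, y) \<in> D" for x y using D [OF that] by blast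
  show "(y, x) \<notin> D" if "(x, y) \<in> D" for x y using anti [OF that] .
  have adj: "\<exists>i j. x = a i \<and> y = a j \<and> i \<in> {1..m} \<and> j \<in> {1..m} \<and> (j = Suc i \<or> i = Suc j)"
    if "(x, y) \<in> D \<union> D\<inverse>" for x y
    using that D [of x y] D [of y x] by blast
  show "(z, x) \<notin> D \<union> D\<inverse>" if xy: "(x, y) \<in> D \<union> D\<inverse>" and yz: "(y, z) \<in> D \<union> D\<inverse>" for x y z
  proof
    assume zx: "(z, x) \<in> D \<union> D\<inverse>"
    obtain i j where 1: "x = a i" "y = a j" "i \<in> {1..m}" "j \<in> {1..m}" "j = Suc i \<or> i = Suc j"
      using adj [OF xy] by blast
    obtain j' k where 2: "y = a j'" "z = a k" "j' \<in> {1..m}" "k \<in> {1..m}" "k = Suc j' \<or> j' = Suc k"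
      using adj [OF yz] by blast
    obtain k' i' where 3: "z = a k'" "x = a i'" "k' \<in> {1..m}" "i' \<in> {1..m}" "i' = Suc k' \<or> k' = Suc i'"
      using adj [OF zx] by blast
    have "i = i'" "j = j'" "k = k'"
      using 1(1-4) 2(1-4) 3(1-4) inj_on_eq_iff [OF inj] by metis+
    then show False using 1(5) 2(5) 3(5) by presburger
  qed
qed

lemma ORR_of_long_path:
  assumes gen: "generate G T = carrier G" and inj: "inj_on a {1..m}" and T: "T = a ` {1..m}"
    and sq: "\<And>i. 1 \<le> i \<Longrightarrow> i < m \<Longrightarrow> (a (Suc i) \<otimes> inv (a i)) \<otimes> (a (Suc i) \<otimes> inv (a i)) \<noteq> \<one>"
    and m: "4 \<le> m"
  shows "admits_ORR G"
proof (cases "a 1 \<otimes> a 2 = a 2 \<otimes> a 1")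
  case False
  define D where "D = {(a i, a (Suc i)) | i. 1 \<le> i \<and> i < m}"
  have eqI: "i = j" if "a i = a j" "1 \<le> i" "i \<le> m" "1 \<le> j" "j \<le> m" for i j
    using inj_on_eq_iff [OF inj, of i j] that by simp
  interpret avoiding_graph G T D
  proof (rule avoiding_graph_index [OF inj])
    show "\<exists>i j. x = a i \<and> y = a j \<and> i \<in> {1..m} \<and> j \<in> {1..m} \<and>
       (j = Suc i \<or> i = Suc j) \<and> (y \<otimes> inv x) \<otimes> (y \<otimes> inv x) \<noteq> \<one>" if "(x, y) \<in> D" for x y
    proof -
      obtain i where "x = a i" "y = a (Suc i)" "1 \<le> i" "i < m" using \<open>(x, y) \<in> D\<close> D_def by blast
      then show ?thesis using sq by (intro exI [of _ i] exI [of _ "Suc i"]) simp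
    qed
    show "(y, x) \<notin> D" if "(x, y) \<in> D" for x y
    proof
      assume "(y, x) \<in> D"
      then obtain j where j: "y = a j" "x = a (Suc j)" "1 \<le> j" "j < m" using D_def by blast
      obtain i where i: "x = a i" "y = a (Suc i)" "1 \<le> i" "i < m" using \<open>(x, y) \<in> D\<close> D_def by blast
      have "Suc i = j" using i j by (intro eqI) auto
      moreover have "i = Suc j" using i j by (intro eqI) auto
      ultimately show False by simp
    qed
  qed (use T in simp)
  interpret avoiding_path G T D a m
    by unfold_locales (use inj m D_def in auto)
  show ?thesis
    using admits_ORR_if_letters_fixed [OF gen] long_path_fixed [OF m False] T by blast
next
  case True
  define D where "D = insert (a 2, a 1) {(a i, a (Suc i)) | i. 2 \<le> i \<and> i < m}"
  have eqI: "i = j" if "a i = a j" "1 \<le> i" "i \<le> m" "1 \<le> j" "j \<le> m" for i j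
    using inj_on_eq_iff [OF inj, of i j] that by simp
  have C: "a i \<in> carrier G" if "i \<in> {1..m}" for i using T that letters by blast
  have DE: "\<exists>i j. x = a i \<and> y = a j \<and> i \<in> {1..m} \<and> j \<in> {1..m} \<and>
     (i = 2 \<and> j = 1 \<or> 2 \<le> i \<and> j = Suc i)" if "(x, y) \<in> D" for x y
  proof -
    consider "x = a 2" "y = a 1" | i where "x = a i" "y = a (Suc i)" "2 \<le> i" "i < m"
      using \<open>(x, y) \<in> D\<close> unfolding D_def by blast
    then show ?thesis
    proof cases
      case 1
      then show ?thesis using m by (intro exI [of _ 2] exI [of _ 1]) simp
    next
      case (2 i)
      then show ?thesis by (intro exI [of _ i] exI [of _ "Suc i"]) simp
    qed
  qed
  interpret avoiding_graph G T D
  proof (rule avoiding_graph_index [OF inj])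
    show "\<exists>i j. x = a i \<and> y = a j \<and> i \<in> {1..m} \<and> j \<in> {1..m} \<and>
       (j = Suc i \<or> i = Suc j) \<and> (y \<otimes> inv x) \<otimes> (y \<otimes> inv x) \<noteq> \<one>" if xy: "(x, y) \<in> D" for x y
    proof -
      obtain i j where ij: "x = a i" "y = a j" "i \<in> {1..m}" "j \<in> {1..m}"
        "i = 2 \<and> j = 1 \<or> 2 \<le> i \<and> j = Suc i" using DE [OF xy] by blast
      have s: "(a 1 \<otimes> inv (a 2)) \<otimes> (a 1 \<otimes> inv (a 2)) \<noteq> \<one>"
        using quotient_square_swap [OF C [of 1] C [of 2]] sq [of 1] m by (simp add: numeral_2_eq_2)
      have "(y \<otimes> inv x) \<otimes> (y \<otimes> inv x) \<noteq> \<one>"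
      proof (cases "i = 2 \<and> j = 1")
        case False
        then have "j = Suc i" using ij by blast
        then show ?thesis using ij sq [of i] by simp
      qed (use ij s in simp)
      then show ?thesis using ij by (intro exI [of _ i] exI [of _ j]) auto
    qed
    show "(y, x) \<notin> D" if xy: "(x, y) \<in> D" for x y
    proof
      assume "(y, x) \<in> D"
      obtain i j where ij: "x = a i" "y = a j" "i \<in> {1..m}" "j \<in> {1..m}"
        "i = 2 \<and> j = 1 \<or> 2 \<le> i \<and> j = Suc i" using DE [OF xy] by blast
      obtain i' j' where ij': "y = a i'" "x = a j'" "i' \<in> {1..m}" "j' \<in> {1..m}"
        "i' = 2 \<and> j' = 1 \<or> 2 \<le> i' \<and> j' = Suc i'" using DE [OF \<open>(y, x) \<in> D\<close>] by blast
      have "i = j'" using eqI [of i j'] ij(1,3) ij'(2,4) by simp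
      moreover have "j = i'" using eqI [of j i'] ij(2,4) ij'(1,3) by simp
      ultimately show False using ij(5) ij'(5) by presburger
    qed
  qed (use T in simp)
  interpret avoiding_fork G T D a m
    by unfold_locales (use inj m D_def True in auto)
  show ?thesis
    using admits_ORR_if_letters_fixed [OF gen] fork_fixed T by blast
qed

section \<open>Two or three generators with a noncommuting edge\<close>

lemma ORR_of_short_path:
  assumes gen: "generate G T = carrier G" and T: "T = {x, y, z}"
    and dist: "x \<noteq> y" "y \<noteq> z" "x \<noteq> z"
    and sq: "(y \<otimes> inv x) \<otimes> (y \<otimes> inv x) \<noteq> \<one>" "(z \<otimes> inv y) \<otimes> (z \<otimes> inv y) \<noteq> \<one>"
    and nc: "x \<otimes> y \<noteq> y \<otimes> x"
    and good: "\<not> (x \<otimes> y \<otimes> x = y \<and> y \<otimes> y = z \<otimes> z \<and> (x \<otimes> x = y \<otimes> y \<longleftrightarrow> y \<otimes> z \<otimes> y = z))"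
  shows "admits_ORR G"
proof -
  define a where "a i = (if i = 1 then x else if i = 2 then y else z)" for i :: nat
  have av: "a 1 = x" "a 2 = y" "a 3 = z" by (simp_all add: a_def)
  have three: "i = 1 \<or> i = 2 \<or> i = 3" if "i \<in> {1..3}" for i :: nat using that by auto
  have inj: "inj_on a {1..3}"
    by (rule inj_onI) (use three dist in \<open>auto simp: a_def split: if_splits\<close>)
  define D where "D = {(x, y), (y, z)}"
  interpret avoiding_graph G T D
  proof (rule avoiding_graph_index [OF inj])
    show "\<exists>i j. u = a i \<and> v = a j \<and> i \<in> {1..3} \<and> j \<in> {1..3} \<and>
       (j = Suc i \<or> i = Suc j) \<and> (v \<otimes> inv u) \<otimes> (v \<otimes> inv u) \<noteq> \<one>" if "(u, v) \<in> D" for u v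
    proof -
      consider "u = x" "v = y" | "u = y" "v = z" using \<open>(u, v) \<in> D\<close> D_def by blast
      then show ?thesis
      proof cases
        case 1
        then show ?thesis using sq av by (intro exI [of _ 1] exI [of _ 2]) simp
      next
        case 2
        then show ?thesis using sq av by (intro exI [of _ 2] exI [of _ 3]) simp
      qed
    qed
    show "a ` {1..3} \<subseteq> T"
    proof
      fix t assume "t \<in> a ` {1..3}"
      then obtain i where i: "t = a i" "i \<in> {1..3}" by blast
      show "t \<in> T" using three [OF i(2)] i(1) av T by auto
    qed
    show "(v, u) \<notin> D" if "(u, v) \<in> D" for u v
    proof -
      from that have "u = x \<and> v = y \<or> u = y \<and> v = z" by (simp add: D_def)
      then show ?thesis using dist by (elim disjE) (simp_all add: D_def)
    qed
  qed
  interpret avoiding_path G T D a 3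
  proof unfold_locales
    have iff: "1 \<le> i \<and> i < 3 \<longleftrightarrow> i = 1 \<or> i = 2" for i :: nat by auto
    have "{(a i, a (Suc i)) | i. i = 1 \<or> i = 2} = {(a 1, a (Suc 1)), (a 2, a (Suc 2))}" by blast
    then show "D = {(a i, a (Suc i)) | i. 1 \<le> i \<and> i < 3}"
      unfolding iff D_def by (simp add: a_def)
  qed (use inj in auto)
  show ?thesis
    using admits_ORR_if_letters_fixed [OF gen] short_path_fixed [OF refl av [symmetric] nc good] T
    by blast
qed

lemma avoiding_graph_edge:
  assumes "x \<in> T" "y \<in> T" "x \<noteq> y" "(y \<otimes> inv x) \<otimes> (y \<otimes> inv x) \<noteq> \<one>"
  shows "avoiding_graph G T {(x, y)}"
  by unfold_locales (use assms in auto)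

text \<open>By noncommutation the digraph on x, y and b = y x^{-1} has the arc from x to y, possibly
  one from y to b (if xyx = y) and possibly one from b to x (if x^2 = y^2). Unless both are present,
  it is a directed path with at most one further isolated vertex, and rigid.\<close>

lemma ORR_of_edge:
  assumes gen: "generate G T = carrier G" and T: "T = {x, y}" "x \<noteq> y"
    and sq: "(y \<otimes> inv x) \<otimes> (y \<otimes> inv x) \<noteq> \<one>"
    and nc: "x \<otimes> y \<noteq> y \<otimes> x"
    and good: "\<not> (x \<otimes> y \<otimes> x = y \<and> x \<otimes> x = y \<otimes> y)"
  shows "admits_ORR G"
proof -
  interpret avoiding_graph G T "{(x, y)}"
    by (rule avoiding_graph_edge) (use T sq in auto)
  define b where "b = y \<otimes> inv x"
  have D: "(x, y) \<in> {(x, y)}" by simp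
  have conn: "connectors = {b}" by (auto simp: connectors_def b_def)
  have xT: "x \<in> T" "y \<in> T" and S: "x \<in> S" "y \<in> S" "b \<in> S" using T conn by auto
  have from_b: "u = x \<and> x \<otimes> x = y \<otimes> y" if "u \<in> S" "arc b u" for u
    using arc_from_connector [OF D that [unfolded b_def]] nc root_commuting [OF D]
    unfolding root_rel_def by blast
  have to_b: "u = y \<and> x \<otimes> y \<otimes> x = y" if "u \<in> S" "arc u b" for u
    using arc_to_connector [OF D that [unfolded b_def]] .
  have "\<psi> x = x \<and> \<psi> y = y" if \<psi>: "\<psi> \<in> cayley_stabilizer G S" for \<psi>
  proof -
    note im = stab_in_S [OF \<psi> S(1)] stab_in_S [OF \<psi> S(2)] stab_in_S [OF \<psi> S(3)]
    have a: "arc (\<psi> x) (\<psi> y)" using stab_edge_arc [OF \<psi> D] .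
    have "\<psi> x \<in> T \<or> \<psi> x = b" "\<psi> y \<in> T \<or> \<psi> y = b" using im conn by blast+
    then consider "\<psi> x \<in> T" "\<psi> y \<in> T" | "\<psi> x = b" | "\<psi> y = b" by argo
    then show ?thesis
    proof cases
      case 1
      then show ?thesis using a arc_letter_letter by auto
    next
      case 2
      then have y: "\<psi> y = x" and sq: "x \<otimes> x = y \<otimes> y" using from_b [OF im(2)] a by simp_all
      have "arc b x" using arc_connector_letter [OF xT(1) D] sq by (simp add: b_def)
      then have "arc (\<psi> b) b" using stab_arc [OF \<psi> S(3,1)] 2 by simp
      then show ?thesis using to_b [OF im(3)] sq good by blast
    next
      case 3
      then have y: "\<psi> x = y" and q: "x \<otimes> y \<otimes> x = y" using to_b [OF im(1)] a by simp_all
      have "arc y b" using arc_letter_connector [OF xT(2) D] q by (simp add: b_def)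
      then have "arc b (\<psi> b)" using stab_arc [OF \<psi> S(2,3)] 3 by simp
      then show ?thesis using from_b [OF im(3)] q good by blast
    qed
  qed
  then have "x \<in> cayley_fixed G S" "y \<in> cayley_fixed G S"
    using fixedI [OF xT(1)] fixedI [OF xT(2)] by blast+
  then have "T \<subseteq> cayley_fixed G S" unfolding T(1) by blast
  then show ?thesis using admits_ORR_if_letters_fixed [OF gen] by blast
qed

text \<open>Here the arcs inside the connection set form a directed triangle and an isolated vertex \<open>w\<close>,
  so they do not suffice. The element \<open>e\<close> is singled out in the triangle because it is the only one
  that has two common out-neighbours with \<open>w\<close>, namely \<open>w\<^sup>2 = e\<^sup>2\<close> and \<open>we = ew\<close>.\<close>

lemma ORR_of_quaternion_triple:
  assumes gen: "generate G T = carrier G" and T: "T = {x, y, w}" "x \<noteq> y" "w \<noteq> x" "w \<noteq> y"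
    and sq: "(y \<otimes> inv x) \<otimes> (y \<otimes> inv x) \<noteq> \<one>"
    and Q: "x \<otimes> y \<otimes> x = y" "x \<otimes> x = y \<otimes> y" "w \<otimes> w = x \<otimes> x"
    and e: "e \<in> {x, y, y \<otimes> inv x}" "w \<otimes> e = e \<otimes> w"
    and f: "\<And>f. f \<in> {x, y, y \<otimes> inv x} \<Longrightarrow> f \<noteq> e \<Longrightarrow> w \<otimes> f = inv f \<otimes> w"
  shows "admits_ORR G"
proof -
  interpret avoiding_graph G T "{(x, y)}"
    by (rule avoiding_graph_edge) (use T sq in auto)
  define b where "b = y \<otimes> inv x"
  have D: "(x, y) \<in> {(x, y)}" by simp
  have conn: "connectors = {b}" by (auto simp: connectors_def b_def)
  have xT: "x \<in> T" "y \<in> T" "w \<in> T" and S: "x \<in> S" "y \<in> S" "b \<in> S" "w \<in> S" using T conn by auto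
  have C: "x \<in> carrier G" "y \<in> carrier G" "b \<in> carrier G" "w \<in> carrier G"
    using S S_in_carrier by blast+
  have S_eq: "S = {x, y, b, w}" using T(1) conn by blast
  have neq: "b \<noteq> x" "b \<noteq> y" "b \<noteq> w"
    using letter_neq_connector [OF _ D] xT b_def by blast+
  have bxy: "b = x \<otimes> y" using Q(1) inverts_iff(1) [OF C(1,2)] by (simp add: b_def)
  have bb: "b \<otimes> b = x \<otimes> x"
  proof -
    have "b \<otimes> b = x \<otimes> y \<otimes> x \<otimes> y" using C bxy by (simp add: m_assoc)
    then show ?thesis using Q by simp
  qed
  have sq_eq: "v \<otimes> v = w \<otimes> w" if "v \<in> {x, y, b}" for v using that Q bb by auto
  have arcs: "arc x y" "arc y b" "arc b x"
    using arc_letter_letter [OF xT(1,2)] arc_letter_connector [OF xT(2) D]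
      arc_connector_letter [OF xT(1) D] Q(1,2) by (auto simp: b_def)
  have no_arc_w: "\<not> arc w u" if "u \<in> S" for u
    using arc_from_letter [OF xT(3) that] T by auto
  have from_x: "u = y" if "u \<in> S" "arc x u" for u
    using arc_from_letter [OF xT(1) that] T by auto
  have from_y: "u = b" if "u \<in> S" "arc y u" for u
    using arc_from_letter [OF xT(2) that] T by (auto simp: b_def)
  have nc: "x \<otimes> y \<noteq> y \<otimes> x" using inverted_not_commuting [OF D Q(1)] .
  have from_b: "u = x" if "u \<in> S" "arc b u" for u
    using arc_from_connector [OF D that [unfolded b_def]] nc by blast

  \<comment> \<open>A common out-neighbour of \<open>v\<close> and \<open>w\<close> is a solution of
    s v = s' w with s, s' in \<open>S\<close>; for \<open>v\<close> other than \<open>e\<close> only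
    s' = w survives.\<close>
  have unique: "h = w \<otimes> w"
    if h: "h \<in> carrier G" "arc v h" "arc w h" and v: "v \<in> {x, y, b}" "v \<noteq> e" for h v
  proof -
    define s where "s = h \<otimes> inv v"
    define s' where "s' = h \<otimes> inv w"
    have vC: "v \<in> carrier G" using v C by blast
    have s: "s \<in> S" "s' \<in> S" using h s_def s'_def by auto
    have sC: "s \<in> carrier G" "s' \<in> carrier G" using s S_in_carrier by blast+
    have h1: "h = s \<otimes> v" "h = s' \<otimes> w" using h vC C by (simp_all add: s_def s'_def m_assoc)
    show ?thesis
    proof (cases "s' = w")
      case False
      then have s': "s' \<in> {x, y, b}" using s S_eq by blast
      show ?thesis
      proof (cases "s = w")
        case True
        \<comment> \<open>As \<open>w\<close> inverts \<open>v\<close>, the equation w v = s' w says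
          that s' is the inverse of \<open>v\<close>, against antisymmetry of
          \<open>S\<close>.\<close>
        have "w \<otimes> v = inv v \<otimes> w" using f v by (simp add: b_def)
        then have "inv v \<otimes> w = s' \<otimes> w" using h1 True by simp
        then have "inv v = s'" using vC sC C by simp
        then have "v \<otimes> s' = \<one>" using vC r_inv by blast
        then show ?thesis using S_mult_neq_one [of v s'] s v S by blast
      next
        case False
        then have s0: "s \<in> {x, y, b}" using s S_eq by blast
        \<comment> \<open>Spelling the connector as two letters turns s v = s' w into a relation
          containing \<open>w\<close> exactly once. Its length is at most six unless s, v and s' all
          equal \<open>b\<close>, and then cancelling \<open>b\<close> gives b = w.\<close>
        define rep where "rep u = (if u = b then [(y, True), (x, False)] else [(u, True)])" for u
        have rep: "word G (rep u) = u" "fst ` set (rep u) \<subseteq> {x, y}" "length (rep u) \<le> 2"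
          "u \<noteq> b \<Longrightarrow> length (rep u) = 1" "fst ` set (rep u) \<subseteq> carrier G" if "u \<in> {x, y, b}" for u
          using that C by (auto simp: rep_def b_def)
        have notall: "\<not> (s = b \<and> v = b \<and> s' = b)"
        proof
          assume "s = b \<and> v = b \<and> s' = b"
          then have "b \<otimes> b = b \<otimes> w" using h1 by simp
          then show False using C neq by simp
        qed
        have len: "length (rep s @ rep v) + length (rep s' @ [(w, True)]) \<le> 6"
          using rep(3,4) [OF s0] rep(3,4) [OF v(1)] rep(3,4) [OF s'] notall by auto
        have eq: "word G (rep s @ rep v) = word G (rep s' @ [(w, True)])"
          using rep [OF s0] rep [OF v(1)] rep [OF s'] h1 C by (simp add: word_append)
        have "2 \<le> count_list (map fst ((rep s @ rep v) @ (rep s' @ [(w, True)]))) w"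
          by (rule word_eq_letter_twice [OF eq len])
            (use rep(2) [OF s0] rep(2) [OF v(1)] rep(2) [OF s'] xT in auto)
        moreover have "count_list (map fst (rep u)) w = 0" if "u \<in> {x, y, b}" for u
          using rep(2) [OF that] T by (auto simp: count_list_0_iff)
        ultimately show ?thesis using s0 v(1) s' by simp
      qed
    qed (use h1 in simp)
  qed
  have fixed: "\<psi> x = x \<and> \<psi> y = y \<and> \<psi> w = w" if \<psi>: "\<psi> \<in> cayley_stabilizer G S" for \<psi>
  proof -
    note im = stab_in_S [OF \<psi> S(1)] stab_in_S [OF \<psi> S(2)] stab_in_S [OF \<psi> S(3)] stab_in_S [OF \<psi> S(4)]
    have ar: "arc (\<psi> x) (\<psi> y)" "arc (\<psi> y) (\<psi> b)" "arc (\<psi> b) (\<psi> x)"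
      using stab_arc [OF \<psi> S(1,2)] stab_arc [OF \<psi> S(2,3)] stab_arc [OF \<psi> S(3,1)] arcs by blast+
    have nw: "\<psi> x \<noteq> w" "\<psi> y \<noteq> w" "\<psi> b \<noteq> w"
      using no_arc_w im ar by auto
    have im': "\<psi> x \<in> {x, y, b}" "\<psi> y \<in> {x, y, b}" "\<psi> b \<in> {x, y, b}"
      using im nw S_eq by blast+
    have ne: "\<psi> x \<noteq> \<psi> y" "\<psi> x \<noteq> \<psi> b" "\<psi> y \<noteq> \<psi> b" "\<psi> w \<noteq> \<psi> x" "\<psi> w \<noteq> \<psi> y" "\<psi> w \<noteq> \<psi> b"
      using stab_eq_iff [OF \<psi>] S T neq by auto
    have w: "\<psi> w = w"
    proof -
      have "\<psi> w \<in> {x, y, b, w}" using im(4) unfolding S_eq .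
      then show ?thesis using im' ne by auto
    qed
    have eS: "e \<in> {x, y, b}" using e b_def by simp
    have eC: "e \<in> carrier G" using eS C by blast
    define g where "g = w \<otimes> e"
    define z where "z = w \<otimes> w"
    have gz: "g \<in> carrier G" "z \<in> carrier G" using eC C by (simp_all add: g_def z_def)
    have "w \<noteq> e" using eS T neq by auto
    then have "g \<noteq> z" using eC C by (simp add: g_def z_def)
    have a1: "arc e z"
    proof -
      have "z \<otimes> inv e = e" using sq_eq [OF eS] eC by (simp add: z_def m_assoc flip: sq_eq [OF eS])
      then show ?thesis using eS S by auto
    qed
    have a2: "arc w z" using C S by (simp add: z_def m_assoc)
    have a3: "arc e g" using eC C S by (simp add: g_def m_assoc)
    have a4: "arc w g"
    proof -
      have "g \<otimes> inv w = e" using e(2) eC C by (simp add: g_def m_assoc)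
      then show ?thesis using eS S by auto
    qed
    have "\<psi> e = e"
    proof (rule ccontr)
      assume ne: "\<psi> e \<noteq> e"
      have \<psi>e: "\<psi> e \<in> {x, y, b}" using eS im' by auto
      have "arc (\<psi> e) (\<psi> z)" "arc w (\<psi> z)" "arc (\<psi> e) (\<psi> g)" "arc w (\<psi> g)"
        using stabilizer_arc_iff [OF \<psi>] eC C gz a1 a2 a3 a4 w by metis+
      then have "\<psi> z = w \<otimes> w" "\<psi> g = w \<otimes> w"
        using unique [OF _ _ _ \<psi>e ne] stabilizer_closed [OF \<psi>] gz by blast+
      then show False using stabilizer_inj [OF \<psi> gz] \<open>g \<noteq> z\<close> by simp
    qed
    then consider "\<psi> x = x" | "\<psi> y = y" | "\<psi> b = b" using eS by blast
    then have x: "\<psi> x = x"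
      using from_y [OF im(3)] from_b [OF im(1)] ar(2,3) by cases simp_all
    then show ?thesis using w from_x [OF im(2)] ar(1) by simp
  qed
  have "x \<in> cayley_fixed G S" "y \<in> cayley_fixed G S" "w \<in> cayley_fixed G S"
    using fixedI [OF xT(1)] fixedI [OF xT(2)] fixedI [OF xT(3)] fixed by blast+
  then have "T \<subseteq> cayley_fixed G S" unfolding T(1) by blast
  then show ?thesis using admits_ORR_if_letters_fixed [OF gen] by blast
qed

text \<open>If the path fails in both directions, the three squares agree and both x, y and y, z
  satisfy the quaternion relations. What remains is decided by x and z: if they commute, x is the
  distinguished element of the directed triangle; if z inverts x, it is y x^{-1}; otherwise the path
  y, x, z works.\<close>

lemma ORR_of_three_noncommuting:
  assumes gen: "generate G T = carrier G" and T: "T = {x, y, z}"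
    and dist: "x \<noteq> y" "y \<noteq> z" "x \<noteq> z"
    and sq: "(y \<otimes> inv x) \<otimes> (y \<otimes> inv x) \<noteq> \<one>" "(z \<otimes> inv y) \<otimes> (z \<otimes> inv y) \<noteq> \<one>"
    and nc: "x \<otimes> y \<noteq> y \<otimes> x"
  shows "admits_ORR G"
proof (rule ccontr)
  assume no: "\<not> admits_ORR G"
  have C: "x \<in> carrier G" "y \<in> carrier G" "z \<in> carrier G" using T letters by auto
  note sq' = quotient_square_swap [OF C(1,2) sq(1)] quotient_square_swap [OF C(2,3) sq(2)]
  have bad: "x \<otimes> y \<otimes> x = y \<and> y \<otimes> y = z \<otimes> z \<and> (x \<otimes> x = y \<otimes> y \<longleftrightarrow> y \<otimes> z \<otimes> y = z)"
    using ORR_of_short_path [OF gen T dist sq nc] no by blast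
  \<comment> \<open>Commuting elements with equal squares would give z y^{-1} a trivial
    square.\<close>
  have nc': "z \<otimes> y \<noteq> y \<otimes> z"
    using commuting_square_quotient_eq_one [OF C(2,3)] bad sq(2) by metis
  have bad': "z \<otimes> y \<otimes> z = y \<and> y \<otimes> y = x \<otimes> x \<and> (z \<otimes> z = y \<otimes> y \<longleftrightarrow> y \<otimes> x \<otimes> y = x)"
    using ORR_of_short_path [OF gen _ _ _ _ sq'(2,1) nc'] T dist no by blast
  have sqs: "x \<otimes> x = y \<otimes> y" "z \<otimes> z = x \<otimes> x" "x \<otimes> x = z \<otimes> z"
    and Q: "x \<otimes> y \<otimes> x = y" "y \<otimes> z \<otimes> y = z" "y \<otimes> x \<otimes> y = x"
    using bad bad' by auto
  have zy: "z \<otimes> y = inv y \<otimes> z" using inverts_iff(2) [OF C(2,3)] Q(2) by simp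
  have xy: "x \<otimes> y = y \<otimes> inv x" using inverts_iff(1) [OF C(1,2)] Q(1) by simp
  define b where "b = y \<otimes> inv x"
  have zb: "z \<otimes> b = inv y \<otimes> (z \<otimes> inv x)"
  proof -
    have "z \<otimes> b = z \<otimes> y \<otimes> inv x" using C by (simp add: b_def m_assoc)
    then show ?thesis using zy C by (simp add: m_assoc)
  qed
  consider "x \<otimes> z = z \<otimes> x" | "x \<otimes> z \<otimes> x = z" | "x \<otimes> z \<noteq> z \<otimes> x" "x \<otimes> z \<otimes> x \<noteq> z" by blast
  then show False
  proof cases
    case 1
    then have "z \<otimes> inv x = inv x \<otimes> z"
      using C by (metis inv_closed inv_mult_eq_iff m_assoc m_closed)
    then have "z \<otimes> b = inv (x \<otimes> y) \<otimes> z" using zb C by (simp add: inv_mult_group m_assoc)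
    then have "z \<otimes> b = inv b \<otimes> z" unfolding xy b_def .
    then show False
      using ORR_of_quaternion_triple [OF gen T dist(1) dist(3) [symmetric] dist(2) [symmetric]
          sq(1) Q(1) sqs(1,2), of x] 1 zy no by (auto simp: b_def)
  next
    case 2
    have xz: "z \<otimes> x = inv x \<otimes> z" "x \<otimes> z = z \<otimes> inv x"
      using inverts_iff [OF C(1,3)] 2 by simp_all
    \<comment> \<open>Conjugation by \<open>z\<close> turns \<open>b\<close> into y^{-1} x, which
      equals y x^{-1} because x^2 = y^2.\<close>
    have "inv y \<otimes> (y \<otimes> y) = inv y \<otimes> (x \<otimes> x)" using sqs(1) by simp
    then have "y = inv y \<otimes> x \<otimes> x" using C by (simp add: cancel_inv m_assoc)
    then have "b = inv y \<otimes> x"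
      unfolding b_def using C by (metis inv_closed inv_mult_eq_iff(2) m_closed)
    moreover have "z \<otimes> b = inv y \<otimes> x \<otimes> z" using zb C by (simp add: m_assoc flip: xz(2))
    ultimately have "z \<otimes> b = b \<otimes> z" by simp
    then show False
      using ORR_of_quaternion_triple [OF gen T dist(1) dist(3) [symmetric] dist(2) [symmetric]
          sq(1) Q(1) sqs(1,2), of b] xz(1) zy no by (auto simp: b_def)
  next
    case 3
    \<comment> \<open>Equal squares without commutation make x, z an admissible edge. The path y, x,
      z is not in the bad configuration, since x^2 = y^2 holds while z does not invert x.\<close>
    have zx: "(z \<otimes> inv x) \<otimes> (z \<otimes> inv x) \<noteq> \<one>"
      using square_quotient_eq_one_commutes [OF C(1,3) sqs(3)] 3 by blast
    have T': "T = {y, x, z}" using T by blast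
    have "admits_ORR G"
      by (rule ORR_of_short_path [OF gen T' dist(1) [symmetric] dist(3,2) sq'(1) zx nc [symmetric]])
        (use 3(2) sqs(1) in simp)
    then show False using no by blast
  qed
qed

end

section \<open>Commuting generators\<close>

context group
begin

lemma commutes_int_pow:
  assumes "x \<in> carrier G" "y \<in> carrier G" "x \<otimes> y = y \<otimes> x"
  shows "x [^] (k::int) \<otimes> y = y \<otimes> x [^] k"
proof -
  have n: "x [^] (n::nat) \<otimes> y = y \<otimes> x [^] n" for n
    using group_commutes_pow [of x y n] assms by simp
  have i: "inv (x [^] (n::nat)) \<otimes> y = y \<otimes> inv (x [^] n)" for n
  proof -
    have "inv (x [^] n) \<otimes> (x [^] n \<otimes> y) \<otimes> inv (x [^] n) = inv (x [^] n) \<otimes> (y \<otimes> x [^] n) \<otimes> inv (x [^] n)"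
      using n [of n] by (rule arg_cong)
    then show ?thesis using assms(1,2) by (simp add: cancel_inv m_assoc)
  qed
  show ?thesis
    using n [of "nat k"] i [of "nat (- k)"] by (cases "k < 0") (simp_all only: int_pow_def2 if_True if_False)
qed

lemma commutes_int_pows:
  assumes "x \<in> carrier G" "y \<in> carrier G" "x \<otimes> y = y \<otimes> x"
  shows "x [^] (k::int) \<otimes> y [^] (l::int) = y [^] l \<otimes> x [^] k"
  using commutes_int_pow [of y "x [^] k" l] commutes_int_pow [of x y k] assms by simp

lemma word_replicate:
  assumes "x \<in> carrier G"
  shows "word G (replicate (nat \<bar>k\<bar>) (x, 0 \<le> k)) = x [^] (k::int)"
proof -
  have 1: "word G (replicate n (x, True)) = x [^] n" for n
  proof (induction n)
    case (Suc n)
    then show ?case using assms group_commutes_pow [of x x n] by simp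
  qed simp
  have 2: "word G (replicate n (x, False)) = inv (x [^] n)" for n
    using assms by (induction n) (simp_all add: inv_mult_group)
  show ?thesis
  proof (cases "k < 0")
    case True
    then have "nat \<bar>k\<bar> = nat (- k)" "(0 \<le> k) = False" by simp_all
    then show ?thesis using True 2 by (simp only: int_pow_def2 if_True)
  next
    case False
    then have "nat \<bar>k\<bar> = nat k" "(0 \<le> k) = True" by simp_all
    then show ?thesis using False 1 by (simp only: int_pow_def2 if_False)
  qed
qed

end

locale commuting_triple = group +
  fixes x y z
  assumes xyz: "x \<in> carrier G" "y \<in> carrier G" "z \<in> carrier G"
    and commutes: "x \<otimes> y = y \<otimes> x" "x \<otimes> z = z \<otimes> x" "y \<otimes> z = z \<otimes> y"
begin

text \<open>A homomorphism from Z^3, because the three elements commute; equations between such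
  products become questions about the exponent vectors in its kernel.\<close>

definition P :: "int \<Rightarrow> int \<Rightarrow> int \<Rightarrow> 'a" where
  "P k l m = x [^] k \<otimes> (y [^] l \<otimes> z [^] m)"

lemma P_closed [simp]: "P k l m \<in> carrier G"
  using xyz by (simp add: P_def)

lemma P_basis: "P 1 0 0 = x" "P 0 1 0 = y" "P 0 0 1 = z" "P 0 0 0 = \<one>"
  using xyz by (simp_all add: P_def)

lemma P_mult: "P k l m \<otimes> P k' l' m' = P (k + k') (l + l') (m + m')"
proof -
  note c = commutes_int_pows [OF xyz(1,2) commutes(1)] commutes_int_pows [OF xyz(1,3) commutes(2)]
    commutes_int_pows [OF xyz(2,3) commutes(3)]
  have "P k l m \<otimes> P k' l' m' =
      x [^] k \<otimes> (y [^] l \<otimes> ((z [^] m \<otimes> x [^] k') \<otimes> (y [^] l' \<otimes> z [^] m')))"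
    using xyz by (simp add: P_def m_assoc)
  also have "\<dots> = x [^] k \<otimes> ((y [^] l \<otimes> x [^] k') \<otimes> ((z [^] m \<otimes> y [^] l') \<otimes> z [^] m'))"
    using xyz by (simp add: m_assoc flip: c(2))
  also have "\<dots> = (x [^] k \<otimes> x [^] k') \<otimes> ((y [^] l \<otimes> y [^] l') \<otimes> (z [^] m \<otimes> z [^] m'))"
    using xyz by (simp add: m_assoc flip: c(1,3))
  finally show ?thesis using xyz by (simp add: P_def int_pow_mult)
qed

lemma P_inv: "inv (P k l m) = P (- k) (- l) (- m)"
  by (rule inv_equality) (simp_all add: P_mult P_basis)

lemma P_eq_iff: "P k l m = P k' l' m' \<longleftrightarrow> P (k - k') (l - l') (m - m') = \<one>"
proof -
  have "P k l m = P k' l' m' \<longleftrightarrow> P k l m \<otimes> inv (P k' l' m') = \<one>"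
    by (metis P_closed inv_closed inv_solve_right l_one one_closed)
  then show ?thesis by (simp add: P_inv P_mult)
qed

lemma P_neg_eq_one: "P (- k) (- l) (- m) = \<one> \<longleftrightarrow> P k l m = \<one>"
  by (metis P_closed P_inv inv_eq_1_iff)

lemma P_add_relation:
  "P k l m = \<one> \<Longrightarrow> P (k + k') (l + l') (m + m') = P k' l' m'"
  using P_mult [of k l m k' l' m'] by simp

end

context avoiding
begin

definition expand :: "('a \<times> int) list \<Rightarrow> ('a \<times> bool) list" where
  "expand es = concat (map (\<lambda>(t, k). replicate (nat \<bar>k\<bar>) (t, 0 \<le> k)) es)"

lemma word_expand:
  "fst ` set es \<subseteq> carrier G \<Longrightarrow> word G (expand es) = foldr (\<lambda>(t, k) r. t [^] k \<otimes> r) es \<one>"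
proof (induction es)
  case (Cons e es)
  obtain t k where e: "e = (t, k)" by force
  have "fst ` set (expand es) \<subseteq> carrier G" "t \<in> carrier G"
    using Cons.prems e by (auto simp: expand_def)
  moreover have "expand (e # es) = replicate (nat \<bar>k\<bar>) (t, 0 \<le> k) @ expand es"
    by (simp add: expand_def e)
  ultimately have "word G (expand (e # es)) = t [^] k \<otimes> word G (expand es)"
    using word_append [of "replicate (nat \<bar>k\<bar>) (t, 0 \<le> k)" "expand es"]
    by (auto simp: word_replicate)
  then show ?case using Cons e by simp
qed (simp add: expand_def)

lemma count_expand:
  "distinct (map fst es) \<Longrightarrow> (t, k) \<in> set es \<Longrightarrow> count_list (map fst (expand es)) t = nat \<bar>k\<bar>"
proof (induction es)
  case (Cons e es)
  obtain s l where e: "e = (s, l)" by force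
  have r: "count_list (map fst (replicate n (s, b))) t = (if s = t then n else 0)" for n b
    by (induction n) auto
  have x: "expand (e # es) = replicate (nat \<bar>l\<bar>) (s, 0 \<le> l) @ expand es"
    by (simp add: expand_def e)
  have nil: "count_list (map fst (expand es)) u = 0" if "u \<notin> fst ` set es" for u
    using that by (force simp: expand_def count_list_0_iff)
  show ?case
  proof (cases "s = t")
    case True
    then have "t \<notin> fst ` set es" "k = l"
      using Cons.prems e by (auto simp: image_iff)
    then show ?thesis using x r nil True by simp
  next
    case False
    then show ?thesis using Cons e x r by simp
  qed
qed simp

text \<open>An exponent 1 or -1 would mean a single occurrence of its letter.\<close>

lemma relator_exponents:
  assumes "foldr (\<lambda>(t, k) r. t [^] k \<otimes> r) es \<one> = \<one>" "distinct (map fst es)" "fst ` set es \<subseteq> T"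
    and "length (expand es) \<le> 6" "(t, k) \<in> set es"
  shows "\<bar>k\<bar> \<noteq> 1"
proof
  assume k: "\<bar>k\<bar> = 1"
  have C: "fst ` set es \<subseteq> carrier G" using assms(3) letters by blast
  have w: "word G (expand es) = \<one>" using word_expand [OF C] assms(1) by simp
  have sub: "fst ` set (expand es) \<subseteq> T" using assms(3) by (auto simp: expand_def)
  have c: "count_list (map fst (expand es)) t = 1" using count_expand [OF assms(2,5)] k by simp
  then have "t \<in> fst ` set (expand es)"
    by (metis count_notin list.set_map zero_neq_one)
  then show False using relator_letter_twice [OF w assms(4) sub] c by fastforce
qed

end

text \<open>\<open>W\<close> is empty or holds the third generator, which may or may not commute
  with \<open>x\<close> and \<open>y\<close>. The exponent calculus is used with the identity as
  third element.\<close>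

locale commuting_pair = avoiding +
  fixes x y W
  assumes T_eq: "T = {x, y} \<union> W" and W: "W = {} \<or> (\<exists>w. W = {w})" "x \<notin> W" "y \<notin> W" "x \<noteq> y"
    and gen: "generate G T = carrier G"
    and commute: "x \<otimes> y = y \<otimes> x"
    and quotient: "(y \<otimes> inv x) \<otimes> (y \<otimes> inv x) \<noteq> \<one>"
begin

lemma pair_letters: "x \<in> T" "y \<in> T" "\<And>w. w \<in> W \<Longrightarrow> w \<in> T"
  using T_eq by auto

sublocale commuting_triple G x y \<one>
  by unfold_locales (use pair_letters commute in auto)

abbreviation Q where "Q k l \<equiv> P k l 0"

lemma Q_letter:
  assumes "\<bar>k\<bar> + \<bar>l\<bar> \<le> 6" "\<bar>k\<bar> = 1 \<or> \<bar>l\<bar> = 1" shows "Q k l \<noteq> \<one>"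
proof
  assume "Q k l = \<one>"
  then have "foldr (\<lambda>(t, k) r. t [^] k \<otimes> r) [(x, k), (y, l)] \<one> = \<one>" by (simp add: P_def)
  moreover have "distinct (map fst [(x, k), (y, l)])" "fst ` set [(x, k), (y, l)] \<subseteq> T"
    using pair_letters W(4) by simp_all
  moreover have "length (expand [(x, k), (y, l)]) \<le> 6" using assms(1) by (simp add: expand_def)
  ultimately show False
    using relator_exponents [of "[(x, k), (y, l)]" x k] relator_exponents [of "[(x, k), (y, l)]" y l]
      assms(2) by fastforce
qed

lemma relator_exponents_W:
  assumes w: "w \<in> W" and eq: "x [^] k \<otimes> (y [^] l \<otimes> w [^] n) = \<one>" and len: "\<bar>k\<bar> + \<bar>l\<bar> + \<bar>n\<bar> \<le> 6"
  shows "\<bar>k\<bar> \<noteq> 1" "\<bar>l\<bar> \<noteq> 1" "\<bar>n\<bar> \<noteq> (1::int)"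
proof -
  let ?es = "[(x, k), (y, l), (w, n)]"
  have 1: "foldr (\<lambda>(t, k) r. t [^] k \<otimes> r) ?es \<one> = \<one>" using eq pair_letters w by simp
  have 2: "distinct (map fst ?es)" using w W by auto
  have 3: "fst ` set ?es \<subseteq> T" using pair_letters w by simp
  have 4: "length (expand ?es) \<le> 6" using len by (simp add: expand_def)
  note r = relator_exponents [OF 1 2 3 4]
  show "\<bar>k\<bar> \<noteq> 1" "\<bar>l\<bar> \<noteq> 1" "\<bar>n\<bar> \<noteq> 1"
    using r [of x k] r [of y l] r [of w n] by simp_all
qed

text \<open>The equation would be a relation of length at most six containing \<open>w\<close>
  once.\<close>

lemma W_neq_Q:
  assumes "w \<in> W" "\<bar>k\<bar> + \<bar>l\<bar> \<le> 5" shows "w \<noteq> Q k l"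
proof
  assume w: "w = Q k l"
  have wC: "w \<in> carrier G" using pair_letters assms(1) by auto
  have "w [^] (-1::int) = inv w" using int_pow_neg [of w 1] wC by simp
  moreover have "Q k l \<otimes> inv w = \<one>" using w by (metis P_closed r_inv)
  ultimately have "Q k l \<otimes> w [^] (-1::int) = \<one>" by simp
  then have "x [^] k \<otimes> (y [^] l \<otimes> w [^] (-1::int)) = \<one>"
    using pair_letters(1,2) wC by (simp add: P_def m_assoc)
  from relator_exponents_W(3) [OF assms(1) this] show False using assms(2) by simp
qed

text \<open>Here the single occurrence is that of \<open>x\<close> or \<open>y\<close>.\<close>

lemma W_square_neq_Q:
  assumes "w \<in> W" "\<bar>k\<bar> + \<bar>l\<bar> \<le> 4" "\<bar>k\<bar> = 1 \<or> \<bar>l\<bar> = 1" shows "w \<otimes> w \<noteq> Q k l"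
proof
  assume w: "w \<otimes> w = Q k l"
  have wC: "w \<in> carrier G" using pair_letters assms(1) by auto
  have "w [^] (2::int) = w \<otimes> w"
    using int_pow_mult [of w 1 1] wC by simp
  then have "w [^] (-2::int) = inv (w \<otimes> w)"
    using int_pow_neg [of w 2] wC by simp
  moreover have "Q k l \<otimes> inv (w \<otimes> w) = \<one>" using w by (metis P_closed r_inv)
  ultimately have "Q k l \<otimes> w [^] (-2::int) = \<one>" by simp
  then have "x [^] k \<otimes> (y [^] l \<otimes> w [^] (-2::int)) = \<one>"
    using pair_letters(1,2) wC by (simp add: P_def m_assoc)
  from relator_exponents_W [OF assms(1) this] show False using assms(2,3) by simp
qed

lemma Q_squares: "Q 2 0 \<noteq> \<one>" "Q 0 2 \<noteq> \<one>" "Q (-2) 2 \<noteq> \<one>" "Q 2 (-2) \<noteq> \<one>"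
  "Q (-2) 0 \<noteq> \<one>" "Q 0 (-2) \<noteq> \<one>"
proof -
  have 1: "x \<otimes> x \<noteq> \<one>" "y \<otimes> y \<noteq> \<one>" using pair_letters square_neq_one by auto
  show a: "Q 2 0 \<noteq> \<one>" "Q 0 2 \<noteq> \<one>" "Q (-2) 2 \<noteq> \<one>"
    using 1 quotient P_mult [of 1 0 0 1 0 0] P_mult [of 0 1 0 0 1 0] P_mult [of 0 1 0 "-1" 0 0]
      P_inv [of 1 0 0] P_mult [of "-1" 1 0 "-1" 1 0] by (simp_all add: P_basis)
  show "Q 2 (-2) \<noteq> \<one>" "Q (-2) 0 \<noteq> \<one>" "Q 0 (-2) \<noteq> \<one>"
    using a P_neg_eq_one [of "-2" 2 0] P_neg_eq_one [of 2 0 0] P_neg_eq_one [of 0 2 0] by simp_all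
qed

text \<open>An arc between \<open>w\<close> and an element of exponents \<open>E\<close> gives
  either a short relation containing \<open>w\<close> once, or a trivial \<open>Q k l\<close>, or
  w^2 = \<open>Q k l\<close>; the last is what \<open>sq\<close> excludes.\<close>

lemma W_isolated:
  assumes E: "\<And>k l. (k, l) \<in> E \<Longrightarrow> \<bar>k\<bar> + \<bar>l\<bar> \<le> 2" and w: "w \<in> W"
    and S: "S = (\<lambda>(k, l). Q k l) ` E \<union> W"
    and sq: "\<And>k l. (k, l) \<in> E \<Longrightarrow> w \<otimes> w \<noteq> Q k l"
    and one: "\<And>k l. (k, l) \<in> E \<Longrightarrow> Q k l \<noteq> \<one>"
    and e: "(k, l) \<in> E"
  shows "w \<otimes> inv (Q k l) \<notin> S" "Q k l \<otimes> inv w \<notin> S" "w \<otimes> inv w \<notin> S"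
    "w \<otimes> Q k l \<noteq> \<one>" "Q k l \<otimes> w \<noteq> \<one>"
proof -
  have wT: "w \<in> T" and wC: "w \<in> carrier G" using pair_letters w by auto
  have Ww: "W = {w}" using W w by blast
  have neq: "w \<noteq> Q (k' + k'') (l' + l'')" "w \<noteq> Q (k' - k'') (l' - l'')"
    if "(k', l') \<in> E" "(k'', l'') \<in> E" for k' l' k'' l''
    using W_neq_Q [OF w] E [OF that(1)] E [OF that(2)] by auto
  have eq: "u \<otimes> inv v = s \<longleftrightarrow> u = s \<otimes> v"
    if "u \<in> carrier G" "v \<in> carrier G" "s \<in> carrier G" for u v s
    using inv_mult_eq_iff(2) [OF that(3,2,1)] by auto
  show "w \<otimes> inv (Q k l) \<notin> S"
  proof
    assume "w \<otimes> inv (Q k l) \<in> S"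
    then consider k' l' where "(k', l') \<in> E" "w \<otimes> inv (Q k l) = Q k' l'" | "w \<otimes> inv (Q k l) = w"
      using S Ww by auto
    then show False
    proof cases
      case 1
      then have "w = Q (k' + k) (l' + l)" using eq wC by (simp add: P_mult)
      then show False using neq(1) 1(1) e by blast
    next
      case 2
      then have "inv w \<otimes> (w \<otimes> inv (Q k l)) = inv w \<otimes> w" by simp
      then have "inv (Q k l) = \<one>" using wC by (simp add: cancel_inv)
      then show False using one [OF e] by simp
    qed
  qed
  show "Q k l \<otimes> inv w \<notin> S"
  proof
    assume "Q k l \<otimes> inv w \<in> S"
    then consider k' l' where "(k', l') \<in> E" "Q k l \<otimes> inv w = Q k' l'" | "Q k l \<otimes> inv w = w"
      using S Ww by auto
    then show False
    proof cases
      case 1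
      then have "Q k' l' \<otimes> w = Q k l" using eq wC by simp
      then have "w = inv (Q k' l') \<otimes> Q k l" using inv_mult_eq_iff(1) wC by simp
      then have "w = Q (k - k') (l - l')" by (simp add: P_mult P_inv)
      then show False using neq(2) 1(1) e by blast
    next
      case 2
      then show False using eq wC sq [OF e] by simp
    qed
  qed
  show "w \<otimes> inv w \<notin> S"
    using one letter_neq_one [OF wT] wC S Ww by (auto simp: eq_commute [of \<one>])
  show "w \<otimes> Q k l \<noteq> \<one>" "Q k l \<otimes> w \<noteq> \<one>"
  proof -
    have *: "w \<noteq> inv (Q k l)" using W_neq_Q [OF w, of "-k" "-l"] E [OF e] by (simp add: P_inv)
    then show "w \<otimes> Q k l \<noteq> \<one>" using inv_equality [of w "Q k l"] wC by auto
    then show "Q k l \<otimes> w \<noteq> \<one>" using inv_comm [of "Q k l" w] wC by auto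
  qed
qed

end

text \<open>The bound two on the exponents keeps a relation between three elements of the connection
  set within six letters, so most candidate arcs are excluded by avoidance alone.\<close>

locale commuting_pair_exponents = commuting_pair +
  fixes E :: "(int \<times> int) set"
  assumes basis: "(1, 0) \<in> E" "(0, 1) \<in> E"
    and short: "(k, l) \<in> E \<Longrightarrow> \<bar>k\<bar> + \<bar>l\<bar> \<le> 2"
    and square_W: "w \<in> W \<Longrightarrow> (k, l) \<in> E \<Longrightarrow> w \<otimes> w \<noteq> Q k l"
    and neq_one: "(k, l) \<in> E \<Longrightarrow> Q k l \<noteq> \<one>"
    and antisym: "(k, l) \<in> E \<Longrightarrow> (k', l') \<in> E \<Longrightarrow> Q (k + k') (l + l') \<noteq> \<one>"
begin

definition S where "S = (\<lambda>(k, l). Q k l) ` E \<union> W"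

lemma Q_in_S: "(k, l) \<in> E \<Longrightarrow> Q k l \<in> S"
  unfolding S_def by force

lemma S_cases:
  assumes "u \<in> S"
  obtains k l where "(k, l) \<in> E" "u = Q k l" | "u \<in> W"
  using assms unfolding S_def by auto

lemma S_closed: "S \<subseteq> carrier G"
  using pair_letters letters by (auto simp: S_def)

lemma isolated:
  assumes "w \<in> W" "(k, l) \<in> E"
  shows "w \<otimes> inv (Q k l) \<notin> S" "Q k l \<otimes> inv w \<notin> S" "w \<otimes> inv w \<notin> S"
    "w \<otimes> Q k l \<noteq> \<one>" "Q k l \<otimes> w \<noteq> \<one>"
  using W_isolated [OF short assms(1) S_def square_W [OF assms(1)] neq_one assms(2)] by blast+

lemma W_unique: "w \<in> W \<Longrightarrow> w' \<in> W \<Longrightarrow> w = w'"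
  using W(1) by auto

lemma S_antisym:
  assumes "s \<in> S" "t \<in> S" shows "s \<otimes> t \<noteq> \<one>"
  using assms(1)
proof (cases rule: S_cases)
  case (1 k l)
  note s = 1
  from assms(2) show ?thesis
  proof (cases rule: S_cases)
    case (1 k' l')
    then show ?thesis using s antisym by (simp add: P_mult)
  next
    case 2
    then show ?thesis using s isolated by blast
  qed
next
  case 2
  note s = 2
  from assms(2) show ?thesis
  proof (cases rule: S_cases)
    case (1 k' l')
    then show ?thesis using s isolated by blast
  next
    case 2
    then show ?thesis using s W_unique [OF 2 s] square_neq_one pair_letters by blast
  qed
qed

lemma arcE:
  assumes "u \<in> S" "v \<in> S" "v \<otimes> inv u \<in> S"
  obtains k l k' l' k'' l'' where "(k, l) \<in> E" "(k', l') \<in> E" "(k'', l'') \<in> E"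
    "u = Q k l" "v = Q k' l'" "Q (k' - k - k'') (l' - l - l'') = \<one>"
proof -
  have "u \<notin> W"
  proof
    assume u: "u \<in> W"
    from assms(2) show False
    proof (cases rule: S_cases)
      case (1 k l)
      then show ?thesis using isolated(2) [OF u] assms(3) by simp
    next
      case 2
      then show ?thesis using isolated(3) [OF u basis(1)] W_unique [OF 2 u] assms(3) by simp
    qed
  qed
  moreover have "v \<notin> W"
  proof
    assume v: "v \<in> W"
    from assms(1) show False
    proof (cases rule: S_cases)
      case (1 k l)
      then show ?thesis using isolated(1) [OF v] assms(3) by simp
    next
      case 2
      then show ?thesis using \<open>u \<notin> W\<close> by blast
    qed
  qed
  ultimately obtain k l k' l' where e: "(k, l) \<in> E" "(k', l') \<in> E" "u = Q k l" "v = Q k' l'"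
    using assms(1,2) by (metis S_cases)
  then have eq: "v \<otimes> inv u = Q (k' - k) (l' - l)" by (simp add: P_inv P_mult)
  have "Q (k' - k) (l' - l) \<notin> W"
  proof -
    have "\<bar>k' - k\<bar> + \<bar>l' - l\<bar> \<le> 5" using short [OF e(1)] short [OF e(2)] by linarith
    then show ?thesis using W_neq_Q by blast
  qed
  then obtain k'' l'' where "(k'', l'') \<in> E" "Q (k' - k) (l' - l) = Q k'' l''"
    using assms(3) eq by (metis S_cases)
  then show ?thesis using that [OF e(1,2) _ e(3,4), of k'' l''] P_eq_iff by simp
qed

lemma arcI:
  assumes "(k, l) \<in> E" "(k', l') \<in> E"
  shows "Q (k + k') (l + l') \<otimes> inv (Q k l) \<in> S"
  using Q_in_S [OF assms(2)] by (simp add: P_inv P_mult)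

text \<open>Once all \<open>Q k l\<close> are fixed, injectivity sends the element of
  \<open>W\<close> to itself.\<close>

lemma admits_ORR_if_exponents_fixed:
  assumes "\<And>\<psi> k l. \<psi> \<in> cayley_stabilizer G S \<Longrightarrow> (k, l) \<in> E \<Longrightarrow> \<psi> (Q k l) = Q k l"
  shows "admits_ORR G"
proof -
  have "\<psi> t = t" if \<psi>: "\<psi> \<in> cayley_stabilizer G S" and t: "t \<in> T" for \<psi> t
  proof (cases "t \<in> W")
    case True
    then have tS: "t \<in> S" by (simp add: S_def)
    have "\<psi> t \<in> S" using stab_S(1) [OF \<psi> S_closed tS] .
    then show ?thesis
    proof (cases rule: S_cases)
      case (1 k l)
      then have "\<psi> t = \<psi> (Q k l)" using assms [OF \<psi> 1(1)] by simp
      then have "t = Q k l" using stab_S(2) [OF \<psi> S_closed tS Q_in_S [OF 1(1)]] by simp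
      then show ?thesis using W_neq_Q [OF True, of k l] short [OF 1(1)] by simp
    next
      case 2
      then show ?thesis using W_unique True by blast
    qed
  next
    case False
    then have "t = x \<or> t = y" using t T_eq by blast
    then show ?thesis
      using assms [OF \<psi> basis(1)] assms [OF \<psi> basis(2)] by (auto simp: P_basis)
  qed
  then have "T \<subseteq> cayley_fixed G S"
    by (auto simp: cayley_fixed_def)
  then show ?thesis using admits_ORR_if_fixed [OF S_closed S_antisym _ gen] by blast
qed

end

text \<open>Besides x, y, c, the set \<open>A\<close> can contain the transitive triangle b, x, y.
  Its middle vertex x has only one in-neighbour, whereas the middle vertex y' of the image has the
  two in-neighbours x' and b'.\<close>

lemma transitive_triangle_rigid:
  assumes "distinct [x, y, b, c]" "distinct [x', y', b', c']"
    and "A \<subseteq> {(x, c), (y, c), (x, y), (b, y), (b, x)}"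
    and "(x', c') \<in> A" "(y', c') \<in> A" "(x', y') \<in> A" "(b', y') \<in> A"
  shows "x' = x \<and> y' = y \<and> b' = b \<and> c' = c"
proof -
  have A: "(u, v) \<in> A \<Longrightarrow> u = x \<and> v = c \<or> u = y \<and> v = c \<or> u = x \<and> v = y \<or> u = b \<and> v = y \<or> u = b \<and> v = x" for u v
    using assms(3) by blast
  show ?thesis
    using A [OF assms(4)] A [OF assms(5)] A [OF assms(6)] A [OF assms(7)] assms(1,2) by auto
qed

section \<open>Representations from a commuting pair of generators\<close>

context commuting_pair
begin

text \<open>Adjoining xy breaks the exchange of x with y x^{-1}: the arcs between x, y and xy form a
  transitive triangle, and y x^{-1} has an arc to its middle vertex y. If x^3 were trivial, x and xy
  would have arcs to y x^{-1}.\<close>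

lemma ORR_of_sum:
  assumes "(x \<otimes> y) \<otimes> (x \<otimes> y) \<noteq> \<one>" "x \<otimes> x \<otimes> x \<noteq> \<one>"
  shows "admits_ORR G"
proof -
  define E :: "(int \<times> int) set" where "E = {(1, 0), (0, 1), (-1, 1), (1, 1)}"
  have "Q 2 2 \<noteq> \<one>" "Q 3 0 \<noteq> \<one>"
    using assms P_mult [of 1 0 0 0 1 0] P_mult [of 1 1 0 1 1 0] P_mult [of 1 0 0 1 0 0]
      P_mult [of 2 0 0 1 0 0] by (simp_all add: P_basis)
  then have nz: "Q 2 2 \<noteq> \<one>" "Q (-2) (-2) \<noteq> \<one>" "Q 3 0 \<noteq> \<one>" "Q (-3) 0 \<noteq> \<one>"
    using P_neg_eq_one [of 2 2 0] P_neg_eq_one [of 3 0 0] by simp_all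
  interpret commuting_pair_exponents G T x y W E
  proof unfold_locales
    show "w \<otimes> w \<noteq> Q k l" if "w \<in> W" "(k, l) \<in> E" for w k l
      using W_square_neq_Q [OF that(1), of k l] that(2) by (auto simp: E_def)
    show "Q (k + k') (l + l') \<noteq> \<one>" if "(k, l) \<in> E" "(k', l') \<in> E" for k l k' l'
      using that nz Q_squares Q_letter unfolding E_def by auto
  qed (use Q_letter in \<open>auto simp: E_def\<close>)
  \<comment> \<open>An arc from e to e' with quotient e'' is a vector e' - e - e'' in the kernel.
    The last pair of the table is only a possible arc, present when x^3 = y^2.\<close>
  have tab: "\<forall>e\<in>E. \<forall>e'\<in>E. \<forall>e''\<in>E.
      Q (fst e' - fst e - fst e'') (snd e' - snd e - snd e'') = \<one> \<longrightarrow> (e, e') \<in> {((1, 0), (1, 1)), ((0, 1), (1, 1)), ((1, 0), (0, 1)),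
        ((-1, 1), (0, 1)), ((-1, 1), (1, 0))}"
    unfolding E_def by (simp add: nz Q_squares Q_letter)
  define A where "A = {(u, v). u \<in> S \<and> v \<in> S \<and> v \<otimes> inv u \<in> S}"
  have A: "A \<subseteq> {(Q 1 0, Q 1 1), (Q 0 1, Q 1 1), (Q 1 0, Q 0 1), (Q (-1) 1, Q 0 1), (Q (-1) 1, Q 1 0)}"
  proof
    fix p assume "p \<in> A"
    then obtain u v where p: "p = (u, v)" and uv: "u \<in> S" "v \<in> S" "v \<otimes> inv u \<in> S"
      unfolding A_def by blast
    from uv show "p \<in> {(Q 1 0, Q 1 1), (Q 0 1, Q 1 1), (Q 1 0, Q 0 1), (Q (-1) 1, Q 0 1), (Q (-1) 1, Q 1 0)}"
    proof (cases rule: arcE)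
      case (1 k l k' l' k'' l'')
      have "((k, l), (k', l')) \<in> {((1, 0), (1, 1)), ((0, 1), (1, 1)), ((1, 0), (0, 1)),
          ((-1, 1), (0, 1)), ((-1, 1), (1, 0))}"
        using tab [THEN bspec, OF 1(1), THEN bspec, OF 1(2), THEN bspec, OF 1(3)] 1(6) by simp
      then show ?thesis using 1(4,5) p by auto
    qed
  qed
  have ar: "(Q 1 0, Q 1 1) \<in> A" "(Q 0 1, Q 1 1) \<in> A" "(Q 1 0, Q 0 1) \<in> A" "(Q (-1) 1, Q 0 1) \<in> A"
    using arcI [of 1 0 0 1] arcI [of 0 1 1 0] arcI [of 1 0 "-1" 1] arcI [of "-1" 1 1 0] Q_in_S
    by (simp_all add: A_def E_def)
  have dist: "distinct [Q 1 0, Q 0 1, Q (-1) 1, Q 1 1]"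
    using Q_letter Q_squares by (simp add: P_eq_iff)
  show ?thesis
  proof (rule admits_ORR_if_exponents_fixed)
    fix \<psi> k l assume \<psi>: "\<psi> \<in> cayley_stabilizer G S" and kl: "(k, l) \<in> E"
    note st = stab_S [OF \<psi> S_closed]
    have im: "(\<psi> u, \<psi> v) \<in> A" if "(u, v) \<in> A" for u v
      using that st(1,3) unfolding A_def by blast
    have inS: "Q 1 0 \<in> S" "Q 0 1 \<in> S" "Q (-1) 1 \<in> S" "Q 1 1 \<in> S"
      using Q_in_S by (simp_all add: E_def)
    have "distinct [\<psi> (Q 1 0), \<psi> (Q 0 1), \<psi> (Q (-1) 1), \<psi> (Q 1 1)]"
      using dist st(2) inS by simp
    from transitive_triangle_rigid [OF dist this A im [OF ar(1)] im [OF ar(2)] im [OF ar(3)] im [OF ar(4)]]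
    show "\<psi> (Q k l) = Q k l" using kl by (auto simp: E_def)
  qed
qed

text \<open>Since y^2 = x^{-2}, avoidance reaches small powers of x: x^3 = x y^{-2} and x^5 = x
  y^{-4} contain x once, and x^4 = x^2 y^{-2} is the square of a quotient.\<close>

lemma involution_exponents:
  assumes inv: "(x \<otimes> y) \<otimes> (x \<otimes> y) = \<one>"
  shows "Q k 2 = Q (k - 2) 0" "Q k (-2) = Q (k + 2) 0"
    and "\<And>n. 1 \<le> n \<Longrightarrow> n \<le> 5 \<Longrightarrow> Q n 0 \<noteq> \<one> \<and> Q (-n) 0 \<noteq> \<one>"
proof -
  have 22: "Q 2 2 = \<one>"
    using inv P_mult [of 1 0 0 0 1 0] P_mult [of 1 1 0 1 1 0] by (simp add: P_basis)
  show red: "Q k 2 = Q (k - 2) 0" "Q k (-2) = Q (k + 2) 0" for k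
    using P_add_relation [OF 22, of "k - 2" 0 0] P_add_relation [OF 22, of k "-2" 0] by (simp_all add: add.commute)
  have 44: "Q 4 4 = \<one>" using P_add_relation [OF 22, of 2 2 0] 22 by simp
  have n: "Q n 0 \<noteq> \<one>" if n15: "1 \<le> n" "n \<le> 5" for n
  proof -
    consider "n = 1" | "n = 2" | "n = 3" | "n = 4" | "n = 5" using n15 by linarith
    then show ?thesis
    proof cases
      case 1
      then show ?thesis using Q_letter by simp
    next
      case 2
      then show ?thesis using Q_squares by simp
    next
      case 3
      have "Q 1 (-2) = Q 3 0" using red(2) [of 1] by simp
      then show ?thesis using 3 Q_letter [of 1 "-2"] by simp
    next
      case 4
      have "Q 2 (-2) = Q 4 0" using red(2) [of 2] by simp
      then show ?thesis using 4 Q_squares by simp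
    next
      case 5
      have "Q 5 0 = Q 1 (-4)" using P_add_relation [OF 44, of 1 "-4" 0] by simp
      then show ?thesis using 5 Q_letter [of 1 "-4"] by simp
    qed
  qed
  then show "\<And>n. 1 \<le> n \<Longrightarrow> n \<le> 5 \<Longrightarrow> Q n 0 \<noteq> \<one> \<and> Q (-n) 0 \<noteq> \<one>"
    using P_neg_eq_one [of _ 0 0] by simp
qed

text \<open>The product xy has trivial square and cannot be adjoined; x^2 takes its place. The only
  arc then leads from x to x^2, and y is the remaining vertex.\<close>

lemma ORR_of_involution_pair:
  assumes inv: "(x \<otimes> y) \<otimes> (x \<otimes> y) = \<one>" and W0: "W = {}"
  shows "admits_ORR G"
proof -
  define E :: "(int \<times> int) set" where "E = {(1, 0), (0, 1), (2, 0)}"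
  note red = involution_exponents(1,2) [OF inv]
  note nz' = involution_exponents(3) [OF inv]
  have nz: "Q 3 0 \<noteq> \<one>" "Q (-3) 0 \<noteq> \<one>" "Q 4 0 \<noteq> \<one>" "Q (-4) 0 \<noteq> \<one>" "Q 5 0 \<noteq> \<one>" "Q (-5) 0 \<noteq> \<one>"
    using nz' [of 3] nz' [of 4] nz' [of 5] by simp_all
  interpret commuting_pair_exponents G T x y W E
  proof unfold_locales
    show "Q (k + k') (l + l') \<noteq> \<one>" if "(k, l) \<in> E" "(k', l') \<in> E" for k l k' l'
      using that nz Q_squares Q_letter unfolding E_def by auto
  qed (use Q_letter Q_squares W0 in \<open>auto simp: E_def\<close>)
  have tab: "\<forall>e\<in>E. \<forall>e'\<in>E. \<forall>e''\<in>E.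
      Q (fst e' - fst e - fst e'') (snd e' - snd e - snd e'') = \<one> \<longrightarrow> (e, e') = ((1, 0), (2, 0))"
    unfolding E_def by (simp add: red nz Q_squares Q_letter)
  have A: "u = Q 1 0 \<and> v = Q 2 0" if "u \<in> S" "v \<in> S" "v \<otimes> inv u \<in> S" for u v
    using that
  proof (cases rule: arcE)
    case (1 k l k' l' k'' l'')
    have "((k, l), (k', l')) = ((1, 0), (2, 0))"
      using tab [THEN bspec, OF 1(1), THEN bspec, OF 1(2), THEN bspec, OF 1(3)] 1(6) by simp
    then show ?thesis using 1(4,5) by simp
  qed
  have S_eq: "S = {Q 1 0, Q 0 1, Q 2 0}" unfolding S_def by (simp add: E_def W0)
  have dist: "distinct [Q 1 0, Q 0 1, Q 2 0]"
    using Q_letter Q_squares by (simp add: P_eq_iff)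
  show ?thesis
  proof (rule admits_ORR_if_exponents_fixed)
    fix \<psi> k l assume \<psi>: "\<psi> \<in> cayley_stabilizer G S" and kl: "(k, l) \<in> E"
    note st = stab_S [OF \<psi> S_closed]
    have inS: "Q 1 0 \<in> S" "Q 0 1 \<in> S" "Q 2 0 \<in> S"
      using Q_in_S by (simp_all add: E_def)
    have "\<psi> (Q 2 0) \<otimes> inv (\<psi> (Q 1 0)) \<in> S"
      using st(3) [OF inS(1,3)] arcI [of 1 0 1 0] by (simp add: E_def)
    then have 1: "\<psi> (Q 1 0) = Q 1 0" "\<psi> (Q 2 0) = Q 2 0"
      using A [OF st(1) [OF inS(1)] st(1) [OF inS(3)]] by blast+
    have "\<psi> (Q 0 1) \<in> {Q 1 0, Q 0 1, Q 2 0}" using st(1) [OF inS(2)] unfolding S_eq .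
    moreover have "\<psi> (Q 0 1) \<noteq> \<psi> (Q 1 0)" "\<psi> (Q 0 1) \<noteq> \<psi> (Q 2 0)"
      using st(2) [OF inS(2,1)] st(2) [OF inS(2,3)] dist by auto
    ultimately have "\<psi> (Q 0 1) = Q 0 1" using 1 by auto
    then show "\<psi> (Q k l) = Q k l" using kl 1 by (auto simp: E_def)
  qed
qed

text \<open>With x, y, x^2 alone, both y and the third generator would be isolated, so y x^{-1} is
  adjoined. The arcs from x to x^2, from x to y and from y x^{-1} to y form a zigzag that cannot be
  reversed, one end being a sink and the other a source. The hypothesis on x^6 excludes (y x^{-1})^2
  = x^2.\<close>

lemma ORR_of_involution_triple:
  assumes inv: "(x \<otimes> y) \<otimes> (x \<otimes> y) = \<one>" and w: "\<And>w. w \<in> W \<Longrightarrow> w \<otimes> w \<noteq> x \<otimes> x"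
    and six: "x [^] (6::int) \<noteq> \<one>"
  shows "admits_ORR G"
proof -
  define E :: "(int \<times> int) set" where "E = {(1, 0), (0, 1), (2, 0), (-1, 1)}"
  note red = involution_exponents(1,2) [OF inv]
  note nz' = involution_exponents(3) [OF inv]
  have "Q 6 0 \<noteq> \<one>" using six xyz by (simp add: P_def)
  then have nz: "Q 3 0 \<noteq> \<one>" "Q (-3) 0 \<noteq> \<one>" "Q 4 0 \<noteq> \<one>" "Q (-4) 0 \<noteq> \<one>" "Q 5 0 \<noteq> \<one>" "Q (-5) 0 \<noteq> \<one>"
    "Q 6 0 \<noteq> \<one>" "Q (-6) 0 \<noteq> \<one>"
    using nz' [of 3] nz' [of 4] nz' [of 5] P_neg_eq_one [of 6 0 0] by simp_all
  interpret commuting_pair_exponents G T x y W E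
  proof unfold_locales
    have "Q 2 0 = x \<otimes> x" using P_mult [of 1 0 0 1 0 0] by (simp add: P_basis)
    then show "w \<otimes> w \<noteq> Q k l" if "w \<in> W" "(k, l) \<in> E" for w k l
      using W_square_neq_Q [OF that(1), of k l] that w by (auto simp: E_def)
    show "Q (k + k') (l + l') \<noteq> \<one>" if "(k, l) \<in> E" "(k', l') \<in> E" for k l k' l'
      using that nz Q_squares Q_letter unfolding E_def by (auto simp: red)
  qed (use Q_letter Q_squares in \<open>auto simp: E_def\<close>)
  have tab: "\<forall>e\<in>E. \<forall>e'\<in>E. \<forall>e''\<in>E.
      Q (fst e' - fst e - fst e'') (snd e' - snd e - snd e'') = \<one> \<longrightarrow> (e, e') \<in> {((1, 0), (2, 0)), ((1, 0), (0, 1)), ((-1, 1), (0, 1))}"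
    unfolding E_def by (simp add: red nz Q_squares Q_letter)
  have A: "u = Q 1 0 \<and> v = Q 2 0 \<or> u = Q 1 0 \<and> v = Q 0 1 \<or> u = Q (-1) 1 \<and> v = Q 0 1"
    if "u \<in> S" "v \<in> S" "v \<otimes> inv u \<in> S" for u v
    using that
  proof (cases rule: arcE)
    case (1 k l k' l' k'' l'')
    have "((k, l), (k', l')) \<in> {((1, 0), (2, 0)), ((1, 0), (0, 1)), ((-1, 1), (0, 1))}"
      using tab [THEN bspec, OF 1(1), THEN bspec, OF 1(2), THEN bspec, OF 1(3)] 1(6) by simp
    then show ?thesis using 1(4,5) by auto
  qed
  have dist: "distinct [Q 1 0, Q 0 1, Q 2 0, Q (-1) 1]"
    using Q_letter Q_squares by (simp add: P_eq_iff)
  show ?thesis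
  proof (rule admits_ORR_if_exponents_fixed)
    fix \<psi> k l assume \<psi>: "\<psi> \<in> cayley_stabilizer G S" and kl: "(k, l) \<in> E"
    note st = stab_S [OF \<psi> S_closed]
    have inS: "Q 1 0 \<in> S" "Q 0 1 \<in> S" "Q 2 0 \<in> S" "Q (-1) 1 \<in> S"
      using Q_in_S by (simp_all add: E_def)
    have ar: "\<psi> (Q 2 0) \<otimes> inv (\<psi> (Q 1 0)) \<in> S" "\<psi> (Q 0 1) \<otimes> inv (\<psi> (Q 1 0)) \<in> S"
      "\<psi> (Q 0 1) \<otimes> inv (\<psi> (Q (-1) 1)) \<in> S"
      using st(3) [OF inS(1,3)] st(3) [OF inS(1,2)] st(3) [OF inS(4,2)]
        arcI [of 1 0 1 0] arcI [of 1 0 "-1" 1] arcI [of "-1" 1 1 0] by (simp_all add: E_def)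
    have ne: "\<psi> (Q 0 1) \<noteq> \<psi> (Q 2 0)" "\<psi> (Q 1 0) \<noteq> \<psi> (Q (-1) 1)"
      using st(2) [OF inS(2,3)] st(2) [OF inS(1,4)] dist by auto
    note a = A [OF st(1) [OF inS(1)] st(1) [OF inS(3)] ar(1)]
      A [OF st(1) [OF inS(1)] st(1) [OF inS(2)] ar(2)] A [OF st(1) [OF inS(4)] st(1) [OF inS(2)] ar(3)]
    have "\<psi> (Q 1 0) = Q 1 0 \<and> \<psi> (Q 0 1) = Q 0 1 \<and> \<psi> (Q 2 0) = Q 2 0 \<and> \<psi> (Q (-1) 1) = Q (-1) 1"
      using a ne dist by auto
    then show "\<psi> (Q k l) = Q k l" using kl by (auto simp: E_def)
  qed
qed

end

section \<open>The three exceptional groups\<close>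

context group
begin

lemma is_iso_if_surjective_on_generators:
  assumes "group H" "h \<in> hom H G" "\<And>u. u \<in> carrier H \<Longrightarrow> h u = \<one> \<Longrightarrow> u = \<one>\<^bsub>H\<^esub>"
    and X: "X \<subseteq> h ` carrier H" "generate G X = carrier G"
  shows "G \<cong> H"
proof -
  interpret h: group_hom H G h
    using assms(1,2) is_group by (simp add: group_hom_def group_hom_axioms_def)
  have "carrier G \<subseteq> h ` carrier H"
    using generate_subgroup_incl [OF X(1) h.img_is_subgroup] X(2) by simp
  then have "h \<in> iso H G" using h.iso_iff assms(3) by blast
  then show ?thesis using group.iso_sym [OF assms(1)] unfolding is_iso_def by blast
qed

end

context commuting_triple
begin

lemma P_scale:
  assumes "P k l m = \<one>" shows "P (n * k) (n * l) (n * m) = \<one>"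
proof -
  have n: "P (int i * k) (int i * l) (int i * m) = \<one>" for i
  proof (induction i)
    case (Suc i)
    then show ?case
      using P_add_relation [OF assms, of "int i * k" "int i * l" "int i * m"]
      by (simp add: algebra_simps)
  qed (simp add: P_basis)
  show ?thesis
  proof (cases "0 \<le> n")
    case True
    then show ?thesis using n [of "nat n"] by simp
  next
    case False
    then show ?thesis using n [of "nat (- n)"] P_neg_eq_one [of "n * k" "n * l" "n * m"] by simp
  qed
qed

end

lemma group_C3_C2_C2_C2:
  "group (integer_mod_group 3 \<times>\<times> (integer_mod_group 2 \<times>\<times> integer_mod_group 2 \<times>\<times> integer_mod_group 2))"
  by (intro DirProd_group group_integer_mod_group)

lemma group_C3_C3: "group (integer_mod_group 3 \<times>\<times> integer_mod_group 3)"
  by (intro DirProd_group group_integer_mod_group)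

lemma mod_2_eq: "(q::int) mod 2 = 2 * (- (q div 2)) + q" and mod_3_eq: "q mod 3 = 3 * (- (q div 3)) + q"
  by presburger+

context avoiding
begin

lemma relator_exponents_triple:
  assumes "x \<in> T" "y \<in> T" "z \<in> T" "distinct [x, y, z]"
    and eq: "x [^] k \<otimes> (y [^] l \<otimes> z [^] m) = \<one>" and len: "\<bar>k\<bar> + \<bar>l\<bar> + \<bar>m\<bar> \<le> 6"
  shows "\<bar>k\<bar> \<noteq> 1" "\<bar>l\<bar> \<noteq> 1" "\<bar>m\<bar> \<noteq> (1::int)"
proof -
  let ?es = "[(x, k), (y, l), (z, m)]"
  have 1: "foldr (\<lambda>(t, k) r. t [^] k \<otimes> r) ?es \<one> = \<one>" using eq assms by simp
  have 2: "distinct (map fst ?es)" using assms by simp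
  have 3: "fst ` set ?es \<subseteq> T" using assms by simp
  have 4: "length (expand ?es) \<le> 6" using len by (simp add: expand_def)
  note r = relator_exponents [OF 1 2 3 4]
  show "\<bar>k\<bar> \<noteq> 1" "\<bar>l\<bar> \<noteq> 1" "\<bar>m\<bar> \<noteq> 1"
    using r [of x k] r [of y l] r [of z m] by simp_all
qed

text \<open>For injectivity, the exponent of y is reduced modulo six; a kernel element becomes a
  relation of length at most six with x and z occurring at most once, so only a power of y is
  left.\<close>

lemma is_iso_C3_C2_C2_C2:
  assumes gen: "generate G T = carrier G" and T: "T = {x, y, z}" "distinct [x, y, z]"
    and c: "x \<otimes> y = y \<otimes> x" "x \<otimes> z = z \<otimes> x" "y \<otimes> z = z \<otimes> y"
    and rel: "(x \<otimes> y) \<otimes> (x \<otimes> y) = \<one>" "(y \<otimes> z) \<otimes> (y \<otimes> z) = \<one>" "y [^] (6::int) = \<one>"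
    and nz: "\<And>n::int. 1 \<le> n \<Longrightarrow> n \<le> 5 \<Longrightarrow> y [^] n \<noteq> \<one>"
  shows "G \<cong> integer_mod_group 3 \<times>\<times> (integer_mod_group 2 \<times>\<times> integer_mod_group 2 \<times>\<times> integer_mod_group 2)"
proof -
  interpret commuting_triple G x y z
    by unfold_locales (use T c in auto)
  let ?H = "integer_mod_group 3 \<times>\<times> (integer_mod_group 2 \<times>\<times> integer_mod_group 2 \<times>\<times> integer_mod_group 2)"
  have r1: "P 2 2 0 = \<one>" and r2: "P 0 2 2 = \<one>"
    using rel(1,2) P_mult [of 1 0 0 0 1 0] P_mult [of 1 1 0 1 1 0] P_mult [of 0 1 0 0 0 1]
      P_mult [of 0 1 1 0 1 1] by (simp_all add: P_basis)
  have y: "P 0 n 0 = y [^] n" for n using xyz by (simp add: P_def)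
  have r3: "P 0 6 0 = \<one>" using rel(3) y by simp
  have lattice: "P (2 * i) (6 * j + 2 * i + 2 * n) (2 * n) = \<one>" for i j n
    using P_add_relation [OF P_scale [OF r1, of i], of 0 "6 * j + 2 * n" "2 * n"]
      P_add_relation [OF P_scale [OF r2, of n], of 0 "6 * j" 0] P_scale [OF r3, of j]
    by (simp add: algebra_simps)
  \<comment> \<open>This is (y^2)^k (y^3)^p (xy)^q (yz)^r: the powers of y give C_3 and one C_2, the
    elements xy and yz of trivial square the other two.\<close>
  define h where "h = (\<lambda>(k, p, q, r). P q (2 * k + 3 * p + q + r) r)"
  show ?thesis
  proof (rule is_iso_if_surjective_on_generators [OF group_C3_C2_C2_C2, of h])
    show "h \<in> hom ?H G"
    proof (rule homI)
      fix u v assume "u \<in> carrier ?H" "v \<in> carrier ?H"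
      obtain k p q r where u: "u = (k, p, q, r)" by (metis prod_cases4)
      obtain k' p' q' r' where v: "v = (k', p', q', r')" by (metis prod_cases4)
      have *: "P ((q + q') mod 2) (2 * ((k + k') mod 3) + 3 * ((p + p') mod 2) + (q + q') mod 2 + (r + r') mod 2)
          ((r + r') mod 2) = P (q + q') (2 * (k + k') + 3 * (p + p') + (q + q') + (r + r')) (r + r')"
        unfolding mod_2_eq mod_3_eq
        using P_add_relation [OF lattice [of "- ((q + q') div 2)" "- ((k + k') div 3) - ((p + p') div 2)" "- ((r + r') div 2)"],
            of "q + q'" "2 * (k + k') + 3 * (p + p') + (q + q') + (r + r')" "r + r'"]
        by (simp add: algebra_simps)
      show "h (u \<otimes>\<^bsub>?H\<^esub> v) = h u \<otimes> h v"
        using * by (simp add: u v h_def P_mult algebra_simps)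
    qed (auto simp: h_def)
    fix u assume u: "u \<in> carrier ?H" "h u = \<one>"
    obtain k p q r where kpqr: "u = (k, p, q, r)" by (metis prod_cases4)
    have rng: "k \<in> {0, 1, 2}" "p \<in> {0, 1}" "q \<in> {0, 1}" "r \<in> {0, 1}"
      using u(1) kpqr by (auto simp: carrier_integer_mod_group)
    define n where "n = 2 * k + 3 * p + q + r"
    \<comment> \<open>The value of \<open>n\<close> is at most 9, so subtracting 6 from 4 on leaves
      an exponent between -2 and 3.\<close>
    define n' where "n' = (if 4 \<le> n then n - 6 else n)"
    have 1: "P q n r = \<one>" using u(2) kpqr by (simp add: h_def n_def)
    then have 2: "P q n' r = \<one>"
      using P_add_relation [OF r3, of q "n - 6" r] by (auto simp: n'_def)
    have len: "\<bar>q\<bar> + \<bar>n'\<bar> + \<bar>r\<bar> \<le> 6" using rng by (auto simp: n'_def n_def)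
    have "\<bar>q\<bar> \<noteq> 1" "\<bar>r\<bar> \<noteq> 1"
      using relator_exponents_triple(1,3) [OF _ _ _ T(2) _ len] 2 T by (auto simp: P_def)
    then have qr: "q = 0" "r = 0" using rng by auto
    have "k = 0 \<and> p = 0"
    proof (rule ccontr)
      assume "\<not> (k = 0 \<and> p = 0)"
      then have "n \<in> {2, 4, 3, 5, 7}" using rng qr by (auto simp: n_def)
      moreover have "P 0 7 0 = P 0 1 0" using P_add_relation [OF r3, of 0 1 0] by simp
      ultimately show False
        using 1 qr y nz [of 1] nz [of 2] nz [of 3] nz [of 4] nz [of 5] by auto
    qed
    then show "u = \<one>\<^bsub>?H\<^esub>" using qr kpqr by simp
  next
    \<comment> \<open>Indeed y^7 = y, and y^5 (xy) = x and y^5 (yz) = z, because y^6 = 1.\<close>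
    have "h (2, 1, 0, 0) = y" "h (1, 1, 1, 0) = x" "h (1, 1, 0, 1) = z"
      using P_add_relation [OF r3, of 0 1 0] P_add_relation [OF r3, of 1 0 0] P_add_relation [OF r3, of 0 0 1]
      by (simp_all add: h_def P_basis)
    moreover have "(2, 1, 0, 0) \<in> carrier ?H" "(1, 1, 1, 0) \<in> carrier ?H" "(1, 1, 0, 1) \<in> carrier ?H"
      by (auto simp: carrier_integer_mod_group)
    ultimately show "T \<subseteq> h ` carrier ?H" unfolding T(1) by (metis empty_subsetI image_eqI insert_subset)
  qed (rule gen)
qed

lemma is_iso_C3_C3:
  assumes gen: "generate G T = carrier G" and T: "T = {x, y}" "x \<noteq> y"
    and c: "x \<otimes> y = y \<otimes> x"
    and rel: "x [^] (3::int) = \<one>" "y [^] (3::int) = \<one>"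
  shows "G \<cong> integer_mod_group 3 \<times>\<times> integer_mod_group 3"
proof -
  interpret commuting_triple G x y \<one>
    by unfold_locales (use T c in auto)
  let ?H = "integer_mod_group 3 \<times>\<times> integer_mod_group 3"
  have r1: "P 3 0 0 = \<one>" and r2: "P 0 3 0 = \<one>"
    using rel xyz by (simp_all add: P_def)
  have lattice: "P (3 * i) (3 * j) 0 = \<one>" for i j
    using P_add_relation [OF P_scale [OF r1, of i], of 0 "3 * j" 0] P_scale [OF r2, of j]
    by (simp add: algebra_simps)
  define h where "h = (\<lambda>(k, l). P k l 0)"
  show ?thesis
  proof (rule is_iso_if_surjective_on_generators [OF group_C3_C3, of h])
    show "h \<in> hom ?H G"
    proof (rule homI)
      fix u v assume "u \<in> carrier ?H" "v \<in> carrier ?H"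
      obtain k l where u: "u = (k, l)" by force
      obtain k' l' where v: "v = (k', l')" by force
      have *: "P ((k + k') mod 3) ((l + l') mod 3) 0 = P (k + k') (l + l') 0"
        unfolding mod_3_eq
        using P_add_relation [OF lattice [of "- ((k + k') div 3)" "- ((l + l') div 3)"], of "k + k'" "l + l'" 0]
        by simp
      show "h (u \<otimes>\<^bsub>?H\<^esub> v) = h u \<otimes> h v"
        using * by (simp add: u v h_def P_mult)
    qed (auto simp: h_def)
    fix u assume u: "u \<in> carrier ?H" "h u = \<one>"
    obtain k l where kl: "u = (k, l)" by force
    have rng: "k \<in> {0, 1, 2}" "l \<in> {0, 1, 2}"
      using u(1) kl by (auto simp: carrier_integer_mod_group)
    \<comment> \<open>Taking the residue 2 as -1 makes every nonzero exponent a single occurrence of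
      its letter.\<close>
    define k' where "k' = (if k = 2 then -1 else k)"
    define l' where "l' = (if l = 2 then -1 else l)"
    have "P k l 0 = \<one>" using u(2) kl by (simp add: h_def)
    then have 2: "P k' l' 0 = \<one>"
      using P_add_relation [OF r1, of "-1" l 0] P_add_relation [OF r2, of k' "-1" 0]
      by (auto simp: k'_def l'_def)
    have "foldr (\<lambda>(t, k) r. t [^] k \<otimes> r) [(x, k'), (y, l')] \<one> = \<one>"
      using 2 by (simp add: P_def)
    moreover have "distinct (map fst [(x, k'), (y, l')])" "fst ` set [(x, k'), (y, l')] \<subseteq> T"
      using T by simp_all
    moreover have "length (expand [(x, k'), (y, l')]) \<le> 6"
      using rng by (auto simp: expand_def k'_def l'_def)
    ultimately have "\<bar>k'\<bar> \<noteq> 1" "\<bar>l'\<bar> \<noteq> 1"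
      using relator_exponents [of "[(x, k'), (y, l')]" x k']
        relator_exponents [of "[(x, k'), (y, l')]" y l'] by simp_all
    then show "u = \<one>\<^bsub>?H\<^esub>" using rng kl by (auto simp: k'_def l'_def)
  next
    have "h (1, 0) = x" "h (0, 1) = y"
      by (simp_all add: h_def P_basis)
    moreover have "(1, 0) \<in> carrier ?H" "(0, 1) \<in> carrier ?H"
      by (auto simp: carrier_integer_mod_group)
    ultimately show "T \<subseteq> h ` carrier ?H" unfolding T(1) by (metis empty_subsetI image_eqI insert_subset)
  qed (rule gen)
qed

end

lemma hamilton_mult_assoc: "hamilton_mult (hamilton_mult u v) w = hamilton_mult u (hamilton_mult v w)"
  by (cases u; cases v; cases w) (simp add: algebra_simps)

lemma carrier_quaternion_group:
  "carrier quaternion_group = {(1,0,0,0), (-1,0,0,0), (0,1,0,0), (0,-1,0,0),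
                 (0,0,1,0), (0,0,-1,0), (0,0,0,1), (0,0,0,-1)}"
  by (simp add: quaternion_group_def)

lemma group_quaternion_group: "group quaternion_group"
proof (rule groupI)
  show "u \<otimes>\<^bsub>quaternion_group\<^esub> v \<in> carrier quaternion_group"
    if "u \<in> carrier quaternion_group" "v \<in> carrier quaternion_group" for u v
    using that by (auto simp: quaternion_group_def)
  show "\<exists>v\<in>carrier quaternion_group. v \<otimes>\<^bsub>quaternion_group\<^esub> u = \<one>\<^bsub>quaternion_group\<^esub>"
    if "u \<in> carrier quaternion_group" for u
    using that by (auto simp: quaternion_group_def)
qed (auto simp: quaternion_group_def hamilton_mult_assoc)

context avoiding
begin

text \<open>z = x^2 = y^2 takes the part of -1: it commutes with x and y, and applying xyx = y twice
  gives z y z = y, hence z^2 = 1. With k = xy for the third unit, moving every z to the front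
  reproduces the quaternion table.\<close>

lemma is_iso_quaternion_group:
  assumes gen: "generate G T = carrier G" and T: "T = {x, y}" "x \<noteq> y"
    and q: "x \<otimes> y \<otimes> x = y" "x \<otimes> x = y \<otimes> y"
  shows "G \<cong> quaternion_group"
proof -
  define z where "z = x \<otimes> x"
  define k where "k = x \<otimes> y"
  have xyT: "x \<in> T" "y \<in> T" using T by auto
  have C: "x \<in> carrier G" "y \<in> carrier G" "z \<in> carrier G" "k \<in> carrier G"
    using xyT by (auto simp: z_def k_def)
  have xz: "x \<otimes> z = z \<otimes> x" using C by (simp add: z_def m_assoc)
  have zyy: "z = y \<otimes> y" using q by (simp add: z_def)
  have yz: "y \<otimes> z = z \<otimes> y" using C by (simp add: zyy m_assoc)
  have kz: "k \<otimes> z = z \<otimes> k"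
  proof -
    have "k \<otimes> z = x \<otimes> (y \<otimes> z)" using C by (simp add: k_def m_assoc)
    also have "\<dots> = (x \<otimes> z) \<otimes> y" unfolding yz using C by (simp add: m_assoc)
    also have "\<dots> = z \<otimes> k" unfolding xz using C by (simp add: k_def m_assoc)
    finally show ?thesis .
  qed
  have kx: "k \<otimes> x = y" using q by (simp add: k_def)
  have zz: "z \<otimes> z = \<one>"
  proof -
    have "x \<otimes> (y \<otimes> x) = y" using q(1) C by (simp add: m_assoc)
    then have "x \<otimes> (x \<otimes> (y \<otimes> x) \<otimes> x) = y" using q(1) by simp
    then have "z \<otimes> (y \<otimes> z) = y" using C by (simp add: z_def m_assoc)
    then have "y \<otimes> (z \<otimes> z) = y" using C yz by (metis m_assoc)
    then have "inv y \<otimes> (y \<otimes> (z \<otimes> z)) = inv y \<otimes> y" by simp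
    then show ?thesis using C by (simp add: cancel_inv)
  qed
  have xk: "x \<otimes> k = z \<otimes> y" using C by (simp add: k_def z_def m_assoc)
  have ky: "k \<otimes> y = z \<otimes> x"
  proof -
    have "k \<otimes> y = x \<otimes> (y \<otimes> y)" using C by (simp add: k_def m_assoc)
    then show ?thesis using xz zyy by simp
  qed
  have kk: "k \<otimes> k = z"
  proof -
    have "k \<otimes> k = k \<otimes> x \<otimes> y" using C by (simp add: k_def m_assoc)
    then show ?thesis using kx zyy by simp
  qed
  have yk: "y \<otimes> k = x"
  proof -
    have "x \<otimes> (y \<otimes> k) = k \<otimes> k" using C by (simp add: k_def m_assoc)
    also have "\<dots> = x \<otimes> x" using kk z_def by simp
    finally show ?thesis using C by simp
  qed
  have yx: "y \<otimes> x = z \<otimes> k"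
  proof -
    have "x \<otimes> (y \<otimes> x) = y" using q(1) C by (simp add: m_assoc)
    moreover have "x \<otimes> (z \<otimes> k) = y"
    proof -
      have "x \<otimes> (z \<otimes> k) = (x \<otimes> z) \<otimes> k" using C by (simp add: m_assoc)
      also have "\<dots> = z \<otimes> (x \<otimes> k)" unfolding xz using C by (simp add: m_assoc)
      also have "\<dots> = (z \<otimes> z) \<otimes> y" unfolding xk using C by (simp add: m_assoc)
      finally show ?thesis using zz C by simp
    qed
    ultimately have "x \<otimes> (y \<otimes> x) = x \<otimes> (z \<otimes> k)" by simp
    then show ?thesis using C by simp
  qed
  have zzl: "z \<otimes> (z \<otimes> w) = w" if "w \<in> carrier G" for w
    using zz C that by (simp flip: m_assoc)
  have lc: "x \<otimes> (z \<otimes> w) = z \<otimes> (x \<otimes> w)" "y \<otimes> (z \<otimes> w) = z \<otimes> (y \<otimes> w)" "k \<otimes> (z \<otimes> w) = z \<otimes> (k \<otimes> w)"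
    if "w \<in> carrier G" for w
    using xz yz kz C that by (simp_all flip: m_assoc)
  note rules = xz yz kz kx zz xk ky kk yk yx zzl lc z_def [symmetric] zyy [symmetric] k_def [symmetric] C
  define h where "h u =
     (if u = (1,0,0,0) then \<one> else if u = (-1,0,0,0) then z else
      if u = (0,1,0,0) then x else if u = (0,-1,0,0) then z \<otimes> x else
      if u = (0,0,1,0) then y else if u = (0,0,-1,0) then z \<otimes> y else
      if u = (0,0,0,1) then k else z \<otimes> k)" for u :: "int \<times> int \<times> int \<times> int"
  have h: "h (1,0,0,0) = \<one>" "h (-1,0,0,0) = z" "h (0,1,0,0) = x" "h (0,-1,0,0) = z \<otimes> x"
    "h (0,0,1,0) = y" "h (0,0,-1,0) = z \<otimes> y" "h (0,0,0,1) = k" "h (0,0,0,-1) = z \<otimes> k"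
    by (simp_all add: h_def)
  show ?thesis
  proof (rule is_iso_if_surjective_on_generators [OF group_quaternion_group, of h])
    have hC: "h u \<in> carrier G" for u using C by (simp add: h_def)
    have "\<forall>u\<in>carrier quaternion_group. \<forall>v\<in>carrier quaternion_group.
        h (u \<otimes>\<^bsub>quaternion_group\<^esub> v) = h u \<otimes> h v"
      unfolding carrier_quaternion_group using C
      by (simp add: quaternion_group_def h m_assoc rules)
    then show "h \<in> hom quaternion_group G" using hC by (auto simp: hom_def)
    have zn: "z \<noteq> \<one>" using square_neq_one [OF xyT(1)] by (simp add: z_def)
    have eqz: "w = z" if "z \<otimes> w = \<one>" "w \<in> carrier G" for w
      using zzl [OF that(2)] that C by simp
    have "x \<noteq> \<one>" "y \<noteq> \<one>" using letter_neq_one xyT by auto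
    moreover have "k \<noteq> \<one>"
    proof
      assume "k = \<one>"
      then have "word G [(x, True), (y, True)] = \<one>" using C by (simp add: k_def)
      then show False using relator2 [of x True y True] T xyT by auto
    qed
    moreover have idem: "w = \<one>" if "w = w \<otimes> w" "w \<in> carrier G" for w
    proof -
      have "inv w \<otimes> w = inv w \<otimes> (w \<otimes> w)" using that(1) by simp
      then show ?thesis using that(2) by (simp add: cancel_inv)
    qed
    have "x \<noteq> z" "y \<noteq> z"
      using idem [of x] idem [of y] letter_neq_one xyT C zyy z_def by auto
    moreover have "k \<noteq> z"
    proof
      assume "k = z"
      then have "x \<otimes> y = x \<otimes> x" by (simp add: k_def z_def)
      then show False using C T by simp
    qed
    ultimately have "\<forall>u\<in>carrier quaternion_group. h u = \<one> \<longrightarrow> u = (1,0,0,0)"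
      unfolding carrier_quaternion_group using zn eqz C by (auto simp: h)
    moreover have one: "\<one>\<^bsub>quaternion_group\<^esub> = (1,0,0,0)" by (simp add: quaternion_group_def)
    ultimately show "u = \<one>\<^bsub>quaternion_group\<^esub>" if "u \<in> carrier quaternion_group" "h u = \<one>" for u
      using that unfolding one by blast
    have "(0,1,0,0) \<in> carrier quaternion_group" "(0,0,1,0) \<in> carrier quaternion_group"
      by (simp_all add: carrier_quaternion_group)
    then show "T \<subseteq> h ` carrier quaternion_group"
      unfolding T(1) using h(3,5) by (metis empty_subsetI image_eqI insert_subset)
  qed (rule gen)
qed

end

section \<open>At most three generators\<close>

text \<open>Directed walks with three arcs inside the six permitted arcs run through y, z, c and
  start at x or b; of these two, only x may have an arc to c.\<close>

lemma six_vertex_rigid: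
  assumes "distinct [x, y, z, b, b', c]"
    and A: "A \<subseteq> {(x, y), (b, y), (y, z), (b', z), (x, c), (z, c)}"
    and "(x1, y1) \<in> A" "(y1, z1) \<in> A" "(x1, c1) \<in> A" "(z1, c1) \<in> A"
  shows "x1 = x \<and> y1 = y \<and> z1 = z"
proof -
  have A: "(u, v) \<in> A \<Longrightarrow> u = x \<and> v = y \<or> u = b \<and> v = y \<or> u = y \<and> v = z \<or> u = b' \<and> v = z
      \<or> u = x \<and> v = c \<or> u = z \<and> v = c" for u v
    using A by blast
  show ?thesis
    using A [OF assms(3)] A [OF assms(4)] A [OF assms(5)] A [OF assms(6)] assms(1) by auto
qed

context avoiding
begin

text \<open>G is a vector space over the field of three elements with basis x, y, z. The set of the
  path x, y, z is preserved by the linear map that exchanges x with y x^{-1} and fixes y and z; the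
  additional element xz, reached from both x and z, removes this symmetry.\<close>

lemma ORR_of_three_cubes:
  assumes gen: "generate G T = carrier G" and T: "T = {x, y, z}" "distinct [x, y, z]"
    and c: "x \<otimes> y = y \<otimes> x" "x \<otimes> z = z \<otimes> x" "y \<otimes> z = z \<otimes> y"
    and cube: "x \<otimes> x \<otimes> x = \<one>" "y \<otimes> y \<otimes> y = \<one>" "z \<otimes> z \<otimes> z = \<one>"
  shows "admits_ORR G"
proof -
  interpret commuting_triple G x y z
    by unfold_locales (use T c in auto)
  have r: "P 3 0 0 = \<one>" "P 0 3 0 = \<one>" "P 0 0 3 = \<one>"
    using cube P_mult [of 1 0 0 1 0 0] P_mult [of 2 0 0 1 0 0] P_mult [of 0 1 0 0 1 0]
      P_mult [of 0 2 0 0 1 0] P_mult [of 0 0 1 0 0 1] P_mult [of 0 0 2 0 0 1]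
    by (simp_all add: P_basis)
  have lattice: "P (3 * i) (3 * j) (3 * n) = \<one>" for i j n
    using P_add_relation [OF P_scale [OF r(1), of i], of 0 "3 * j" "3 * n"]
      P_add_relation [OF P_scale [OF r(2), of j], of 0 0 "3 * n"] P_scale [OF r(3), of n]
    by (simp add: algebra_simps)
  have one_iff: "P k l m = \<one> \<longleftrightarrow> 3 dvd k \<and> 3 dvd l \<and> 3 dvd m" for k l m
  proof
    assume eq: "P k l m = \<one>"
    \<comment> \<open>The residue modulo three among -1, 0, 1: a nonzero exponent then is a single
      occurrence in a word of length at most three.\<close>
    define b where "b n = (n + 1) mod 3 - 1" for n :: int
    have b: "n = 3 * ((n + 1) div 3) + b n" "b n = -1 \<or> b n = 0 \<or> b n = 1" for n
      unfolding b_def by presburger+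
    have "P k l m = P (3 * ((k + 1) div 3) + b k) (3 * ((l + 1) div 3) + b l) (3 * ((m + 1) div 3) + b m)"
      using b(1) by metis
    then have 1: "P (b k) (b l) (b m) = \<one>"
      using eq P_add_relation [OF lattice] by simp
    have len: "\<bar>b k\<bar> + \<bar>b l\<bar> + \<bar>b m\<bar> \<le> 6" using b(2) [of k] b(2) [of l] b(2) [of m] by auto
    have "\<bar>b k\<bar> \<noteq> 1" "\<bar>b l\<bar> \<noteq> 1" "\<bar>b m\<bar> \<noteq> 1"
      using relator_exponents_triple [OF _ _ _ T(2) _ len] 1 T(1) by (auto simp: P_def)
    then have "b k = 0" "b l = 0" "b m = 0" using b(2) [of k] b(2) [of l] b(2) [of m] by auto
    then show "3 dvd k \<and> 3 dvd l \<and> 3 dvd m" using b(1) by (metis add.right_neutral dvd_triv_left)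
  next
    assume "3 dvd k \<and> 3 dvd l \<and> 3 dvd m"
    then show "P k l m = \<one>" using lattice by (auto elim!: dvdE)
  qed
  define E :: "(int \<times> int \<times> int) set"
    where "E = {(1, 0, 0), (0, 1, 0), (0, 0, 1), (-1, 1, 0), (0, -1, 1), (1, 0, 1)}"
  define p where "p = (\<lambda>(k, l, m). P k l m)"
  define S where "S = p ` E"
  have S_closed: "S \<subseteq> carrier G" by (auto simp: S_def p_def)
  have anti: "s \<otimes> t \<noteq> \<one>" if "s \<in> S" "t \<in> S" for s t
  proof -
    obtain e e' where "e \<in> E" "e' \<in> E" "s = p e" "t = p e'" using \<open>s \<in> S\<close> \<open>t \<in> S\<close> S_def by blast
    moreover have "\<forall>e\<in>E. \<forall>e'\<in>E. p e \<otimes> p e' \<noteq> \<one>"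
      unfolding E_def by (simp add: p_def P_mult one_iff)
    ultimately show ?thesis by blast
  qed
  have tab: "\<forall>e\<in>E. \<forall>e'\<in>E. \<forall>e''\<in>E. p e' \<otimes> inv (p e) = p e'' \<longrightarrow>
    (p e, p e') \<in> {(P 1 0 0, P 0 1 0), (P (-1) 1 0, P 0 1 0), (P 0 1 0, P 0 0 1), (P 0 (-1) 1, P 0 0 1),
      (P 1 0 0, P 1 0 1), (P 0 0 1, P 1 0 1)}"
    unfolding E_def by (simp add: p_def P_mult P_inv P_eq_iff one_iff)
  define A where "A = {(u, v). u \<in> S \<and> v \<in> S \<and> v \<otimes> inv u \<in> S}"
  have A: "A \<subseteq> {(P 1 0 0, P 0 1 0), (P (-1) 1 0, P 0 1 0), (P 0 1 0, P 0 0 1), (P 0 (-1) 1, P 0 0 1),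
      (P 1 0 0, P 1 0 1), (P 0 0 1, P 1 0 1)}"
    unfolding A_def S_def using tab by blast
  have inS: "P 1 0 0 \<in> S" "P 0 1 0 \<in> S" "P 0 0 1 \<in> S" "P (-1) 1 0 \<in> S" "P 0 (-1) 1 \<in> S" "P 1 0 1 \<in> S"
    by (simp_all add: S_def E_def p_def)
  have ar: "(P 1 0 0, P 0 1 0) \<in> A" "(P 0 1 0, P 0 0 1) \<in> A" "(P 1 0 0, P 1 0 1) \<in> A" "(P 0 0 1, P 1 0 1) \<in> A"
    using inS by (simp_all add: A_def P_mult P_inv)
  have dist: "distinct [P 1 0 0, P 0 1 0, P 0 0 1, P (-1) 1 0, P 0 (-1) 1, P 1 0 1]"
    by (simp add: P_eq_iff one_iff)
  have "\<psi> x = x \<and> \<psi> y = y \<and> \<psi> z = z" if \<psi>: "\<psi> \<in> cayley_stabilizer G S" for \<psi>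
  proof -
    have im: "(\<psi> u, \<psi> v) \<in> A" if "(u, v) \<in> A" for u v
      using that stab_S(1,3) [OF \<psi> S_closed] unfolding A_def by blast
    show ?thesis
      using six_vertex_rigid [OF dist A im [OF ar(1)] im [OF ar(2)] im [OF ar(3)] im [OF ar(4)]]
      by (simp add: P_basis)
  qed
  then have "T \<subseteq> cayley_fixed G S" using xyz T(1) by (auto simp: cayley_fixed_def)
  then show ?thesis using admits_ORR_if_fixed [OF S_closed anti _ gen] by blast
qed

text \<open>T together with its inverses stays the same, and a product of five equal to x^{-1},
  inverted and read backwards, is one equal to x.\<close>

lemma avoiding_replace_inv:
  assumes x: "x \<in> T" shows "avoiding G (insert (inv x) (T - {x}))"
proof
  let ?T = "insert (inv x) (T - {x})"
  show "?T \<subseteq> carrier G" using x by auto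
  show "t \<otimes> t \<noteq> \<one>" if t: "t \<in> ?T" for t
  proof (cases "t = inv x")
    case True
    then have "t \<otimes> t = inv (x \<otimes> x)" using x by (simp add: inv_mult_group)
    then show ?thesis using square_neq_one [OF x] x by simp
  qed (use t square_neq_one in blast)
  let ?U = "T \<union> set_inv T \<union> {\<one>}"
  have U: "?T \<union> set_inv ?T \<union> {\<one>} = ?U"
  proof -
    have "inv (inv x) = x" using x by simp
    then show ?thesis using x unfolding SET_INV_def by auto
  qed
  have UC: "u \<in> carrier G" "inv u \<in> ?U" if "u \<in> ?U" for u
    using that unfolding SET_INV_def by auto
  have av: "u1 \<otimes> u2 \<otimes> u3 \<otimes> u4 \<otimes> u5 \<notin>
      T - {u1, inv u1, u2, inv u2, u3, inv u3, u4, inv u4, u5, inv u5}"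
    if "u1 \<in> ?U" "u2 \<in> ?U" "u3 \<in> ?U" "u4 \<in> ?U" "u5 \<in> ?U" for u1 u2 u3 u4 u5
    using five_avoiding that unfolding five_product_avoiding_def Let_def by blast
  have av': "u1 \<otimes> u2 \<otimes> u3 \<otimes> u4 \<otimes> u5 \<notin>
      ?T - {u1, inv u1, u2, inv u2, u3, inv u3, u4, inv u4, u5, inv u5}"
    if u: "u1 \<in> ?U" "u2 \<in> ?U" "u3 \<in> ?U" "u4 \<in> ?U" "u5 \<in> ?U" for u1 u2 u3 u4 u5
  proof
    define p where "p = u1 \<otimes> u2 \<otimes> u3 \<otimes> u4 \<otimes> u5"
    assume "u1 \<otimes> u2 \<otimes> u3 \<otimes> u4 \<otimes> u5 \<in>
      ?T - {u1, inv u1, u2, inv u2, u3, inv u3, u4, inv u4, u5, inv u5}"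
    then have p: "p \<in> ?T" "p \<notin> {u1, inv u1, u2, inv u2, u3, inv u3, u4, inv u4, u5, inv u5}"
      by (auto simp: p_def)
    have "p \<notin> T" using av [OF u] p(2) by (simp add: p_def)
    then have px: "p = inv x" using p(1) by blast
    note C = UC(1) [OF u(1)] UC(1) [OF u(2)] UC(1) [OF u(3)] UC(1) [OF u(4)] UC(1) [OF u(5)]
    have "inv p = x" using px x by simp
    then have "x = inv u5 \<otimes> inv u4 \<otimes> inv u3 \<otimes> inv u2 \<otimes> inv u1"
      using C by (simp add: p_def inv_mult_group m_assoc)
    moreover have "x \<notin> {inv u5, inv (inv u5), inv u4, inv (inv u4), inv u3, inv (inv u3),
        inv u2, inv (inv u2), inv u1, inv (inv u1)}"
      using p(2) px C x by auto
    ultimately show False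
      using av [OF UC(2) [OF u(5)] UC(2) [OF u(4)] UC(2) [OF u(3)] UC(2) [OF u(2)] UC(2) [OF u(1)]] x
      by blast
  qed
  have "?T \<inter> set_inv ?T = {}"
  proof -
    have "inv s \<noteq> t" if "s \<in> ?T" "t \<in> ?T" for s t
    proof
      assume st: "inv s = t"
      consider "s \<in> T" "t \<in> T" | "s = inv x" "t = inv x" | "s = inv x" "t \<in> T - {x}" | "s \<in> T - {x}" "t = inv x"
        using \<open>s \<in> ?T\<close> \<open>t \<in> ?T\<close> by blast
      then show False
      proof cases
        case 1
        then show False using st inv_not_letter by blast
      next
        case 2
        then show False using st x by (metis inv_inv inv_not_letter letter_closed)
      next
        case 3
        then show False using st x by auto
      next
        case 4
        then show False using st x by (metis DiffD1 DiffD2 inv_inv letter_closed singletonI)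
      qed
    qed
    then have "t \<notin> set_inv ?T" if t: "t \<in> ?T" for t
    proof -
      have "t \<noteq> inv s" if "s \<in> ?T" for s
        using \<open>\<And>s t. s \<in> ?T \<Longrightarrow> t \<in> ?T \<Longrightarrow> inv s \<noteq> t\<close> [OF that t] by simp
      then show ?thesis unfolding SET_INV_def by blast
    qed
    then show ?thesis by blast
  qed
  then show "five_product_avoiding G ?T"
    unfolding five_product_avoiding_def Let_def U by (intro conjI ballI av')
qed

lemma generate_replace_inv:
  assumes "x \<in> T" "generate G T = carrier G"
  shows "generate G (insert (inv x) (T - {x})) = carrier G"
proof -
  let ?T = "insert (inv x) (T - {x})"
  have sub: "?T \<subseteq> carrier G" using assms(1) by auto
  have sg: "subgroup (generate G ?T) G" by (rule generate_is_subgroup [OF sub])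
  have "inv (inv x) \<in> generate G ?T"
    by (rule subgroup.m_inv_closed [OF sg]) (simp add: generate.incl)
  then have "x \<in> generate G ?T" using assms(1) by simp
  moreover have "t \<in> generate G ?T" if "t \<in> T" "t \<noteq> x" for t
    by (rule generate.incl) (use that in simp)
  ultimately have "T \<subseteq> generate G ?T" by blast
  then have "carrier G \<subseteq> generate G ?T"
    using generate_subgroup_incl [OF _ sg] assms(2) by blast
  then show ?thesis using generate_incl [OF sub] by blast
qed

lemma commuting_pairI:
  assumes "generate G T = carrier G" "T = {x, y, z}" "distinct [x, y, z]" "x \<otimes> y = y \<otimes> x"
    "(y \<otimes> inv x) \<otimes> (y \<otimes> inv x) \<noteq> \<one>"
  shows "commuting_pair G T x y {z}"
  by unfold_locales (use assms in auto)

text \<open>\<open>ORR_of_sum\<close> applies to the pair in both orders, so its failure leaves a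
  trivial square of xy, where \<open>involution_exponents\<close> controls the powers of y, or
  trivial cubes of both.\<close>

lemma no_ORR_commuting_triple:
  assumes gen: "generate G T = carrier G" and T: "T = {x, y, z}" "distinct [x, y, z]"
    and c: "x \<otimes> y = y \<otimes> x" and sq: "(y \<otimes> inv x) \<otimes> (y \<otimes> inv x) \<noteq> \<one>" and no: "\<not> admits_ORR G"
  shows "(x \<otimes> y) \<otimes> (x \<otimes> y) = \<one> \<and> (\<forall>n::int. 1 \<le> n \<and> n \<le> 5 \<longrightarrow> y [^] n \<noteq> \<one>)
    \<or> x \<otimes> x \<otimes> x = \<one> \<and> y \<otimes> y \<otimes> y = \<one>"
proof -
  have C: "x \<in> carrier G" "y \<in> carrier G" using T by auto
  interpret xy: commuting_pair G T x y "{z}"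
    by (rule commuting_pairI [OF gen T c sq])
  interpret yx: commuting_pair G T y x "{z}"
    by (rule commuting_pairI [OF gen _ _ c [symmetric] quotient_square_swap [OF C sq]]) (use T in auto)
  show ?thesis
  proof (cases "(x \<otimes> y) \<otimes> (x \<otimes> y) = \<one>")
    case True
    then have "(y \<otimes> x) \<otimes> (y \<otimes> x) = \<one>" using c by simp
    from yx.involution_exponents(3) [OF this] have "y [^] n \<noteq> \<one>" if "1 \<le> n" "n \<le> 5" for n :: int
      using that C by (auto simp: yx.P_def)
    then show ?thesis using True by blast
  next
    case False
    then have "(y \<otimes> x) \<otimes> (y \<otimes> x) \<noteq> \<one>" using c by simp
    then show ?thesis using xy.ORR_of_sum [OF False] yx.ORR_of_sum no by blast
  qed
qed

lemma cube_int_pow: "x \<in> carrier G \<Longrightarrow> x \<otimes> x \<otimes> x = x [^] (3::int)"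
  using int_pow_mult [of x 1 1] int_pow_mult [of x 2 1] by simp

text \<open>The middle generator y commutes with x and z, as a path starting at a noncommuting edge
  would work. Nontrivial small powers of y exclude y^3 = 1, so the pairs x, y and z, y fall into the
  same case. The quotient of x and z is not controlled by the hypotheses; their commutation has to
  be derived, or its failure exploited.\<close>

lemma ORR_of_three:
  assumes gen: "generate G T = carrier G" and T: "T = {x, y, z}" "distinct [x, y, z]"
    and sq: "(y \<otimes> inv x) \<otimes> (y \<otimes> inv x) \<noteq> \<one>" "(z \<otimes> inv y) \<otimes> (z \<otimes> inv y) \<noteq> \<one>"
    and no_iso: "\<not> G \<cong> integer_mod_group 3 \<times>\<times> (integer_mod_group 2 \<times>\<times> integer_mod_group 2 \<times>\<times> integer_mod_group 2)"
  shows "admits_ORR G"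
proof (rule ccontr)
  assume no: "\<not> admits_ORR G"
  have C: "x \<in> carrier G" "y \<in> carrier G" "z \<in> carrier G" and xT: "x \<in> T" "z \<in> T" using T by auto
  note sq' = quotient_square_swap [OF C(1,2) sq(1)] quotient_square_swap [OF C(2,3) sq(2)]
  have T': "T = {z, y, x}" "distinct [z, y, x]" using T by auto
  have cxy: "x \<otimes> y = y \<otimes> x"
    using ORR_of_three_noncommuting [OF gen T(1) _ _ _ sq] T(2) no by auto
  have cyz: "z \<otimes> y = y \<otimes> z"
    using ORR_of_three_noncommuting [OF gen T'(1) _ _ _ sq'(2,1)] T(2) no by auto
  \<comment> \<open>This is the path x, z, y, available once the quotient of x and z has nontrivial
    square.\<close>
  have xzy: "x \<otimes> z = z \<otimes> x" if "(z \<otimes> inv x) \<otimes> (z \<otimes> inv x) \<noteq> \<one>"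
    using ORR_of_three_noncommuting [OF gen, of x z y] that sq'(2) T no by auto
  define N where "N \<longleftrightarrow> (\<forall>n::int. 1 \<le> n \<and> n \<le> 5 \<longrightarrow> y [^] n \<noteq> \<one>)"
  have "\<not> (N \<and> y \<otimes> y \<otimes> y = \<one>)" 
  proof
    assume *: "N \<and> y \<otimes> y \<otimes> y = \<one>"
    then have "y [^] (3::int) \<noteq> \<one>" unfolding N_def by (elim conjE allE [of _ 3]) simp
    then show False using * cube_int_pow [OF C(2)] by simp
  qed
  then have "(x \<otimes> y) \<otimes> (x \<otimes> y) = \<one> \<and> (z \<otimes> y) \<otimes> (z \<otimes> y) = \<one> \<and> N
    \<or> x \<otimes> x \<otimes> x = \<one> \<and> y \<otimes> y \<otimes> y = \<one> \<and> z \<otimes> z \<otimes> z = \<one>"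
    using no_ORR_commuting_triple [OF gen T cxy sq(1) no, folded N_def]
      no_ORR_commuting_triple [OF gen T' cyz sq'(2) no, folded N_def] by argo
  then consider (inv) "(x \<otimes> y) \<otimes> (x \<otimes> y) = \<one>" "(z \<otimes> y) \<otimes> (z \<otimes> y) = \<one>" N
    | (cube) "x \<otimes> x \<otimes> x = \<one>" "y \<otimes> y \<otimes> y = \<one>" "z \<otimes> z \<otimes> z = \<one>" by blast
  then show False
  proof cases
    case inv
    have nz: "y [^] n \<noteq> \<one>" if "1 \<le> n" "n \<le> 5" for n :: int using inv(3) that by (simp add: N_def)
    have sqs: "x \<otimes> x = inv (y \<otimes> y)" "z \<otimes> z = inv (y \<otimes> y)"
    proof -
      have "(x \<otimes> x) \<otimes> (y \<otimes> y) = x \<otimes> (x \<otimes> y) \<otimes> y" using C by (simp add: m_assoc)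
      also have "\<dots> = x \<otimes> (y \<otimes> x) \<otimes> y" by (simp only: cxy)
      also have "\<dots> = (x \<otimes> y) \<otimes> (x \<otimes> y)" using C by (simp add: m_assoc)
      finally show "x \<otimes> x = inv (y \<otimes> y)" using inv(1) inv_equality [of "x \<otimes> x" "y \<otimes> y"] C by simp
      have "(z \<otimes> z) \<otimes> (y \<otimes> y) = z \<otimes> (z \<otimes> y) \<otimes> y" using C by (simp add: m_assoc)
      also have "\<dots> = z \<otimes> (y \<otimes> z) \<otimes> y" by (simp only: cyz)
      also have "\<dots> = (z \<otimes> y) \<otimes> (z \<otimes> y)" using C by (simp add: m_assoc)
      finally show "z \<otimes> z = inv (y \<otimes> y)" using inv(2) inv_equality [of "z \<otimes> z" "y \<otimes> y"] C by simp
    qed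
    \<comment> \<open>Now x^2 = z^2: a quotient with trivial square yields commutation directly, and
      any other quotient yields it through the path x, z, y.\<close>
    have cxz: "x \<otimes> z = z \<otimes> x"
      using xzy square_quotient_eq_one_commutes [OF C(1,3)] sqs by (metis (no_types))
    show False
    proof (cases "y [^] (6::int) = \<one>")
      case True
      have "(y \<otimes> z) \<otimes> (y \<otimes> z) = \<one>" using inv(2) cyz by simp
      then show False
        using is_iso_C3_C2_C2_C2 [OF gen T cxy cxz cyz [symmetric] inv(1) _ True nz] no_iso by blast
    next
      case False
      interpret yx: commuting_pair G T y x "{z}"
        by (rule commuting_pairI [OF gen _ _ cxy [symmetric] sq'(1)]) (use T in auto)
      have "z \<otimes> z \<noteq> y \<otimes> y"
      proof
        assume "z \<otimes> z = y \<otimes> y"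
        then have "(y \<otimes> y) \<otimes> (y \<otimes> y) = inv (y \<otimes> y) \<otimes> (y \<otimes> y)" using sqs by simp
        then have "y [^] (4::int) = \<one>"
          using C int_pow_mult [of y 1 1] int_pow_mult [of y 2 2] by simp
        then show False using nz [of 4] by simp
      qed
      moreover have "(y \<otimes> x) \<otimes> (y \<otimes> x) = \<one>" using inv(1) cxy by simp
      ultimately show False using yx.ORR_of_involution_triple False no by blast
    qed
  next
    case cube
    show False
    proof (cases "x \<otimes> z = z \<otimes> x")
      case True
      then show False using ORR_of_three_cubes [OF gen T cxy True cyz [symmetric] cube] no by blast
    next
      case False
      then have 1: "(z \<otimes> inv x) \<otimes> (z \<otimes> inv x) = \<one>" using xzy by blast
      have ix: "inv x = x \<otimes> x" using inv_equality [of "x \<otimes> x" x] cube(1) C by simp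
      \<comment> \<open>If both squares were trivial, then xzx = x^{-1} z x^{-1}; inserting x^{-1} =
        x^2 gives z = x^{-1} z x^{-1}, and then z^2 = 1.\<close>
      have 2: "(z \<otimes> x) \<otimes> (z \<otimes> x) \<noteq> \<one>"
      proof
        assume 2: "(z \<otimes> x) \<otimes> (z \<otimes> x) = \<one>"
        have "z \<otimes> (x \<otimes> z \<otimes> x) = z \<otimes> (inv x \<otimes> z \<otimes> inv x)" using 1 2 C by (simp add: m_assoc)
        then have 3: "x \<otimes> z \<otimes> x = inv x \<otimes> z \<otimes> inv x" using C by simp
        have "z = x \<otimes> (x \<otimes> z \<otimes> x) \<otimes> x" unfolding 3 using C by (simp add: m_assoc cancel_inv)
        also have "\<dots> = inv x \<otimes> z \<otimes> inv x" unfolding ix using C by (simp add: m_assoc)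
        finally have "z \<otimes> z = z \<otimes> (inv x \<otimes> z \<otimes> inv x)" by simp
        also have "\<dots> = \<one>" using 1 C by (simp add: m_assoc)
        finally show False using square_neq_one [OF xT(2)] by blast
      qed
      \<comment> \<open>Passing from x to x^{-1} replaces the quotient z x^{-1} by zx, so that
        x^{-1}, z, y becomes an admissible path with noncommuting first edge.\<close>
      define T2 where "T2 = insert (inv x) (T - {x})"
      interpret T2: avoiding G T2 unfolding T2_def by (rule avoiding_replace_inv [OF xT(1)])
      have gen2: "generate G T2 = carrier G"
        unfolding T2_def by (rule generate_replace_inv [OF xT(1) gen])
      have T2: "T2 = {inv x, z, y}" using T by (auto simp: T2_def)
      have ne: "inv x \<noteq> z" "z \<noteq> y" "inv x \<noteq> y"
        using inv_not_letter [OF xT(1)] T by auto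
      have nc: "inv x \<otimes> z \<noteq> z \<otimes> inv x"
      proof
        assume "inv x \<otimes> z = z \<otimes> inv x"
        then have "x \<otimes> (inv x \<otimes> z) \<otimes> x = x \<otimes> (z \<otimes> inv x) \<otimes> x" by simp
        then show False using False C by (simp add: m_assoc cancel_inv)
      qed
      show False
        using T2.ORR_of_three_noncommuting [OF gen2 T2 ne(1,2,3) _ sq'(2) nc] 2 C no by simp
    qed
  qed
qed

lemma ORR_of_two:
  assumes gen: "generate G T = carrier G" and T: "T = {x, y}" "x \<noteq> y"
    and sq: "(y \<otimes> inv x) \<otimes> (y \<otimes> inv x) \<noteq> \<one>"
    and no_iso: "\<not> G \<cong> quaternion_group" "\<not> G \<cong> integer_mod_group 3 \<times>\<times> integer_mod_group 3"
  shows "admits_ORR G"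
proof (cases "x \<otimes> y = y \<otimes> x")
  case False
  then show ?thesis
    using ORR_of_edge [OF gen T sq False] is_iso_quaternion_group [OF gen T] no_iso(1) by blast
next
  case True
  have C: "x \<in> carrier G" "y \<in> carrier G" using T by auto
  interpret xy: commuting_pair G T x y "{}"
    by unfold_locales (use T gen True sq in auto)
  interpret yx: commuting_pair G T y x "{}"
    by unfold_locales (use T gen True quotient_square_swap [OF C sq] in auto)
  show ?thesis
  proof (cases "(x \<otimes> y) \<otimes> (x \<otimes> y) = \<one>")
    case inv: True
    then show ?thesis using xy.ORR_of_involution_pair by blast
  next
    case False
    then have "(y \<otimes> x) \<otimes> (y \<otimes> x) \<noteq> \<one>" using True by simp
    moreover have "\<not> (x [^] (3::int) = \<one> \<and> y [^] (3::int) = \<one>)"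
      using is_iso_C3_C3 [OF gen T True] no_iso(2) by blast
    ultimately show ?thesis
      using xy.ORR_of_sum [OF False] yx.ORR_of_sum cube_int_pow C by metis
  qed
qed

text \<open>T itself serves as connection set: having at most one element, it is fixed pointwise by
  the stabilizer. The trivial group with T empty is included.\<close>

lemma ORR_of_at_most_one:
  assumes gen: "generate G T = carrier G" and T: "T \<subseteq> {x}"
  shows "admits_ORR G"
proof (rule admits_ORR_if_fixed [OF letters _ _ gen])
  show "s \<otimes> t \<noteq> \<one>" if "s \<in> T" "t \<in> T" for s t
    using that T square_neq_one by blast
  have "\<psi> t = t" if "t \<in> T" "\<psi> \<in> cayley_stabilizer G T" for t \<psi>
    using stab_S(1) [OF that(2) letters that(1)] that(1) T by blast
  then show "T \<subseteq> cayley_fixed G T"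
    by (auto simp: cayley_fixed_def)
qed

end

section \<open>The exceptional groups admit no oriented regular representation\<close>

definition subsets_have_symmetries :: "('a, 'b) monoid_scheme \<Rightarrow> bool" where
  "subsets_have_symmetries H \<longleftrightarrow>
     (\<forall>S\<subseteq>carrier H. (\<forall>s\<in>S. \<forall>t\<in>S. s \<otimes>\<^bsub>H\<^esub> t \<noteq> \<one>\<^bsub>H\<^esub>) \<longrightarrow>
       (\<exists>\<theta>\<in>iso H H. (\<forall>u\<in>carrier H. u \<in> S \<longleftrightarrow> \<theta> u \<in> S) \<and> (\<exists>u\<in>carrier H. \<theta> u \<noteq> u)))"

context group
begin

text \<open>A group automorphism preserving S is an automorphism of the Cayley digraph that fixes
  the identity, while the only right translation with this property is the identity map.\<close>

lemma no_ORR_if_subsets_have_symmetries: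
  assumes "subsets_have_symmetries G" shows "\<not> admits_ORR G"
proof
  assume "admits_ORR G"
  then obtain S where S: "S \<subseteq> carrier G" "S \<inter> set_inv S = {}"
    and aut: "digraph_automorphisms (Cay G S) = right_regular_representation G"
    unfolding admits_ORR_def by blast
  have "s \<otimes> t \<noteq> \<one>" if "s \<in> S" "t \<in> S" for s t
  proof
    assume "s \<otimes> t = \<one>"
    then have "inv t = s" using inv_equality [of s t] S(1) that by auto
    then have "s \<in> set_inv S" using that(2) unfolding SET_INV_def by blast
    then show False using S(2) that(1) by blast
  qed
  then have "\<exists>\<theta>\<in>iso G G. (\<forall>u\<in>carrier G. u \<in> S \<longleftrightarrow> \<theta> u \<in> S) \<and> (\<exists>u\<in>carrier G. \<theta> u \<noteq> u)"
    using assms S(1) unfolding subsets_have_symmetries_def by simp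
  then obtain \<theta> where \<theta>: "\<theta> \<in> iso G G" and inv: "\<And>u. u \<in> carrier G \<Longrightarrow> u \<in> S \<longleftrightarrow> \<theta> u \<in> S"
    and moved: "\<exists>u\<in>carrier G. \<theta> u \<noteq> u"
    by blast
  have hom: "\<theta> \<in> hom G G" and bij: "bij_betw \<theta> (carrier G) (carrier G)"
    using \<theta> by (auto simp: iso_def)
  interpret \<theta>: group_hom G G \<theta> by unfold_locales (rule hom)
  have "\<theta> v \<otimes> inv (\<theta> u) = \<theta> (v \<otimes> inv u)" if "u \<in> carrier G" "v \<in> carrier G" for u v
    using that by simp
  then have "(\<lambda>u\<in>carrier G. \<theta> u) \<in> digraph_automorphisms (Cay G S)"
    unfolding digraph_automorphisms_Cay_iff using bij inv by (simp add: bij_betw_restrict_eq)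
  then obtain g where g: "g \<in> carrier G" "(\<lambda>u\<in>carrier G. \<theta> u) = (\<lambda>u\<in>carrier G. u \<otimes> g)"
    unfolding aut right_regular_representation_def by blast
  have eq: "\<theta> u = u \<otimes> g" if "u \<in> carrier G" for u
    using fun_cong [OF g(2), of u] that by simp
  have "g = \<one>" using eq [OF one_closed] g(1) by simp
  then show False using moved eq by auto
qed

lemma subsets_have_symmetries_iso:
  assumes "group H" "G \<cong> H" "subsets_have_symmetries H"
  shows "subsets_have_symmetries G"
  unfolding subsets_have_symmetries_def
proof (intro allI impI)
  fix S assume S: "S \<subseteq> carrier G" "\<forall>s\<in>S. \<forall>t\<in>S. s \<otimes> t \<noteq> \<one>"
  obtain h where h: "h \<in> iso G H" using assms(2) unfolding is_iso_def by blast
  define h' where "h' = inv_into (carrier G) h"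
  have h': "h' \<in> iso H G" unfolding h'_def by (rule iso_set_sym [OF h])
  interpret h: group_hom G H h
    using h assms(1) is_group by (auto simp: group_hom_def group_hom_axioms_def iso_def)
  have bij: "bij_betw h (carrier G) (carrier H)" using h by (simp add: iso_def)
  have mem: "h u \<in> h ` S \<longleftrightarrow> u \<in> S" if "u \<in> carrier G" for u
    using that bij S(1) by (auto simp: bij_betw_def inj_on_def)
  have "h s \<otimes>\<^bsub>H\<^esub> h t \<noteq> \<one>\<^bsub>H\<^esub>" if "s \<in> S" "t \<in> S" for s t
  proof
    assume "h s \<otimes>\<^bsub>H\<^esub> h t = \<one>\<^bsub>H\<^esub>"
    moreover have st: "s \<in> carrier G" "t \<in> carrier G" using that S(1) by auto
    ultimately have "h (s \<otimes> t) = h \<one>" by simp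
    then have "s \<otimes> t = \<one>" using bij st inj_onD [of h "carrier G" "s \<otimes> t" \<one>] by (simp add: bij_betw_def)
    then show False using S(2) that by blast
  qed
  moreover have "h ` S \<subseteq> carrier H" using S(1) by auto
  ultimately have "\<exists>\<theta>\<in>iso H H. (\<forall>u\<in>carrier H. u \<in> h ` S \<longleftrightarrow> \<theta> u \<in> h ` S) \<and> (\<exists>u\<in>carrier H. \<theta> u \<noteq> u)"
    using assms(3) unfolding subsets_have_symmetries_def by simp
  then obtain \<theta> where \<theta>: "\<theta> \<in> iso H H" "\<forall>u\<in>carrier H. u \<in> h ` S \<longleftrightarrow> \<theta> u \<in> h ` S"
    "\<exists>u\<in>carrier H. \<theta> u \<noteq> u"
    by blast
  have \<theta>C: "\<theta> u \<in> carrier H" if "u \<in> carrier H" for u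
    using \<theta>(1) that by (auto simp: iso_def bij_betw_def)
  have h'C: "h' u \<in> carrier G" "h (h' u) = u" if "u \<in> carrier H" for u
    using that bij by (auto simp: h'_def bij_betw_def inv_into_into f_inv_into_f)
  have "h' \<circ> (\<theta> \<circ> h) \<in> iso G G"
    using iso_set_trans [OF iso_set_trans [OF h \<theta>(1)] h'] by (simp add: comp_assoc compose_def comp_def)
  moreover have "u \<in> S \<longleftrightarrow> (h' \<circ> (\<theta> \<circ> h)) u \<in> S" if u: "u \<in> carrier G" for u
  proof -
    have "u \<in> S \<longleftrightarrow> \<theta> (h u) \<in> h ` S" using mem [OF u] \<theta>(2) u by auto
    also have "\<dots> \<longleftrightarrow> h' (\<theta> (h u)) \<in> S"
      using mem [of "h' (\<theta> (h u))"] h'C [of "\<theta> (h u)"] \<theta>C [of "h u"] u by simp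
    finally show ?thesis by simp
  qed
  moreover have "\<exists>u\<in>carrier G. (h' \<circ> (\<theta> \<circ> h)) u \<noteq> u"
  proof -
    obtain w where w: "w \<in> carrier H" "\<theta> w \<noteq> w" using \<theta>(3) by blast
    have "h' (\<theta> (h (h' w))) \<noteq> h' w"
    proof
      assume "h' (\<theta> (h (h' w))) = h' w"
      then have "h (h' (\<theta> w)) = h (h' w)" using h'C w by simp
      then show False using h'C \<theta>C w by simp
    qed
    then show ?thesis using h'C(1) [OF w(1)] by (intro bexI [of _ "h' w"]) simp_all
  qed
  ultimately show "\<exists>\<theta>\<in>iso G G. (\<forall>u\<in>carrier G. u \<in> S \<longleftrightarrow> \<theta> u \<in> S) \<and> (\<exists>u\<in>carrier G. \<theta> u \<noteq> u)"
    by blast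
qed

lemma iso_if_trivial_kernel:
  assumes "finite (carrier G)" "\<theta> \<in> hom G G" "\<And>u. u \<in> carrier G \<Longrightarrow> \<theta> u = \<one> \<Longrightarrow> u = \<one>"
  shows "\<theta> \<in> iso G G"
proof -
  interpret \<theta>: group_hom G G \<theta> by unfold_locales (rule assms(2))
  have inj: "inj_on \<theta> (carrier G)" using \<theta>.inj_on_one_iff assms(3) by blast
  moreover have "\<theta> ` carrier G \<subseteq> carrier G" by auto
  ultimately have "\<theta> ` carrier G = carrier G" using endo_inj_surj assms(1) by blast
  then show ?thesis using assms(2) inj by (simp add: iso_def bij_betw_def)
qed

end

subsection \<open>The quaternion group\<close>

text \<open>The automorphisms used are the orientation-preserving signed permutations of \<open>i, j, k\<close>.\<close>

definition quaternion_maps :: "(int \<times> int \<times> int \<times> int \<Rightarrow> int \<times> int \<times> int \<times> int) set" where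
  "quaternion_maps =
     {\<lambda>(a, b, c, d). (a, d, b, c), \<lambda>(a, b, c, d). (a, - d, b, - c),
      \<lambda>(a, b, c, d). (a, - d, - b, c), \<lambda>(a, b, c, d). (a, d, - b, - c),
      \<lambda>(a, b, c, d). (a, c, b, - d), \<lambda>(a, b, c, d). (a, - c, - b, - d),
      \<lambda>(a, b, c, d). (a, d, - c, b), \<lambda>(a, b, c, d). (a, - d, - c, - b),
      \<lambda>(a, b, c, d). (a, - b, d, c), \<lambda>(a, b, c, d). (a, - b, - d, - c),
      \<lambda>(a, b, c, d). (a, b, - c, - d), \<lambda>(a, b, c, d). (a, - b, c, - d),
      \<lambda>(a, b, c, d). (a, - b, - c, d)}"

lemma quaternion_maps_iso:
  assumes "\<theta> \<in> quaternion_maps" shows "\<theta> \<in> iso quaternion_group quaternion_group"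
proof (rule group.iso_if_trivial_kernel [OF group_quaternion_group])
  show "finite (carrier quaternion_group)" by (simp add: carrier_quaternion_group)
  have "\<theta> (hamilton_mult u v) = hamilton_mult (\<theta> u) (\<theta> v)" for u v
    using assms unfolding quaternion_maps_def
    by (cases u; cases v) (elim insertE emptyE; simp)
  moreover have "\<forall>u\<in>carrier quaternion_group. \<theta> u \<in> carrier quaternion_group"
    using assms unfolding quaternion_maps_def carrier_quaternion_group by (elim insertE emptyE; simp)
  moreover have "u \<otimes>\<^bsub>quaternion_group\<^esub> v = hamilton_mult u v" for u v
    by (simp add: quaternion_group_def)
  ultimately show "\<theta> \<in> hom quaternion_group quaternion_group"
    by (intro homI) simp_all
  have "\<forall>u\<in>carrier quaternion_group. \<theta> u = (1,0,0,0) \<longrightarrow> u = (1,0,0,0)"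
    using assms unfolding quaternion_maps_def carrier_quaternion_group by (elim insertE emptyE; simp)
  moreover have one: "\<one>\<^bsub>quaternion_group\<^esub> = (1,0,0,0)" by (simp add: quaternion_group_def)
  ultimately show "u = \<one>\<^bsub>quaternion_group\<^esub>"
    if "u \<in> carrier quaternion_group" "\<theta> u = \<one>\<^bsub>quaternion_group\<^esub>" for u
    using that unfolding one by blast
qed

text \<open>1 and -1 are their own inverses, so S takes at most one of each of the pairs of i, j, k
  with their negatives. If it takes three, a signed 3-cycle permutes them; if two, a signed
  transposition exchanges them; if at most one, a map negating the other two units fixes it.\<close>

lemma subsets_have_symmetries_quaternion_group: "subsets_have_symmetries quaternion_group"
  unfolding subsets_have_symmetries_def
proof (intro allI impI)
  fix S assume "S \<subseteq> carrier quaternion_group"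
    and anti: "\<forall>s\<in>S. \<forall>t\<in>S. s \<otimes>\<^bsub>quaternion_group\<^esub> t \<noteq> \<one>\<^bsub>quaternion_group\<^esub>"
  have anti': "\<not> (s \<in> S \<and> t \<in> S)" if "hamilton_mult s t = (1,0,0,0)" for s t
    using anti that by (auto simp: quaternion_group_def)
  have ex: "\<not> (1,0,0,0) \<in> S" "\<not> (-1,0,0,0) \<in> S" "\<not> ((0,1,0,0) \<in> S \<and> (0,-1,0,0) \<in> S)"
    "\<not> ((0,0,1,0) \<in> S \<and> (0,0,-1,0) \<in> S)" "\<not> ((0,0,0,1) \<in> S \<and> (0,0,0,-1) \<in> S)"
    using anti' [of "(1,0,0,0)" "(1,0,0,0)"] anti' [of "(-1,0,0,0)" "(-1,0,0,0)"]
      anti' [of "(0,1,0,0)" "(0,-1,0,0)"] anti' [of "(0,0,1,0)" "(0,0,-1,0)"]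
      anti' [of "(0,0,0,1)" "(0,0,0,-1)"] by simp_all
  have "\<exists>\<theta>\<in>quaternion_maps. \<forall>u\<in>carrier quaternion_group. u \<in> S \<longleftrightarrow> \<theta> u \<in> S"
    unfolding quaternion_maps_def carrier_quaternion_group using ex by simp argo
  moreover have "\<exists>u\<in>carrier quaternion_group. \<theta> u \<noteq> u" if "\<theta> \<in> quaternion_maps" for \<theta>
    using that unfolding quaternion_maps_def carrier_quaternion_group by (elim insertE emptyE; simp)
  ultimately show "\<exists>\<theta>\<in>iso quaternion_group quaternion_group.
      (\<forall>u\<in>carrier quaternion_group. u \<in> S \<longleftrightarrow> \<theta> u \<in> S) \<and> (\<exists>u\<in>carrier quaternion_group. \<theta> u \<noteq> u)"
    using quaternion_maps_iso by blast
qed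

subsection \<open>The group $C_3 \times C_3$\<close>

fun matrix_map :: "int \<times> int \<times> int \<times> int \<Rightarrow> int \<times> int \<Rightarrow> int \<times> int" where
  "matrix_map (a, b, c, d) (k, l) = ((a * k + b * l) mod 3, (c * k + d * l) mod 3)"

text \<open>The twelve matrices over the field of three elements with trace 0 and determinant -1,
  which are the reflections, and a generator of each of the four subgroups of order three.\<close>

definition matrices :: "(int \<times> int \<times> int \<times> int) set" where
  "matrices = {(0, 1, 1, 0), (0, 2, 2, 0), (1, 0, 0, 2), (2, 0, 0, 1), (0, 1, 2, 2), (0, 2, 1, 2), (1, 0, 1, 1), (1, 0, 1, 2), (1, 0, 2, 2), (1, 1, 0, 1), (1, 1, 0, 2), (1, 2, 0, 2), (2, 0, 1, 1), (2, 0, 2, 1), (2, 1, 0, 1), (2, 2, 0, 1)}"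

lemma mod_add_linear2:
  "(a * ((k + k') mod n) + b * ((l + l') mod n)) mod n =
     ((a * k + b * l) mod n + (a * k' + b * l') mod n) mod (n::int)"
proof -
  have "(a * ((k + k') mod n) + b * ((l + l') mod n)) mod n = (a * (k + k') + b * (l + l')) mod n"
    by (intro mod_add_cong mod_mult_cong refl mod_mod_trivial)
  also have "\<dots> = ((a * k + b * l) + (a * k' + b * l')) mod n"
    by (simp add: algebra_simps)
  also have "\<dots> = ((a * k + b * l) mod n + (a * k' + b * l') mod n) mod n"
    by (simp only: mod_add_eq)
  finally show ?thesis .
qed

lemma carrier_C3_C3:
  "carrier (integer_mod_group 3 \<times>\<times> integer_mod_group 3) =
    {(0,0), (0,1), (0,2), (1,0), (1,1), (1,2), (2,0), (2,1), (2,2)}"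
proof -
  have "{0..<3::int} = {0, 1, 2}" by auto
  then show ?thesis by (auto simp: carrier_integer_mod_group)
qed

lemma matrix_map_iso:
  assumes "M \<in> matrices"
  shows "matrix_map M \<in> iso (integer_mod_group 3 \<times>\<times> integer_mod_group 3) (integer_mod_group 3 \<times>\<times> integer_mod_group 3)"
    (is "_ \<in> iso ?H ?H")
proof (rule group.iso_if_trivial_kernel [OF group_C3_C3])
  show "finite (carrier ?H)" unfolding carrier_C3_C3 by simp
  obtain a b c d where M: "M = (a, b, c, d)" by (metis prod_cases4)
  show "matrix_map M \<in> hom ?H ?H"
  proof (rule homI)
    fix u v assume "u \<in> carrier ?H" "v \<in> carrier ?H"
    obtain k l k' l' where uv: "u = (k, l)" "v = (k', l')" by force
    show "matrix_map M (u \<otimes>\<^bsub>?H\<^esub> v) = matrix_map M u \<otimes>\<^bsub>?H\<^esub> matrix_map M v"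
      unfolding M uv mult_DirProd matrix_map.simps mult_integer_mod_group of_nat_numeral
      by (simp only: mod_add_linear2)
  qed (auto simp: M carrier_integer_mod_group)
  have "\<forall>u\<in>carrier ?H. matrix_map M u = (0, 0) \<longrightarrow> u = (0, 0)"
    using assms unfolding matrices_def carrier_C3_C3 by (elim insertE emptyE; simp)
  moreover have one: "\<one>\<^bsub>?H\<^esub> = (0, 0)" by simp
  ultimately show "u = \<one>\<^bsub>?H\<^esub>" if "u \<in> carrier ?H" "matrix_map M u = \<one>\<^bsub>?H\<^esub>" for u
    using that unfolding one by blast
qed

text \<open>S meets each of the four pairs v, -v at most once. If at most two pairs are met, some
  reflection fixes or exchanges the chosen vectors. If only the pair of f is missed, two of the
  three chosen vectors agree modulo f, and the reflection that negates f and fixes the third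
  exchanges them. If all four are met, a matrix of order three fixes one chosen vector and permutes
  the others cyclically.\<close>

lemma subsets_have_symmetries_C3_C3:
  "subsets_have_symmetries (integer_mod_group 3 \<times>\<times> integer_mod_group 3)" (is "subsets_have_symmetries ?H")
  unfolding subsets_have_symmetries_def
proof (intro allI impI)
  fix S assume "S \<subseteq> carrier ?H" and anti: "\<forall>s\<in>S. \<forall>t\<in>S. s \<otimes>\<^bsub>?H\<^esub> t \<noteq> \<one>\<^bsub>?H\<^esub>"
  have anti': "\<not> (s \<in> S \<and> t \<in> S)" if "s \<otimes>\<^bsub>?H\<^esub> t = (0, 0)" for s t
    using anti that by auto
  have ex: "\<not> (0, 0) \<in> S" "\<not> ((1, 0) \<in> S \<and> (2, 0) \<in> S)" "\<not> ((0, 1) \<in> S \<and> (0, 2) \<in> S)"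
    "\<not> ((1, 1) \<in> S \<and> (2, 2) \<in> S)" "\<not> ((1, 2) \<in> S \<and> (2, 1) \<in> S)"
    using anti' [of "(0, 0)" "(0, 0)"] anti' [of "(1, 0)" "(2, 0)"] anti' [of "(0, 1)" "(0, 2)"]
      anti' [of "(1, 1)" "(2, 2)"] anti' [of "(1, 2)" "(2, 1)"] by simp_all
  have "\<exists>M\<in>matrices. \<forall>u\<in>carrier ?H. u \<in> S \<longleftrightarrow> matrix_map M u \<in> S"
    unfolding matrices_def carrier_C3_C3 using ex by simp argo
  moreover have "\<exists>u\<in>carrier ?H. matrix_map M u \<noteq> u" if "M \<in> matrices" for M
    using that unfolding matrices_def carrier_C3_C3 by (elim insertE emptyE; simp)
  ultimately show "\<exists>\<theta>\<in>iso ?H ?H. (\<forall>u\<in>carrier ?H. u \<in> S \<longleftrightarrow> \<theta> u \<in> S) \<and> (\<exists>u\<in>carrier ?H. \<theta> u \<noteq> u)"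
    using matrix_map_iso by blast
qed

subsection \<open>The group $C_3 \times C_2^3$\<close>

text \<open>A subset without involutions and inverse pairs is a colouring of the vectors of $C_2^3$ by three
  colours. The seven nonzero vectors are the points of the Fano plane, and some point lies on two lines
  whose remaining two points have the same colour; a transvection then preserves the colouring.\<close>

lemma fano_colouring:
  assumes "c1 \<in> {A, B, C}" "c2 \<in> {A, B, C}" "c3 \<in> {A, B, C}" "c4 \<in> {A, B, C}" "c5 \<in> {A, B, C}" "c6 \<in> {A, B, C}" "c7 \<in> {A, B, C}"
  shows "c2 = c3 \<and> c6 = c7 \<or>
    c4 = c5 \<and> c6 = c7 \<or>
    c2 = c3 \<and> c4 = c5 \<or>
    c1 = c3 \<and> c5 = c7 \<or>
    c4 = c6 \<and> c5 = c7 \<or>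
    c1 = c3 \<and> c4 = c6 \<or>
    c1 = c2 \<and> c5 = c6 \<or>
    c4 = c7 \<and> c5 = c6 \<or>
    c1 = c2 \<and> c4 = c7 \<or>
    c1 = c5 \<and> c3 = c7 \<or>
    c2 = c6 \<and> c3 = c7 \<or>
    c1 = c5 \<and> c2 = c6 \<or>
    c2 = c7 \<and> c3 = c6 \<or>
    c1 = c4 \<and> c3 = c6 \<or>
    c1 = c4 \<and> c2 = c7 \<or>
    c1 = c7 \<and> c3 = c5 \<or>
    c2 = c4 \<and> c3 = c5 \<or>
    c1 = c7 \<and> c2 = c4 \<or>
    c1 = c6 \<and> c2 = c5 \<or>
    c1 = c6 \<and> c3 = c4 \<or>
    c2 = c5 \<and> c3 = c4"
  using assms unfolding insert_iff empty_iff by (smt (verit))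

text \<open>The identity on C_3 and, on C_2^3, the map sending u to u + f(u) v.\<close>

fun transvection :: "(int \<times> int \<times> int) \<times> (int \<times> int \<times> int) \<Rightarrow> int \<times> int \<times> int \<times> int \<Rightarrow> int \<times> int \<times> int \<times> int" where
  "transvection ((v1, v2, v3), (f1, f2, f3)) (k, p, q, r) =
     (k, (p + (f1 * p + f2 * q + f3 * r) * v1) mod 2, (q + (f1 * p + f2 * q + f3 * r) * v2) mod 2,
       (r + (f1 * p + f2 * q + f3 * r) * v3) mod 2)"

text \<open>All pairs of a nonzero v and a nonzero functional f with f(v) = 0, three functionals for
  each of seven points. Off the plane f = 0 the map exchanges u with u + v, the remaining points of
  two lines through v. The order is that of the alternatives in
  \<open>fano_colouring\<close>.\<close>

definition transvections :: "((int \<times> int \<times> int) \<times> (int \<times> int \<times> int)) set" where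
  "transvections = {((1, 0, 0), (0, 1, 0)), ((1, 0, 0), (0, 0, 1)), ((1, 0, 0), (0, 1, 1)), ((0, 1, 0), (1, 0, 0)), ((0, 1, 0), (0, 0, 1)), ((0, 1, 0), (1, 0, 1)), ((1, 1, 0), (1, 1, 0)), ((1, 1, 0), (0, 0, 1)), ((1, 1, 0), (1, 1, 1)), ((0, 0, 1), (1, 0, 0)), ((0, 0, 1), (0, 1, 0)), ((0, 0, 1), (1, 1, 0)), ((1, 0, 1), (0, 1, 0)), ((1, 0, 1), (1, 0, 1)), ((1, 0, 1), (1, 1, 1)), ((0, 1, 1), (1, 0, 0)), ((0, 1, 1), (0, 1, 1)), ((0, 1, 1), (1, 1, 1)), ((1, 1, 1), (1, 1, 0)), ((1, 1, 1), (1, 0, 1)), ((1, 1, 1), (0, 1, 1))}"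

lemma mod_add_linear3:
  "((t + t') mod n + (f1 * ((p + p') mod n) + f2 * ((q + q') mod n) + f3 * ((r + r') mod n)) * v) mod n =
     ((t + (f1 * p + f2 * q + f3 * r) * v) mod n + (t' + (f1 * p' + f2 * q' + f3 * r') * v) mod n) mod (n::int)"
proof -
  have "((t + t') mod n + (f1 * ((p + p') mod n) + f2 * ((q + q') mod n) + f3 * ((r + r') mod n)) * v) mod n =
      ((t + t') + (f1 * (p + p') + f2 * (q + q') + f3 * (r + r')) * v) mod n"
    by (intro mod_add_cong mod_mult_cong refl mod_mod_trivial)
  also have "\<dots> = ((t + (f1 * p + f2 * q + f3 * r) * v) + (t' + (f1 * p' + f2 * q' + f3 * r') * v)) mod n"
    by (simp add: algebra_simps)
  also have "\<dots> = ((t + (f1 * p + f2 * q + f3 * r) * v) mod n + (t' + (f1 * p' + f2 * q' + f3 * r') * v) mod n) mod n"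
    by (simp only: mod_add_eq)
  finally show ?thesis .
qed

lemma carrier_C3_C2_C2_C2:
  "carrier (integer_mod_group 3 \<times>\<times> (integer_mod_group 2 \<times>\<times> integer_mod_group 2 \<times>\<times> integer_mod_group 2)) =
    {0, 1, 2} \<times> {0, 1} \<times> {0, 1} \<times> {0, 1}"
proof -
  have "{0..<3::int} = {0, 1, 2}" "{0..<2::int} = {0, 1}" by auto
  then show ?thesis by (simp add: carrier_integer_mod_group)
qed

lemma transvection_iso:
  assumes "M \<in> transvections"
  shows "transvection M \<in> iso
    (integer_mod_group 3 \<times>\<times> (integer_mod_group 2 \<times>\<times> integer_mod_group 2 \<times>\<times> integer_mod_group 2))
    (integer_mod_group 3 \<times>\<times> (integer_mod_group 2 \<times>\<times> integer_mod_group 2 \<times>\<times> integer_mod_group 2))"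
    (is "_ \<in> iso ?H ?H")
proof (rule group.iso_if_trivial_kernel [OF group_C3_C2_C2_C2])
  show "finite (carrier ?H)" unfolding carrier_C3_C2_C2_C2 by simp
  obtain v1 v2 v3 f1 f2 f3 where M: "M = ((v1, v2, v3), (f1, f2, f3))" by (metis prod.collapse)
  show "transvection M \<in> hom ?H ?H"
  proof (rule homI)
    fix u v assume "u \<in> carrier ?H" "v \<in> carrier ?H"
    obtain k p q r where u: "u = (k, p, q, r)" by (metis prod_cases4)
    obtain k' p' q' r' where v: "v = (k', p', q', r')" by (metis prod_cases4)
    show "transvection M (u \<otimes>\<^bsub>?H\<^esub> v) = transvection M u \<otimes>\<^bsub>?H\<^esub> transvection M v"
      unfolding M u v mult_DirProd transvection.simps mult_integer_mod_group of_nat_numeral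
      by (simp only: mod_add_linear3)
  qed (auto simp: M carrier_integer_mod_group)
  have "\<forall>u\<in>carrier ?H. transvection M u = (0, 0, 0, 0) \<longrightarrow> u = (0, 0, 0, 0)"
    using assms unfolding transvections_def carrier_C3_C2_C2_C2 by (elim insertE emptyE; simp)
  moreover have one: "\<one>\<^bsub>?H\<^esub> = (0, 0, 0, 0)" by simp
  ultimately show "u = \<one>\<^bsub>?H\<^esub>" if "u \<in> carrier ?H" "transvection M u = \<one>\<^bsub>?H\<^esub>" for u
    using that unfolding one by blast
qed

lemma subsets_have_symmetries_C3_C2_C2_C2:
  "subsets_have_symmetries
    (integer_mod_group 3 \<times>\<times> (integer_mod_group 2 \<times>\<times> integer_mod_group 2 \<times>\<times> integer_mod_group 2))"
    (is "subsets_have_symmetries ?H")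
  unfolding subsets_have_symmetries_def
proof (intro allI impI)
  fix S assume "S \<subseteq> carrier ?H" and anti: "\<forall>s\<in>S. \<forall>t\<in>S. s \<otimes>\<^bsub>?H\<^esub> t \<noteq> \<one>\<^bsub>?H\<^esub>"
  have anti': "\<not> (s \<in> S \<and> t \<in> S)" if "s \<otimes>\<^bsub>?H\<^esub> t = (0, 0, 0, 0)" for s t
    using anti that by auto
  \<comment> \<open>The two lifts of a vector with nonzero C_3 coordinate are inverse to each other,
    so at most one lies in S; the colour records which.\<close>
  define c where "c p q r = ((1, p, q, r) \<in> S, (2, p, q, r) \<in> S)" for p q r :: int
  have zero: "(0, p, q, r) \<notin> S" if "p \<in> {0, 1}" "q \<in> {0, 1}" "r \<in> {0, 1}" for p q r
    using that anti' [of "(0, p, q, r)" "(0, p, q, r)"] by auto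
  have col: "c p q r \<in> {(True, False), (False, True), (False, False)}"
    if "p \<in> {0, 1}" "q \<in> {0, 1}" "r \<in> {0, 1}" for p q r
    using that anti' [of "(1, p, q, r)" "(2, p, q, r)"] by (auto simp: c_def)
  have "\<exists>M\<in>transvections. \<forall>u\<in>carrier ?H. u \<in> S \<longleftrightarrow> transvection M u \<in> S"
  proof -
    \<comment> \<open>A transvection leaves the C_3 coordinate alone, so it preserves S once it
      preserves the colour of every vector.\<close>
    have pres: ?thesis
      if M: "M \<in> transvections" and
        eq: "\<forall>p\<in>{0, 1}. \<forall>q\<in>{0, 1}. \<forall>r\<in>{0, 1}. c p q r = (\<lambda>(k, p, q, r). c p q r) (transvection M (0, p, q, r))"
      for M
    proof (intro bexI [OF _ M] ballI)
      obtain v1 v2 v3 f1 f2 f3 where M: "M = ((v1, v2, v3), (f1, f2, f3))" by (metis prod.collapse)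
      fix u assume "u \<in> carrier ?H"
      then obtain k p q r where u: "u = (k, p, q, r)" "k \<in> {0, 1, 2}" "p \<in> {0, 1}" "q \<in> {0, 1}" "r \<in> {0, 1}"
        unfolding carrier_C3_C2_C2_C2 by blast
      obtain p' q' r' where t: "transvection M (0, p, q, r) = (0, p', q', r')"
        "p' \<in> {0, 1}" "q' \<in> {0, 1}" "r' \<in> {0, 1}"
      proof -
        have "(n::int) mod 2 \<in> {0, 1}" for n by auto
        then show thesis using that M by simp
      qed
      have t': "transvection M u = (k, p', q', r')"
        using t(1) unfolding u(1) M by simp
      have "c p q r = c p' q' r'" using eq u(3-5) t(1) by auto
      then show "u \<in> S \<longleftrightarrow> transvection M u \<in> S"
        unfolding t' unfolding u(1)
        using u(2) zero [OF u(3-5)] zero [OF t(2-4)] by (auto simp: c_def)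
    qed
    have "\<exists>M\<in>transvections. \<forall>p\<in>{0, 1}. \<forall>q\<in>{0, 1}. \<forall>r\<in>{0, 1}.
        c p q r = (\<lambda>(k, p, q, r). c p q r) (transvection M (0, p, q, r))"
      \<comment> \<open>The vector (p, q, r) is the point with number p + 2 q + 4 r.\<close>
      using fano_colouring [OF col col col col col col col, of 1 0 0 0 1 0 1 1 0 0 0 1 1 0 1 0 1 1 1 1 1]
      unfolding transvections_def by simp (elim disjE; simp)
    then show ?thesis using pres by blast
  qed
  moreover have "\<exists>u\<in>carrier ?H. transvection M u \<noteq> u" if "M \<in> transvections" for M
    using that unfolding transvections_def carrier_C3_C2_C2_C2 by (elim insertE emptyE; simp)
  ultimately show "\<exists>\<theta>\<in>iso ?H ?H. (\<forall>u\<in>carrier ?H. u \<in> S \<longleftrightarrow> \<theta> u \<in> S) \<and> (\<exists>u\<in>carrier ?H. \<theta> u \<noteq> u)"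
    using transvection_iso by blast
qed

section \<open>From orders to squares, and the two directions of the equivalence\<close>

lemma (in group) square_neq_one_if_ord:
  assumes "x \<in> carrier G" "ord x > 2" shows "x \<otimes> x \<noteq> \<one>"
proof
  assume "x \<otimes> x = \<one>"
  then have "x [^] (2::nat) = \<one>" using assms(1) by (simp add: numeral_2_eq_2)
  then have "ord x dvd 2" using pow_eq_id [OF assms(1)] by blast
  then show False using assms(2) by (auto dest: dvd_imp_le)
qed

theorem theorem5p4:
  fixes G :: "('a, 'b) monoid_scheme"
    and T :: "'a set" and l :: nat and a :: "nat \<Rightarrow> 'a"
  assumes "group G" and "finite (carrier G)"
    and "T \<subseteq> carrier G" and "generate G T = carrier G"
    and "five_product_avoiding G T"
    and "bij_betw a {1..l} T"
    and "\<forall>t\<in>T. group.ord G t > 2"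
    and "\<forall>i. 1 \<le> i \<and> i < l \<longrightarrow> group.ord G (a (i + 1) \<otimes>\<^bsub>G\<^esub> inv\<^bsub>G\<^esub> (a i)) > 2"
  shows "admits_ORR G \<longleftrightarrow>
    \<not> G \<cong> quaternion_group \<and>
    \<not> G \<cong> integer_mod_group 3 \<times>\<times> (integer_mod_group 2 \<times>\<times> integer_mod_group 2 \<times>\<times> integer_mod_group 2) \<and>
    \<not> G \<cong> integer_mod_group 3 \<times>\<times> integer_mod_group 3"
proof -
  interpret group G by fact
  have letter_square: "t \<otimes>\<^bsub>G\<^esub> t \<noteq> \<one>\<^bsub>G\<^esub>" if "t \<in> T" for t
    using square_neq_one_if_ord assms(3,7) that by blast
  interpret avoiding G T
    by unfold_locales (use assms(3,5) letter_square in auto)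
  have inj: "inj_on a {1..l}" and T: "T = a ` {1..l}"
    using assms(6) by (auto simp: bij_betw_def)
  have aT: "a i \<in> T" if "1 \<le> i" "i \<le> l" for i using T that by auto
  have quotient_square: "(a (Suc i) \<otimes>\<^bsub>G\<^esub> inv\<^bsub>G\<^esub> (a i)) \<otimes>\<^bsub>G\<^esub> (a (Suc i) \<otimes>\<^bsub>G\<^esub> inv\<^bsub>G\<^esub> (a i)) \<noteq> \<one>\<^bsub>G\<^esub>"
    if "1 \<le> i" "i < l" for i
    by (rule square_neq_one_if_ord) (use assms(8) aT [of i] aT [of "Suc i"] that in auto)
  show ?thesis
  proof
    assume "admits_ORR G"
    moreover have "\<not> admits_ORR G" if "G \<cong> quaternion_group"
      using no_ORR_if_subsets_have_symmetries subsets_have_symmetries_iso [OF group_quaternion_group that]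
        subsets_have_symmetries_quaternion_group by blast
    moreover have "\<not> admits_ORR G"
      if "G \<cong> integer_mod_group 3 \<times>\<times> (integer_mod_group 2 \<times>\<times> integer_mod_group 2 \<times>\<times> integer_mod_group 2)"
      using no_ORR_if_subsets_have_symmetries subsets_have_symmetries_iso [OF group_C3_C2_C2_C2 that]
        subsets_have_symmetries_C3_C2_C2_C2 by blast
    moreover have "\<not> admits_ORR G" if "G \<cong> integer_mod_group 3 \<times>\<times> integer_mod_group 3"
      using no_ORR_if_subsets_have_symmetries subsets_have_symmetries_iso [OF group_C3_C3 that]
        subsets_have_symmetries_C3_C3 by blast
    ultimately show "\<not> G \<cong> quaternion_group \<and>
      \<not> G \<cong> integer_mod_group 3 \<times>\<times> (integer_mod_group 2 \<times>\<times> integer_mod_group 2 \<times>\<times> integer_mod_group 2) \<and>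
      \<not> G \<cong> integer_mod_group 3 \<times>\<times> integer_mod_group 3"
      by blast
  next
    assume no_iso: "\<not> G \<cong> quaternion_group \<and>
      \<not> G \<cong> integer_mod_group 3 \<times>\<times> (integer_mod_group 2 \<times>\<times> integer_mod_group 2 \<times>\<times> integer_mod_group 2) \<and>
      \<not> G \<cong> integer_mod_group 3 \<times>\<times> integer_mod_group 3"
    consider "l \<le> 1" | "l = 2" | "l = 3" | "4 \<le> l" by linarith
    then show "admits_ORR G"
    proof cases
      case 1
      have "i = 1" if "i \<in> {1..l}" for i using 1 that by simp
      then have "T \<subseteq> {a 1}" unfolding T by blast
      then show ?thesis using ORR_of_at_most_one [OF assms(4)] by blast
    next
      case 2
      then have I: "{1..l} = {1, 2}" by auto
      have T2: "T = {a 1, a 2}" unfolding T I by simp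
      have "a 1 \<noteq> a 2" using inj unfolding I by simp
      then show ?thesis
        using ORR_of_two [OF assms(4) T2] quotient_square [of 1] no_iso 2 by (simp add: numeral_2_eq_2)
    next
      case 3
      then have I: "{1..l} = {1, 2, 3}" by auto
      have T3: "T = {a 1, a 2, a 3}" unfolding T I by simp
      have d: "distinct [a 1, a 2, a 3]" using inj unfolding I by simp
      have q: "(a 2 \<otimes>\<^bsub>G\<^esub> inv\<^bsub>G\<^esub> (a 1)) \<otimes>\<^bsub>G\<^esub> (a 2 \<otimes>\<^bsub>G\<^esub> inv\<^bsub>G\<^esub> (a 1)) \<noteq> \<one>\<^bsub>G\<^esub>"
        "(a 3 \<otimes>\<^bsub>G\<^esub> inv\<^bsub>G\<^esub> (a 2)) \<otimes>\<^bsub>G\<^esub> (a 3 \<otimes>\<^bsub>G\<^esub> inv\<^bsub>G\<^esub> (a 2)) \<noteq> \<one>\<^bsub>G\<^esub>"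
        using quotient_square [of 1] quotient_square [of 2] 3 by (simp_all add: numeral_2_eq_2 numeral_3_eq_3)
      show ?thesis using ORR_of_three [OF assms(4) T3 d q] no_iso by blast
    next
      case 4
      then show ?thesis using ORR_of_long_path [OF assms(4) inj T quotient_square] by blast
    qed
  qed
qed

end
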